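(* Assume the following. (a) The finite element spaces satisfy the compatibility conditions given in the context, and $\Phi$ is either strictly convex or strictly concave on $(0,+\infty)$. (b) Either $\frac13\le S^-_\phi\le S^+_\phi<1$ or $1<S^-_\phi\le S^+_\phi\le3$. (c) $\lambda:=\inf_{r>0}\left\{1+\frac{r\mu''(r)}{2\mu'(r)}\right\}>-\infty$, and either (i) $\Phi$ is convex and $\mu''(r)\le0$ for all $r>0$, or (ii) $\Phi$ is concave and $\mu''(r)\ge\frac{4\mu'(r)^2}{\mu(r)}$ for all $r>0$. Let $c_h(t)$ be the (unique global) solution in $C_h^+$ of $\frac{dc_h}{dt}=|Du_h[c_h]|^2-c_h$, $c_h(0)=c_{h,0}\in C_h^+$, and let $\bar u_h\in W_h$ be the solution of $$\int_\Omega A(D\bar u_h):Dv_h\,dx=F(v_h)\quad\forall v_h\in W_h .$$ Then there exists a constant $C>0$, independent of $t$, such that $$\|V(Du_h[c_h(t)])-V(D\bar u_h)\|_{L^2(\Omega)}\le C e^{-\lambda t}\sqrt{d_h(0)}\qquad\forall t\ge 0.$$ Therefore, if $\lambda>0$, $$\lim_{t\to\infty}\|V(Du_h[c_h(t)])-V(D\bar u_h)\|_{L^2(\Omega)}=0.$$ This holds in both the scalar and the incompressible vector-valued case.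
   Context: $\Omega\subset\mathbb{R}^d$, $d=2,3$, is an open bounded domain. $\phi:[0,+\infty)\to[0,+\infty)$ is an N-function: convex, continuous, $\phi(0)=0$, $\phi(r)>0$ for $r>0$, $\lim_{r\to0}\phi(r)/r=0$, $\lim_{r\to+\infty}\phi(r)/r=+\infty$. Standing assumptions: $\phi\in C^1([0,+\infty))\cap C^3((0,+\infty))$; $\inf_{r>0}\frac{r\phi'(r)}{\phi(r)}>1$ and $\sup_{r>0}\frac{r\phi'(r)}{\phi(r)}<+\infty$. Set $\Phi(r):=\phi(\sqrt r)$, $\mu(r):=2\Phi'(r)=\phi'(\sqrt r)/\sqrt r$ for $r>0$ (strict convexity of $\Phi$ means $\mu'>0$, strict concavity means $\mu'<0$ on $(0,+\infty)$), and $$S^-_\phi:=\inf_{r>0}\frac{r\phi''(r)}{\phi'(r)},\qquad S^+_\phi:=\sup_{r>0}\frac{r\phi''(r)}{\phi'(r)}.$$ Finite element spaces: $C_h$, $U_h\subset H^1_0(\Omega)$, $\boldsymbol U_h\subset H^1_0(\Omega;\mathbb{R}^d)$, $Q_h\subset Q:=\{p\in L^2(\Omega):\int_\Omega p\,dx=0\}$ are finite-dimensional (finite element) spaces of functions on $\Omega$. Write $\varepsilon(\boldsymbol u):=\tfrac12(\nabla\boldsymbol u+\nabla\boldsymbol u^T)$. Compatibility conditions: $C_h\subset L^\infty(\Omega)$; $|\nabla u_h|^2\in C_h$ for all $u_h\in U_h$; $|\varepsilon(\boldsymbol u_h)|^2\in C_h$ for all $\boldsymbol u_h\in\boldsymbol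 U_h$; and $\boldsymbol U_h\times Q_h$ is an inf-sup stable pair for the weighted Stokes system (the last two conditions concern the vector-valued case). Let $W_h:=U_h$, $D:=\nabla$, $N:=1$ in the scalar case; $W_h:=\{\boldsymbol u_h\in\boldsymbol U_h:\int_\Omega q\,\nabla\cdot\boldsymbol u_h\,dx=0\ \forall q\in Q_h\}$, $D:=\varepsilon$, $N:=d$ in the incompressible vector-valued case. $P:Q$ denotes the Euclidean/Frobenius inner product. $F$ is a bounded linear functional on $H^1_0(\Omega)$ (scalar case) or $H^1_0(\Omega;\mathbb{R}^d)$ (vector case). $C_h^+:=\{c_h\in C_h:\operatorname{ess\,inf}_{x\in\Omega}c_h(x)>0\}$. For $c_h\in C_h^+$, $u_h[c_h]\in W_h$ denotes the unique solution of $\int_\Omega\mu(c_h)\,Du_h[c_h]:Dv_h\,dx=F(v_h)$ for all $v_h\in W_h$. For $P\in\mathbb{R}^{Nd}$: $A(P):=\mu(|P|^2)P=\frac{\phi'(|P|)}{|P|}P$ and $V(P):=\sqrt{\mu(|P|^2)}\,P$, with continuous extensions $A(0)=0$, $V(0)=0$. Finally, $$d_h(t):=\frac12\int_\Omega|\mu'(c_h(t))|\,\big(c_h(t)-|Du_h[c_h(t)]|^2\big)^2\,dx .$$ *)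

theory Defs
  imports "HOL-Analysis.Analysis" "HOL-Probability.Essential_Supremum"
begin

section \<open>Lebesgue spaces on a domain\<close>

text \<open>
  Elements of Lebesgue and Sobolev spaces are represented by functions on the whole space; only
  their values on \<open>\<Omega>\<close>, up to null sets, matter. Integrals are Bochner integrals with respect to
  \<^term>\<open>lebesgue_on \<Omega>\<close>. The norm and inner product of \<^typ>\<open>real ^ 'd ^ 'd\<close> are the Frobenius ones.
\<close>

definition L2_on :: "(real ^ 'd) set \<Rightarrow> (real ^ 'd \<Rightarrow> 'b::euclidean_space) \<Rightarrow> bool" where
  "L2_on \<Omega> f \<longleftrightarrow> f \<in> borel_measurable (lebesgue_on \<Omega>)
     \<and> integrable (lebesgue_on \<Omega>) (\<lambda>x. (norm (f x))\<^sup>2)"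

text \<open>Only meaningful together with \<^const>\<open>L2_on\<close>, since the integral defaults to 0.\<close>
definition L2_norm :: "(real ^ 'd) set \<Rightarrow> (real ^ 'd \<Rightarrow> 'b::euclidean_space) \<Rightarrow> real" where
  "L2_norm \<Omega> f = sqrt (LINT x|lebesgue_on \<Omega>. (norm (f x))\<^sup>2)"

definition Linf_norm :: "(real ^ 'd) set \<Rightarrow> (real ^ 'd \<Rightarrow> real) \<Rightarrow> ereal" where
  "Linf_norm \<Omega> f = esssup (lebesgue_on \<Omega>) (\<lambda>x. ereal \<bar>f x\<bar>)"

definition Linf_on :: "(real ^ 'd) set \<Rightarrow> (real ^ 'd \<Rightarrow> real) \<Rightarrow> bool" where
  "Linf_on \<Omega> f \<longleftrightarrow> f \<in> borel_measurable (lebesgue_on \<Omega>) \<and> Linf_norm \<Omega> f < \<infinity>"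

definition ess_inf :: "(real ^ 'd) set \<Rightarrow> (real ^ 'd \<Rightarrow> real) \<Rightarrow> ereal" where
  "ess_inf \<Omega> f = - esssup (lebesgue_on \<Omega>) (\<lambda>x. - ereal (f x))"


section \<open>Sobolev spaces\<close>

definition partial_deriv :: "'d \<Rightarrow> (real ^ 'd \<Rightarrow> real) \<Rightarrow> real ^ 'd \<Rightarrow> real" where
  "partial_deriv i f x = frechet_derivative f (at x) (axis i 1)"

definition smooth :: "(real ^ 'd \<Rightarrow> real) \<Rightarrow> bool" where
  "smooth f \<longleftrightarrow> (\<forall>is. foldr partial_deriv is f differentiable_on UNIV)"

definition test_functions :: "(real ^ 'd) set \<Rightarrow> (real ^ 'd \<Rightarrow> real) set" where
  "test_functions \<Omega> =
     {\<psi>. smooth \<psi> \<and> compact (closure {x. \<psi> x \<noteq> 0}) \<and> closure {x. \<psi> x \<noteq> 0} \<subseteq> \<Omega>}"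

definition is_weak_grad ::
    "(real ^ 'd) set \<Rightarrow> (real ^ 'd \<Rightarrow> real) \<Rightarrow> (real ^ 'd \<Rightarrow> real ^ 'd) \<Rightarrow> bool" where
  "is_weak_grad \<Omega> u g \<longleftrightarrow> L2_on \<Omega> g \<and>
     (\<forall>\<psi>\<in>test_functions \<Omega>. \<forall>i.
        (LINT x|lebesgue_on \<Omega>. u x * partial_deriv i \<psi> x)
          = - (LINT x|lebesgue_on \<Omega>. g x $ i * \<psi> x))"

definition H1 :: "(real ^ 'd) set \<Rightarrow> (real ^ 'd \<Rightarrow> real) set" where
  "H1 \<Omega> = {u. L2_on \<Omega> u \<and> (\<exists>g. is_weak_grad \<Omega> u g)}"

text \<open>The weak gradient is unique up to null sets; a representative is chosen.\<close>
definition weak_grad :: "(real ^ 'd) set \<Rightarrow> (real ^ 'd \<Rightarrow> real) \<Rightarrow> real ^ 'd \<Rightarrow> real ^ 'd" where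
  "weak_grad \<Omega> u = (SOME g. is_weak_grad \<Omega> u g)"

definition H1_norm :: "(real ^ 'd) set \<Rightarrow> (real ^ 'd \<Rightarrow> real) \<Rightarrow> real" where
  "H1_norm \<Omega> u = sqrt ((L2_norm \<Omega> u)\<^sup>2 + (L2_norm \<Omega> (weak_grad \<Omega> u))\<^sup>2)"

text \<open>The closure of the test functions in \<open>H\<^sup>1(\<Omega>)\<close>.\<close>
definition H10 :: "(real ^ 'd) set \<Rightarrow> (real ^ 'd \<Rightarrow> real) set" where
  "H10 \<Omega> = {u \<in> H1 \<Omega>. \<exists>\<psi>. (\<forall>n. \<psi> n \<in> test_functions \<Omega>)
     \<and> (\<lambda>n. H1_norm \<Omega> (\<lambda>x. u x - \<psi> n x)) \<longlonglongrightarrow> 0}"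

definition H10_vec :: "(real ^ 'd) set \<Rightarrow> (real ^ 'd \<Rightarrow> real ^ 'd) set" where
  "H10_vec \<Omega> = {u. \<forall>i. (\<lambda>x. u x $ i) \<in> H10 \<Omega>}"

text \<open>Row \<open>i\<close> is the weak gradient of the \<open>i\<close>-th component.\<close>
definition weak_jacobian ::
    "(real ^ 'd) set \<Rightarrow> (real ^ 'd \<Rightarrow> real ^ 'd) \<Rightarrow> real ^ 'd \<Rightarrow> real ^ 'd ^ 'd" where
  "weak_jacobian \<Omega> u x = (\<chi> i. weak_grad \<Omega> (\<lambda>y. u y $ i) x)"

definition sym_grad ::
    "(real ^ 'd) set \<Rightarrow> (real ^ 'd \<Rightarrow> real ^ 'd) \<Rightarrow> real ^ 'd \<Rightarrow> real ^ 'd ^ 'd" where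
  "sym_grad \<Omega> u x = (1/2) *\<^sub>R (weak_jacobian \<Omega> u x + transpose (weak_jacobian \<Omega> u x))"

definition weak_div :: "(real ^ 'd) set \<Rightarrow> (real ^ 'd \<Rightarrow> real ^ 'd) \<Rightarrow> real ^ 'd \<Rightarrow> real" where
  "weak_div \<Omega> u x = trace (weak_jacobian \<Omega> u x)"

definition H1_norm_vec :: "(real ^ 'd) set \<Rightarrow> (real ^ 'd \<Rightarrow> real ^ 'd) \<Rightarrow> real" where
  "H1_norm_vec \<Omega> u = sqrt ((L2_norm \<Omega> u)\<^sup>2 + (L2_norm \<Omega> (weak_jacobian \<Omega> u))\<^sup>2)"

definition bounded_functional_on ::
    "('a \<Rightarrow> 'b::real_vector) set \<Rightarrow> (('a \<Rightarrow> 'b) \<Rightarrow> real) \<Rightarrow> (('a \<Rightarrow> 'b) \<Rightarrow> real) \<Rightarrow> bool" where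
  "bounded_functional_on X N F \<longleftrightarrow>
     (\<forall>u\<in>X. \<forall>v\<in>X. F (\<lambda>x. u x + v x) = F u + F v) \<and>
     (\<forall>a. \<forall>u\<in>X. F (\<lambda>x. a *\<^sub>R u x) = a * F u) \<and>
     (\<exists>K. \<forall>u\<in>X. \<bar>F u\<bar> \<le> K * N u)"


section \<open>The N-function and derived quantities\<close>

text \<open>
  \<open>\<phi>\<close> is only considered on \<open>[0,\<infinity>)\<close>; its values on negative reals are irrelevant. At points
  \<open>r > 0\<close>, \<^term>\<open>deriv \<phi> r\<close> is the ordinary derivative.
\<close>

definition N_function :: "(real \<Rightarrow> real) \<Rightarrow> bool" where
  "N_function \<phi> \<longleftrightarrow> convex_on {0..} \<phi> \<and> continuous_on {0..} \<phi> \<and> \<phi> 0 = 0 \<and> (\<forall>r>0. \<phi> r > 0)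
     \<and> ((\<lambda>r. \<phi> r / r) \<longlongrightarrow> 0) (at_right 0) \<and> filterlim (\<lambda>r. \<phi> r / r) at_top at_top"

definition C1_closed_half_line :: "(real \<Rightarrow> real) \<Rightarrow> bool" where
  "C1_closed_half_line \<phi> \<longleftrightarrow> (\<exists>\<phi>'. continuous_on {0..} \<phi>' \<and>
     (\<forall>r\<ge>0. (\<phi> has_real_derivative \<phi>' r) (at r within {0..})))"

definition C3_open_half_line :: "(real \<Rightarrow> real) \<Rightarrow> bool" where
  "C3_open_half_line \<phi> \<longleftrightarrow> (\<forall>k<3. \<forall>r>0. (deriv ^^ k) \<phi> differentiable (at r))
     \<and> continuous_on {0<..} ((deriv ^^ 3) \<phi>)"

definition standing_assumptions :: "(real \<Rightarrow> real) \<Rightarrow> bool" where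
  "standing_assumptions \<phi> \<longleftrightarrow> N_function \<phi> \<and> C1_closed_half_line \<phi> \<and> C3_open_half_line \<phi>
     \<and> (INF r\<in>{0<..}. ereal (r * deriv \<phi> r / \<phi> r)) > 1
     \<and> (SUP r\<in>{0<..}. ereal (r * deriv \<phi> r / \<phi> r)) < \<infinity>"

definition Phi :: "(real \<Rightarrow> real) \<Rightarrow> real \<Rightarrow> real" where
  "Phi \<phi> r = \<phi> (sqrt r)"

definition mu :: "(real \<Rightarrow> real) \<Rightarrow> real \<Rightarrow> real" where
  "mu \<phi> r = 2 * deriv (Phi \<phi>) r"

lemma mu_eq:
  assumes "C3_open_half_line \<phi>" "r > 0"
  shows "mu \<phi> r = deriv \<phi> (sqrt r) / sqrt r"
proof -
  have "\<forall>s>0. (deriv ^^ 0) \<phi> differentiable (at s)"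
    using assms(1) unfolding C3_open_half_line_def by (metis zero_less_numeral)
  then have "\<phi> differentiable (at (sqrt r))"
    using assms(2) by simp
  then have "(\<phi> has_real_derivative deriv \<phi> (sqrt r)) (at (sqrt r))"
    by (metis DERIV_deriv_iff_real_differentiable)
  moreover have "(sqrt has_real_derivative inverse (sqrt r) / 2) (at r)"
    using DERIV_real_sqrt[OF assms(2)] .
  ultimately have "((\<lambda>r. \<phi> (sqrt r)) has_real_derivative
      deriv \<phi> (sqrt r) * (inverse (sqrt r) / 2)) (at r)"
    using DERIV_chain2[where f = \<phi> and g = sqrt] by blast
  then have "deriv (Phi \<phi>) r = deriv \<phi> (sqrt r) * (inverse (sqrt r) / 2)"
    unfolding Phi_def by (rule DERIV_imp_deriv)
  then show ?thesis
    unfolding mu_def by (simp add: field_simps)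
qed

definition Phi_strictly_convex :: "(real \<Rightarrow> real) \<Rightarrow> bool" where
  "Phi_strictly_convex \<phi> \<longleftrightarrow> (\<forall>r>0. deriv (mu \<phi>) r > 0)"

definition Phi_strictly_concave :: "(real \<Rightarrow> real) \<Rightarrow> bool" where
  "Phi_strictly_concave \<phi> \<longleftrightarrow> (\<forall>r>0. deriv (mu \<phi>) r < 0)"

definition S_minus :: "(real \<Rightarrow> real) \<Rightarrow> ereal" where
  "S_minus \<phi> = (INF r\<in>{0<..}. ereal (r * deriv (deriv \<phi>) r / deriv \<phi> r))"

definition S_plus :: "(real \<Rightarrow> real) \<Rightarrow> ereal" where
  "S_plus \<phi> = (SUP r\<in>{0<..}. ereal (r * deriv (deriv \<phi>) r / deriv \<phi> r))"

definition decay_rate :: "(real \<Rightarrow> real) \<Rightarrow> ereal" where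
  "decay_rate \<phi> =
     (INF r\<in>{0<..}. ereal (1 + r * deriv (deriv (mu \<phi>)) r / (2 * deriv (mu \<phi>) r)))"

text \<open>
  At \<open>P = 0\<close> both maps below evaluate to 0, whatever \<open>mu \<phi> 0\<close> is, so they agree with the continuous
  extensions \<open>A(0) = V(0) = 0\<close>.
\<close>

definition A_map :: "(real \<Rightarrow> real) \<Rightarrow> 'm::euclidean_space \<Rightarrow> 'm" where
  "A_map \<phi> P = mu \<phi> ((norm P)\<^sup>2) *\<^sub>R P"

definition V_map :: "(real \<Rightarrow> real) \<Rightarrow> 'm::euclidean_space \<Rightarrow> 'm" where
  "V_map \<phi> P = sqrt (mu \<phi> ((norm P)\<^sup>2)) *\<^sub>R P"


section \<open>Finite element spaces\<close>

text \<open>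
  A finite-dimensional space of functions (modulo null sets) is given by representatives forming a
  finite-dimensional space of functions in the pointwise sense.
\<close>

definition fin_dim_fun_space :: "('a \<Rightarrow> 'b::real_vector) set \<Rightarrow> bool" where
  "fin_dim_fun_space S \<longleftrightarrow>
     (\<lambda>x. 0) \<in> S \<and> (\<forall>f\<in>S. \<forall>g\<in>S. (\<lambda>x. f x + g x) \<in> S) \<and> (\<forall>a. \<forall>f\<in>S. (\<lambda>x. a *\<^sub>R f x) \<in> S) \<and>
     (\<exists>B. finite B \<and> B \<subseteq> S \<and> (\<forall>f\<in>S. \<exists>a. f = (\<lambda>x. \<Sum>b\<in>B. a b *\<^sub>R b x)))"

definition coefficient_space :: "(real ^ 'd) set \<Rightarrow> (real ^ 'd \<Rightarrow> real) set \<Rightarrow> bool" where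
  "coefficient_space \<Omega> Ch \<longleftrightarrow> fin_dim_fun_space Ch \<and> (\<forall>c\<in>Ch. Linf_on \<Omega> c)"

text \<open>\<open>|D u|\<^sup>2\<close> belongs to \<open>Ch\<close>, as a class modulo null sets, for all \<open>u \<in> Uh\<close>.\<close>
definition squares_in ::
    "(real ^ 'd) set \<Rightarrow> ((real ^ 'd \<Rightarrow> 'v) \<Rightarrow> real ^ 'd \<Rightarrow> 'm::euclidean_space) \<Rightarrow>
     (real ^ 'd \<Rightarrow> 'v) set \<Rightarrow> (real ^ 'd \<Rightarrow> real) set \<Rightarrow> bool" where
  "squares_in \<Omega> D Uh Ch \<longleftrightarrow>
     (\<forall>u\<in>Uh. \<exists>c\<in>Ch. AE x in lebesgue_on \<Omega>. c x = (norm (D u x))\<^sup>2)"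

text \<open>
  The discrete inf-sup (LBB) condition. The weight \<open>\<mu>(c)\<close>, \<open>c \<in> C\<^sub>h\<^sup>+\<close>, is bounded above and away
  from 0 and does not enter the divergence constraint.
\<close>
definition inf_sup_stable ::
    "(real ^ 'd) set \<Rightarrow> (real ^ 'd \<Rightarrow> real ^ 'd) set \<Rightarrow> (real ^ 'd \<Rightarrow> real) set \<Rightarrow> bool" where
  "inf_sup_stable \<Omega> Uh Qh \<longleftrightarrow>
     (INF q\<in>{q\<in>Qh. L2_norm \<Omega> q \<noteq> 0}. SUP v\<in>{v\<in>Uh. H1_norm_vec \<Omega> v \<noteq> 0}.
        ereal ((LINT x|lebesgue_on \<Omega>. q x * weak_div \<Omega> v x)
                 / (H1_norm_vec \<Omega> v * L2_norm \<Omega> q))) > 0"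

definition scalar_spaces ::
    "(real ^ 'd) set \<Rightarrow> (real ^ 'd \<Rightarrow> real) set \<Rightarrow> (real ^ 'd \<Rightarrow> real) set \<Rightarrow> bool" where
  "scalar_spaces \<Omega> Ch Uh \<longleftrightarrow> coefficient_space \<Omega> Ch \<and>
     fin_dim_fun_space Uh \<and> Uh \<subseteq> H10 \<Omega> \<and> squares_in \<Omega> (weak_grad \<Omega>) Uh Ch"

definition vector_spaces ::
    "(real ^ 'd) set \<Rightarrow> (real ^ 'd \<Rightarrow> real) set \<Rightarrow> (real ^ 'd \<Rightarrow> real ^ 'd) set \<Rightarrow>
     (real ^ 'd \<Rightarrow> real) set \<Rightarrow> bool" where
  "vector_spaces \<Omega> Ch Uh Qh \<longleftrightarrow> coefficient_space \<Omega> Ch \<and>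
     fin_dim_fun_space Uh \<and> Uh \<subseteq> H10_vec \<Omega> \<and>
     fin_dim_fun_space Qh \<and> (\<forall>q\<in>Qh. L2_on \<Omega> q \<and> (LINT x|lebesgue_on \<Omega>. q x) = 0) \<and>
     squares_in \<Omega> (sym_grad \<Omega>) Uh Ch \<and> inf_sup_stable \<Omega> Uh Qh"

definition discretely_div_free ::
    "(real ^ 'd) set \<Rightarrow> (real ^ 'd \<Rightarrow> real ^ 'd) set \<Rightarrow> (real ^ 'd \<Rightarrow> real) set \<Rightarrow>
     (real ^ 'd \<Rightarrow> real ^ 'd) set" where
  "discretely_div_free \<Omega> Uh Qh =
     {v\<in>Uh. \<forall>q\<in>Qh. (LINT x|lebesgue_on \<Omega>. q x * weak_div \<Omega> v x) = 0}"


section \<open>The discrete problems and the flow\<close>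

text \<open>
  From here on, \<open>D\<close> is \<^term>\<open>weak_grad \<Omega>\<close> or \<^term>\<open>sym_grad \<Omega>\<close>, and \<open>Wh\<close> is \<open>Uh\<close> or
  \<^term>\<open>discretely_div_free \<Omega> Uh Qh\<close>.
\<close>

definition positive_cone :: "(real ^ 'd) set \<Rightarrow> (real ^ 'd \<Rightarrow> real) set \<Rightarrow> (real ^ 'd \<Rightarrow> real) set" where
  "positive_cone \<Omega> Ch = {c\<in>Ch. ess_inf \<Omega> c > 0}"

definition weighted_solution ::
    "(real ^ 'd) set \<Rightarrow> (real \<Rightarrow> real) \<Rightarrow> (real ^ 'd \<Rightarrow> 'v) set \<Rightarrow>
     ((real ^ 'd \<Rightarrow> 'v) \<Rightarrow> real ^ 'd \<Rightarrow> 'm::euclidean_space) \<Rightarrow> ((real ^ 'd \<Rightarrow> 'v) \<Rightarrow> real) \<Rightarrow>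
     (real ^ 'd \<Rightarrow> real) \<Rightarrow> (real ^ 'd \<Rightarrow> 'v) \<Rightarrow> bool" where
  "weighted_solution \<Omega> \<phi> Wh D F c u \<longleftrightarrow> u \<in> Wh \<and>
     (\<forall>v\<in>Wh. (LINT x|lebesgue_on \<Omega>. mu \<phi> (c x) * (D u x \<bullet> D v x)) = F v)"

definition nonlinear_solution ::
    "(real ^ 'd) set \<Rightarrow> (real \<Rightarrow> real) \<Rightarrow> (real ^ 'd \<Rightarrow> 'v) set \<Rightarrow>
     ((real ^ 'd \<Rightarrow> 'v) \<Rightarrow> real ^ 'd \<Rightarrow> 'm::euclidean_space) \<Rightarrow> ((real ^ 'd \<Rightarrow> 'v) \<Rightarrow> real) \<Rightarrow>
     (real ^ 'd \<Rightarrow> 'v) \<Rightarrow> bool" where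
  "nonlinear_solution \<Omega> \<phi> Wh D F u \<longleftrightarrow> u \<in> Wh \<and>
     (\<forall>v\<in>Wh. (LINT x|lebesgue_on \<Omega>. A_map \<phi> (D u x) \<bullet> D v x) = F v)"

text \<open>
  The flow \<open>dc/dt = |D u[c]|\<^sup>2 - c\<close> in \<open>C\<^sub>h\<^sup>+\<close> for \<open>t \<ge> 0\<close>, where \<open>u\<close> is the solution map
  \<open>c \<mapsto> u[c]\<close>. The time derivative is taken in the sup norm; all norms on the
  finite-dimensional space \<open>Ch\<close> (modulo null sets) are equivalent.
\<close>
definition flow_solution ::
    "(real ^ 'd) set \<Rightarrow> (real ^ 'd \<Rightarrow> real) set \<Rightarrow>
     ((real ^ 'd \<Rightarrow> 'v) \<Rightarrow> real ^ 'd \<Rightarrow> 'm::euclidean_space) \<Rightarrow>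
     ((real ^ 'd \<Rightarrow> real) \<Rightarrow> real ^ 'd \<Rightarrow> 'v) \<Rightarrow>
     (real ^ 'd \<Rightarrow> real) \<Rightarrow> (real \<Rightarrow> real ^ 'd \<Rightarrow> real) \<Rightarrow> bool" where
  "flow_solution \<Omega> Ch D u c0 c \<longleftrightarrow> c 0 = c0 \<and> (\<forall>t\<ge>0. c t \<in> positive_cone \<Omega> Ch) \<and>
     (\<forall>t\<ge>0. ((\<lambda>s. Linf_norm \<Omega> (\<lambda>x. (c s x - c t x) / (s - t)
                     - ((norm (D (u (c t)) x))\<^sup>2 - c t x))) \<longlongrightarrow> 0) (at t within {0..}))"

definition dissipation ::
    "(real ^ 'd) set \<Rightarrow> (real \<Rightarrow> real) \<Rightarrow>
     ((real ^ 'd \<Rightarrow> 'v) \<Rightarrow> real ^ 'd \<Rightarrow> 'm::euclidean_space) \<Rightarrow>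
     ((real ^ 'd \<Rightarrow> real) \<Rightarrow> real ^ 'd \<Rightarrow> 'v) \<Rightarrow>
     (real \<Rightarrow> real ^ 'd \<Rightarrow> real) \<Rightarrow> real \<Rightarrow> real" where
  "dissipation \<Omega> \<phi> D u c t = 1/2 * (LINT x|lebesgue_on \<Omega>.
     \<bar>deriv (mu \<phi>) (c t x)\<bar> * (c t x - (norm (D (u (c t)) x))\<^sup>2)\<^sup>2)"

definition V_error ::
    "(real \<Rightarrow> real) \<Rightarrow> ((real ^ 'd \<Rightarrow> 'v) \<Rightarrow> real ^ 'd \<Rightarrow> 'm::euclidean_space) \<Rightarrow>
     (real ^ 'd \<Rightarrow> 'v) \<Rightarrow> (real ^ 'd \<Rightarrow> 'v) \<Rightarrow> real ^ 'd \<Rightarrow> 'm" where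
  "V_error \<phi> D u w x = V_map \<phi> (D u x) - V_map \<phi> (D w x)"

end

theory Submission
  imports Defs
begin

text \<open>
  Two facts give the estimate: the dissipation \<open>d\<close> decays like \<open>exp (-2 \<lambda> t)\<close>, and the squared error
  \<open>\<parallel>V(D u) - V(D u\<^sub>*)\<parallel>\<^sup>2\<close> is at most a constant times \<open>d\<close> at the same time, where \<open>u\<^sub>*\<close> is the
  discrete minimiser.

  Decay. Write \<open>q = |D u|\<^sup>2\<close>, \<open>r = c - q\<close> and let \<open>\<sigma>\<close> be the sign of \<open>\<mu>'\<close>, so that \<open>c' = -r\<close> and
  \<open>d = 1/2 \<integral> \<sigma> \<mu>'(c) r\<^sup>2\<close>. Formally,
  \<open>d' = \<integral> (- \<sigma>/2 \<mu>''(c) r\<^sup>3 - \<sigma> \<mu>'(c) r\<^sup>2) - 2 \<sigma> \<integral> \<mu>(c) |D u'|\<^sup>2\<close>, where the last term comes from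
  the differentiated equation for \<open>u\<close>. In the convex case this term is nonpositive; in the concave case
  the same equation and Young's inequality bound \<open>\<integral> \<mu>(c) |D u'|\<^sup>2\<close> by \<open>\<integral> \<mu>'(c)\<^sup>2 r\<^sup>2 q / \<mu>(c)\<close>. Since
  \<open>0 \<le> q\<close>, the sign conditions on \<open>\<mu>''\<close> turn both bounds into \<open>d' \<le> -2 \<lambda> d\<close>. The time
  derivative of \<open>u\<close> is never formed: difference quotients of \<open>d\<close> are bounded by convergent sequences
  (\<open>dissipation_quotient_le\<close>), and a Gronwall lemma for upper Dini derivatives concludes
  (\<open>dissipation_decay\<close>). Control of difference quotients needs sup-norm bounds on \<open>D u\<close>; these come from
  the equivalence of norms on the finite-dimensional space of coefficients, which contains the
  squares \<open>|D v|\<^sup>2\<close>.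

  Error. Let \<open>E(P) = \<phi>(|P|)\<close>, whose gradient is \<open>A\<close>. Both \<open>\<mu>(c) D u\<close> and \<open>A(D u\<^sub>*)\<close> represent \<open>F\<close>, so
  the Bregman distance \<open>E(P) - E(R) - A(R) \<bullet> (P - R)\<close>, with \<open>P = D u\<close> and \<open>R = D u\<^sub>*\<close>, has the same integral
  as \<open>E(P) - E(R) - \<mu>(c) P \<bullet> (P - R)\<close>. Pointwise, the former dominates \<open>|V(P) - V(R)|\<^sup>2\<close>
  (\<open>bregman_controls_V\<close>) and the latter is dominated by \<open>|\<mu>'(c)| (c - |P|\<^sup>2)\<^sup>2\<close> (\<open>energy_gap\<close>). This last
  bound is where the exponents \<open>1/3\<close> and \<open>3\<close> and the separation of the slopes from \<open>1\<close> enter.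

  The scalar and the vector-valued problem differ only in the space and the differential operator.
  The operator has to be linear almost everywhere, which for the chosen representatives of weak
  gradients is the fundamental lemma of the calculus of variations.
\<close>

section \<open>Smooth bump functions on boxes\<close>

text \<open>
  The polynomial factor makes the family closed under differentiation, so that smoothness follows
  from first derivatives alone.
\<close>
definition exp_cutoff :: "real poly \<Rightarrow> real \<Rightarrow> real" where
  "exp_cutoff p x = (if x > 0 then poly p (1 / x) * exp (- (1 / x)) else 0)"

lemma poly_exp_decay: "((\<lambda>y::real. poly p y * exp (- y)) \<longlongrightarrow> 0) at_top"
proof -
  have "((\<lambda>y::real. \<Sum>i\<le>degree p. coeff p i * (y ^ i / exp y)) \<longlongrightarrow> (\<Sum>i\<le>degree p. coeff p i * 0)) at_top"
    by (intro tendsto_sum tendsto_mult tendsto_const tendsto_power_div_exp_0)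
  moreover have "(\<Sum>i\<le>degree p. coeff p i * (y ^ i / exp y)) = poly p y * exp (- y)" for y
    by (simp add: poly_altdef sum_distrib_right exp_minus divide_inverse mult.assoc)
  ultimately show ?thesis by simp
qed

text \<open>
  Only the origin is delicate: there the difference quotient is \<open>p(1/h) exp(-1/h) / h\<close>, which tends to 0
  because the exponential beats every polynomial in \<open>1/h\<close>.
\<close>
lemma DERIV_exp_cutoff:
  "(exp_cutoff p has_real_derivative exp_cutoff (pCons 0 (pCons 0 (p - pderiv p))) x) (at x)"
proof -
  let ?q = "pCons 0 (pCons 0 (p - pderiv p))"
  consider "x > 0" | "x < 0" | "x = 0" by linarith
  then show ?thesis
  proof cases
    case 1
    have "((\<lambda>x. poly p (1 / x) * exp (- (1 / x))) has_real_derivative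
        poly ?q (1 / x) * exp (- (1 / x))) (at x)"
      using 1 by (auto intro!: derivative_eq_intros DERIV_chain2[OF poly_DERIV]
          simp: field_simps power2_eq_square)
    then have "(exp_cutoff p has_real_derivative poly ?q (1 / x) * exp (- (1 / x))) (at x)"
      by (rule has_field_derivative_transform_within_open[where S = "{0<..}"])
        (use 1 in \<open>auto simp: exp_cutoff_def\<close>)
    then show ?thesis using 1 by (simp add: exp_cutoff_def)
  next
    case 2
    have "((\<lambda>x. 0) has_real_derivative 0) (at x)" by simp
    then have "(exp_cutoff p has_real_derivative 0) (at x)"
      by (rule has_field_derivative_transform_within_open[where S = "{..<0}"])
        (use 2 in \<open>auto simp: exp_cutoff_def\<close>)
    then show ?thesis using 2 by (simp add: exp_cutoff_def)
  next
    case 3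
    have "((\<lambda>h. exp_cutoff p h / h) \<longlongrightarrow> 0) (at 0)"
    proof (rule filterlim_split_at)
      have "eventually (\<lambda>h. 0 = exp_cutoff p h / h) (at_left 0)"
        unfolding eventually_at_left_field by (rule exI[of _ "-1"]) (auto simp: exp_cutoff_def)
      then show "((\<lambda>h. exp_cutoff p h / h) \<longlongrightarrow> 0) (at_left 0)"
        by (rule Lim_transform_eventually[OF tendsto_const])
      have "((\<lambda>h. poly (pCons 0 p) (inverse h) * exp (- inverse h)) \<longlongrightarrow> 0) (at_right 0)"
        by (rule filterlim_compose[OF poly_exp_decay filterlim_inverse_at_top_right])
      moreover have "eventually (\<lambda>h. poly (pCons 0 p) (inverse h) * exp (- inverse h) = exp_cutoff p h / h) (at_right 0)"
        unfolding eventually_at_right_field by (rule exI[of _ 1]) (auto simp: exp_cutoff_def field_simps)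
      ultimately show "((\<lambda>h. exp_cutoff p h / h) \<longlongrightarrow> 0) (at_right 0)"
        by (rule Lim_transform_eventually)
    qed
    then show ?thesis using 3 by (simp add: DERIV_def exp_cutoff_def)
  qed
qed

text \<open>
  Sums and products are included so that the product rule stays inside the set: it is then closed
  under all partial derivatives, and every member is smooth by induction on the multi-index.
\<close>
inductive_set cutoff_algebra :: "(real ^ 'd \<Rightarrow> real) set" where
  base: "(\<lambda>x. exp_cutoff p (k * x $ i + a)) \<in> cutoff_algebra"
| zero: "(\<lambda>x. 0) \<in> cutoff_algebra"
| one: "(\<lambda>x. 1) \<in> cutoff_algebra"
| add: "f \<in> cutoff_algebra \<Longrightarrow> g \<in> cutoff_algebra \<Longrightarrow> (\<lambda>x. f x + g x) \<in> cutoff_algebra"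
| mult: "f \<in> cutoff_algebra \<Longrightarrow> g \<in> cutoff_algebra \<Longrightarrow> (\<lambda>x. f x * g x) \<in> cutoff_algebra"

lemma exp_cutoff_smult: "exp_cutoff (smult c p) x = c * exp_cutoff p x"
  by (simp add: exp_cutoff_def)

lemma cutoff_algebra_derivative:
  fixes f :: "real ^ 'd \<Rightarrow> real"
  assumes "f \<in> cutoff_algebra"
  shows "f differentiable_on UNIV \<and> (\<forall>j. partial_deriv j f \<in> cutoff_algebra)"
  using assms
proof induction
  case (base p k i a)
  let ?q = "pCons 0 (pCons 0 (p - pderiv p))"
  let ?f = "\<lambda>x::real^'d. exp_cutoff p (k * x $ i + a)"
  have D: "(?f has_derivative (\<lambda>h. exp_cutoff ?q (k * x $ i + a) * (k * h $ i))) (at x)" for x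
  proof -
    have "((\<lambda>x::real^'d. k * x $ i + a) has_derivative (\<lambda>h. k * h $ i)) (at x)"
      by (auto intro!: derivative_eq_intros bounded_linear_imp_has_derivative bounded_linear_vec_nth)
    from has_derivative_compose[OF this DERIV_exp_cutoff[of p, unfolded has_field_derivative_def]]
    show ?thesis by simp
  qed
  have "partial_deriv j ?f = (\<lambda>x. exp_cutoff (smult (if j = i then k else 0) ?q) (k * x $ i + a))" for j
    unfolding partial_deriv_def frechet_derivative_at[OF D, symmetric] exp_cutoff_smult
    by (auto simp: axis_def)
  moreover have "?f differentiable_on UNIV"
    using D by (auto simp: differentiable_on_def differentiable_def)
  ultimately show ?case by (metis cutoff_algebra.base)
next
  case zero
  have "partial_deriv j (\<lambda>x::real^'d. 0) = (\<lambda>x. 0)" for j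
    by (simp add: partial_deriv_def fun_eq_iff)
  then show ?case by (metis cutoff_algebra.zero differentiable_on_const)
next
  case one
  have "partial_deriv j (\<lambda>x::real^'d. 1) = (\<lambda>x. 0)" for j
    by (simp add: partial_deriv_def fun_eq_iff)
  then show ?case by (metis cutoff_algebra.zero differentiable_on_const)
next
  case (add f g)
  then have d: "f differentiable at x" "g differentiable at x" for x
    by (auto simp: differentiable_on_def)
  have "partial_deriv j (\<lambda>x. f x + g x) = (\<lambda>x. partial_deriv j f x + partial_deriv j g x)" for j
  proof
    fix x
    have "((\<lambda>x. f x + g x) has_derivative
        (\<lambda>h. frechet_derivative f (at x) h + frechet_derivative g (at x) h)) (at x)"
      using d by (intro has_derivative_add) (auto simp: frechet_derivative_works[symmetric])
    from frechet_derivative_at[OF this, symmetric]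
    show "partial_deriv j (\<lambda>x. f x + g x) x = partial_deriv j f x + partial_deriv j g x"
      by (simp add: partial_deriv_def)
  qed
  with add show ?case
    by (metis cutoff_algebra.add differentiable_on_add)
next
  case (mult f g)
  then have d: "f differentiable at x" "g differentiable at x" for x
    by (auto simp: differentiable_on_def)
  have "partial_deriv j (\<lambda>x. f x * g x)
      = (\<lambda>x. f x * partial_deriv j g x + partial_deriv j f x * g x)" for j
  proof
    fix x
    have "((\<lambda>x. f x * g x) has_derivative
        (\<lambda>h. f x * frechet_derivative g (at x) h + frechet_derivative f (at x) h * g x)) (at x)"
      using d by (intro has_derivative_mult) (auto simp: frechet_derivative_works[symmetric])
    from frechet_derivative_at[OF this, symmetric]
    show "partial_deriv j (\<lambda>x. f x * g x) x = f x * partial_deriv j g x + partial_deriv j f x * g x"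
      by (simp add: partial_deriv_def)
  qed
  then show ?case using mult
    by (auto intro!: cutoff_algebra.add cutoff_algebra.mult differentiable_on_mult)
qed

lemma cutoff_algebra_smooth: "f \<in> cutoff_algebra \<Longrightarrow> smooth f"
proof -
  assume f: "f \<in> cutoff_algebra"
  have "foldr partial_deriv js f \<in> cutoff_algebra" for js
    by (induction js) (use f cutoff_algebra_derivative in auto)
  then show ?thesis using cutoff_algebra_derivative by (auto simp: smooth_def)
qed

lemma cutoff_algebra_prod:
  "finite I \<Longrightarrow> (\<And>i. i \<in> I \<Longrightarrow> f i \<in> cutoff_algebra) \<Longrightarrow> (\<lambda>x. \<Prod>i\<in>I. f i x) \<in> cutoff_algebra"
  by (induction I rule: finite_induct) (auto intro: cutoff_algebra.one cutoff_algebra.mult)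

text \<open>
  The factor \<open>Suc n\<close> steepens the cutoffs without changing their support. As \<open>exp (-1 / (n y))\<close> tends to 1 for
  \<open>y > 0\<close>, the bumps converge to the indicator of the box while staying supported in its closure.
\<close>
definition box_bump :: "real ^ 'd \<Rightarrow> real ^ 'd \<Rightarrow> nat \<Rightarrow> real ^ 'd \<Rightarrow> real" where
  "box_bump a b n x = (\<Prod>i\<in>UNIV. exp_cutoff 1 (real (Suc n) * (x $ i - a $ i))
                               * exp_cutoff 1 (real (Suc n) * (b $ i - x $ i)))"

lemma smooth_box_bump: "smooth (box_bump a b n)"
proof -
  have "(\<lambda>x. exp_cutoff 1 (real (Suc n) * x $ i + (- real (Suc n) * a $ i))) \<in> cutoff_algebra"
     "(\<lambda>x. exp_cutoff 1 ((- real (Suc n)) * x $ i + real (Suc n) * b $ i)) \<in> cutoff_algebra" for i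
    by (rule cutoff_algebra.base)+
  then have "(\<lambda>x. exp_cutoff 1 (real (Suc n) * (x $ i - a $ i))) \<in> cutoff_algebra"
     "(\<lambda>x. exp_cutoff 1 (real (Suc n) * (b $ i - x $ i))) \<in> cutoff_algebra" for i
    by (simp_all add: algebra_simps)
  then show ?thesis
    unfolding box_bump_def by (intro cutoff_algebra_smooth cutoff_algebra_prod cutoff_algebra.mult) auto
qed

lemma box_bump_bounds: "0 \<le> box_bump a b n x" "box_bump a b n x \<le> 1"
proof -
  have *: "0 \<le> exp_cutoff 1 y \<and> exp_cutoff 1 y \<le> 1" for y by (simp add: exp_cutoff_def)
  show "0 \<le> box_bump a b n x" unfolding box_bump_def using * by (intro prod_nonneg) auto
  show "box_bump a b n x \<le> 1" unfolding box_bump_def using * by (intro prod_le_1) (auto intro: mult_le_one)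
qed

lemma box_bump_outside: "x \<notin> box a b \<Longrightarrow> box_bump a b n x = 0"
  by (auto simp: box_bump_def mem_box_cart exp_cutoff_def not_less zero_less_mult_iff) (meson not_less)+

lemma box_bump_limit: "(\<lambda>n. box_bump a b n x) \<longlonglongrightarrow> indicator (box a b) x"
proof (cases "x \<in> box a b")
  case True
  have *: "(\<lambda>n. exp_cutoff 1 (real (Suc n) * y)) \<longlonglongrightarrow> 1" if "y > 0" for y
  proof -
    have "(\<lambda>n. exp (- (inverse (real (Suc n)) / y))) \<longlonglongrightarrow> exp (- (0 / y))"
      by (intro tendsto_intros LIMSEQ_inverse_real_of_nat) (use that in auto)
    moreover have "exp_cutoff 1 (real (Suc n) * y) = exp (- (inverse (real (Suc n)) / y))" for n
      using that by (simp add: exp_cutoff_def divide_inverse del: of_nat_Suc)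
    ultimately show ?thesis using that by simp
  qed
  have "(\<lambda>n. box_bump a b n x) \<longlonglongrightarrow> (\<Prod>i\<in>(UNIV::'a set). 1 * 1)"
    unfolding box_bump_def using True
    by (intro tendsto_prod tendsto_mult *) (auto simp: mem_box_cart)
  then show ?thesis using True by simp
qed (simp add: box_bump_outside)

lemma box_bump_test_function:
  assumes "cbox a b \<subseteq> \<Omega>"
  shows "box_bump a b n \<in> test_functions \<Omega>"
proof -
  have "closure {x. box_bump a b n x \<noteq> 0} \<subseteq> cbox a b"
    by (rule closure_minimal) (use box_bump_outside box_subset_cbox in \<open>blast+\<close>)
  moreover from this have "bounded {x. box_bump a b n x \<noteq> 0}"
    using bounded_subset[OF bounded_cbox] closure_subset by blast
  ultimately show ?thesis using assms
    by (auto simp: test_functions_def smooth_box_bump)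
qed

section \<open>Uniqueness and linearity of weak gradients\<close>

text \<open>
  Testing with bumps and passing to the limit gives a vanishing integral over every box whose
  closure lies in \<open>\<Omega>\<close>. Averages over small cubes converge to the function almost everywhere, so it vanishes.
\<close>
lemma fundamental_lemma:
  fixes g :: "real ^ 'd \<Rightarrow> real"
  assumes "open \<Omega>" and g: "integrable (lebesgue_on \<Omega>) g"
    and ortho: "\<And>\<psi>. \<psi> \<in> test_functions \<Omega> \<Longrightarrow> (LINT x|lebesgue_on \<Omega>. g x * \<psi> x) = 0"
  shows "AE x in lebesgue_on \<Omega>. g x = 0"
proof -
  have \<Omega>: "\<Omega> \<in> sets lebesgue" using \<open>open \<Omega>\<close> by (simp add: borel_open)
  define f where "f x = (if x \<in> \<Omega> then g x else 0)" for x
  have f: "integrable lebesgue f"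
    unfolding f_def using g by (simp add: Lebesgue_Measure.integrable_restrict_UNIV[OF \<Omega>])
  have f_on: "integrable (lebesgue_on S) f" if "S \<in> sets lebesgue" for S
    using integrable_mult_indicator[OF that f]
    by (simp add: integrable_restrict_space that)
  have box0: "integral (cbox a b) f = 0" if ab: "cbox a b \<subseteq> \<Omega>" for a b
  proof -
    have "(\<lambda>n. LINT x|lebesgue. box_bump a b n x * f x)
        \<longlonglongrightarrow> (LINT x|lebesgue. indicator (box a b) x * f x)"
    proof (rule integral_dominated_convergence[where w = "\<lambda>x. \<bar>f x\<bar>"])
      show "(\<lambda>x. indicator (box a b) x * f x) \<in> borel_measurable lebesgue"
        by (intro borel_measurable_times borel_measurable_integrable[OF f] borel_measurable_indicator) simp
      show "(\<lambda>x. box_bump a b n x * f x) \<in> borel_measurable lebesgue" for n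
      proof -
        have "box_bump a b n differentiable_on UNIV"
          using smooth_box_bump[of a b n] unfolding smooth_def by (metis foldr.simps(1) id_apply)
        then have "box_bump a b n \<in> borel_measurable borel"
          by (intro borel_measurable_continuous_onI differentiable_imp_continuous_on)
        then have "box_bump a b n \<in> borel_measurable lebesgue"
          by (simp add: measurable_completion)
        then show ?thesis
          by (intro borel_measurable_times borel_measurable_integrable[OF f])
      qed
      show "integrable lebesgue (\<lambda>x. \<bar>f x\<bar>)" using f by simp
      show "AE x in lebesgue. (\<lambda>n. box_bump a b n x * f x) \<longlonglongrightarrow> indicator (box a b) x * f x"
        by (intro AE_I2 tendsto_mult box_bump_limit tendsto_const)
      show "AE x in lebesgue. norm (box_bump a b n x * f x) \<le> \<bar>f x\<bar>" for n
        using box_bump_bounds[of a b n] by (auto simp: abs_mult intro!: mult_left_le_one_le)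
    qed
    moreover have "(LINT x|lebesgue. box_bump a b n x * f x) = 0" for n
    proof -
      have "(LINT x|lebesgue. box_bump a b n x * f x)
          = (LINT x|lebesgue. (if x \<in> \<Omega> then g x * box_bump a b n x else 0))"
        by (rule Bochner_Integration.integral_cong) (auto simp: f_def)
      also have "\<dots> = (LINT x|lebesgue_on \<Omega>. g x * box_bump a b n x)"
        by (rule Lebesgue_Measure.integral_restrict_UNIV[OF \<Omega>])
      also have "\<dots> = 0" using ortho box_bump_test_function[OF ab] by blast
      finally show ?thesis .
    qed
    ultimately have "(LINT x|lebesgue. indicator (box a b) x * f x) = 0"
      by (simp add: LIMSEQ_const_iff)
    moreover have "(LINT x|lebesgue. indicator (box a b) x * f x) = (LINT x|lebesgue_on (box a b). f x)"
      by (simp add: integral_restrict_space)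
    moreover have "(LINT x|lebesgue_on (box a b). f x) = integral (box a b) f"
      by (intro lebesgue_integral_eq_integral f_on) auto
    ultimately show ?thesis by (simp add: integral_open_interval)
  qed
  have "f integrable_on cbox a b" for a b
    by (intro integrable_on_lebesgue_on f_on) auto
  then obtain N where N: "negligible N"
    and dif: "\<And>x e. \<lbrakk>x \<notin> N; 0 < e\<rbrakk> \<Longrightarrow> \<exists>d>0. \<forall>h. 0 < h \<and> h < d \<longrightarrow>
        norm (integral (cbox x (x + h *\<^sub>R One)) f /\<^sub>R h ^ DIM(real ^ 'd) - f x) < e"
    using integrable_ccontinuous_explicit by blast
  have "g x = 0" if x: "x \<in> \<Omega>" "x \<notin> N" for x
  proof (rule ccontr)
    assume "g x \<noteq> 0"
    then have "\<bar>f x\<bar> > 0" using x by (simp add: f_def)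
    from dif[OF x(2) this] obtain d where d: "d > 0" "\<And>h. 0 < h \<and> h < d \<Longrightarrow>
        norm (integral (cbox x (x + h *\<^sub>R One)) f /\<^sub>R h ^ DIM(real ^ 'd) - f x) < \<bar>f x\<bar>"
      by blast
    obtain e where e: "e > 0" "cball x e \<subseteq> \<Omega>"
      using \<open>open \<Omega>\<close> x(1) open_contains_cball by blast
    define h where "h = min (d/2) (e / real (DIM(real^'d)))"
    have h: "0 < h" "h < d" "h \<le> e / real (DIM(real^'d))"
    proof -
      have "0 < e / real (DIM(real^'d))" using e(1) by (simp del: DIM_cart)
      then show "0 < h" using d(1) by (simp add: h_def)
      show "h < d" using d(1) min.cobounded1[of "d/2" "e / real (DIM(real^'d))"] unfolding h_def by linarith
      show "h \<le> e / real (DIM(real^'d))" unfolding h_def by (rule min.cobounded2)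
    qed
    have "cbox x (x + h *\<^sub>R One) \<subseteq> cball x e"
    proof
      fix y assume y: "y \<in> cbox x (x + h *\<^sub>R One)"
      have "norm (y - x) \<le> (\<Sum>b\<in>Basis. \<bar>(y - x) \<bullet> b\<bar>)" by (rule norm_le_l1)
      also have "\<dots> \<le> (\<Sum>b\<in>(Basis::(real^'d) set). h)"
        using y by (intro sum_mono) (auto simp: mem_box inner_diff_left inner_add_left)
      also have "\<dots> \<le> e" using h(3) by (simp add: field_simps)
      finally show "y \<in> cball x e" by (simp add: dist_norm norm_minus_commute)
    qed
    then have "integral (cbox x (x + h *\<^sub>R One)) f = 0"
      using e(2) box0 by blast
    with d(2)[of h] h show False by simp
  qed
  moreover have "N \<in> null_sets lebesgue" using N by (simp add: negligible_iff_null_sets)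
  then have "AE x in lebesgue. x \<notin> N" by (rule AE_not_in)
  ultimately show ?thesis
    by (subst AE_restrict_space_iff) (use \<Omega> in \<open>auto elim!: eventually_mono\<close>)
qed

lemma L2_measurable: "L2_on \<Omega> f \<Longrightarrow> f \<in> borel_measurable (lebesgue_on \<Omega>)"
  by (simp add: L2_on_def)

lemma L2_mult_integrable:
  fixes f g :: "real ^ 'd \<Rightarrow> 'b::euclidean_space"
  assumes "L2_on \<Omega> f" "L2_on \<Omega> g"
  shows "integrable (lebesgue_on \<Omega>) (\<lambda>x. f x \<bullet> g x)"
proof (rule Bochner_Integration.integrable_bound)
  show "integrable (lebesgue_on \<Omega>) (\<lambda>x. (norm (f x))\<^sup>2 + (norm (g x))\<^sup>2)"
    using assms by (simp add: L2_on_def)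
  show "(\<lambda>x. f x \<bullet> g x) \<in> borel_measurable (lebesgue_on \<Omega>)"
    using assms[THEN L2_measurable] by measurable
  have "\<bar>f x \<bullet> g x\<bar> \<le> (norm (f x))\<^sup>2 + (norm (g x))\<^sup>2" for x
  proof -
    have "\<bar>f x \<bullet> g x\<bar> \<le> norm (f x) * norm (g x)" by (rule Cauchy_Schwarz_ineq2)
    also have "\<dots> \<le> (norm (f x))\<^sup>2 + (norm (g x))\<^sup>2"
      using sum_squares_bound[of "norm (f x)" "norm (g x)"]
        mult_nonneg_nonneg[OF norm_ge_zero[of "f x"] norm_ge_zero[of "g x"]] by linarith
    finally show ?thesis .
  qed
  then show "AE x in lebesgue_on \<Omega>. norm (f x \<bullet> g x) \<le> norm ((norm (f x))\<^sup>2 + (norm (g x))\<^sup>2)"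
    by simp
qed

lemma L2_add:
  assumes "L2_on \<Omega> f" "L2_on \<Omega> g"
  shows "L2_on \<Omega> (\<lambda>x. f x + g x)"
  unfolding L2_on_def
proof
  show "(\<lambda>x. f x + g x) \<in> borel_measurable (lebesgue_on \<Omega>)"
    using assms[THEN L2_measurable] by measurable
  have *: "(norm (f x + g x))\<^sup>2 = (norm (f x))\<^sup>2 + (norm (g x))\<^sup>2 + 2 * (f x \<bullet> g x)" for x
    by (simp add: power2_norm_eq_inner inner_simps inner_commute)
  show "integrable (lebesgue_on \<Omega>) (\<lambda>x. (norm (f x + g x))\<^sup>2)"
    unfolding * using assms L2_mult_integrable[OF assms] by (simp add: L2_on_def)
qed

lemma L2_diff:
  assumes "L2_on \<Omega> f" "L2_on \<Omega> g"
  shows "L2_on \<Omega> (\<lambda>x. f x - g x)"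
proof -
  have "L2_on \<Omega> (\<lambda>x. - g x)"
    unfolding L2_on_def norm_minus_cancel
    by (rule conjI[OF borel_measurable_uminus[OF L2_measurable[OF assms(2)]]
          assms(2)[unfolded L2_on_def, THEN conjunct2]])
  from L2_add[OF assms(1) this] show ?thesis by (simp only: add_uminus_conv_diff)
qed

lemma L2_component:
  fixes f :: "real ^ 'd \<Rightarrow> real ^ 'm"
  assumes "L2_on \<Omega> f" shows "L2_on \<Omega> (\<lambda>x. f x $ i)"
  unfolding L2_on_def
proof
  show m: "(\<lambda>x. f x $ i) \<in> borel_measurable (lebesgue_on \<Omega>)"
    by (intro borel_measurable_continuous_on[OF _ L2_measurable[OF assms]])
      (simp add: linear_continuous_on bounded_linear_vec_nth)
  show "integrable (lebesgue_on \<Omega>) (\<lambda>x. (norm (f x $ i))\<^sup>2)"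
  proof (rule Bochner_Integration.integrable_bound)
    show "integrable (lebesgue_on \<Omega>) (\<lambda>x. (norm (f x))\<^sup>2)" using assms by (simp add: L2_on_def)
    show "(\<lambda>x. (norm (f x $ i))\<^sup>2) \<in> borel_measurable (lebesgue_on \<Omega>)" using m by simp
    show "AE x in lebesgue_on \<Omega>. norm ((norm (f x $ i))\<^sup>2) \<le> norm ((norm (f x))\<^sup>2)"
    proof (intro AE_I2)
      fix x
      have "(norm (f x $ i))\<^sup>2 \<le> (norm (f x))\<^sup>2"
        by (rule power_mono[OF Finite_Cartesian_Product.norm_nth_le norm_ge_zero])
      then show "norm ((norm (f x $ i))\<^sup>2) \<le> norm ((norm (f x))\<^sup>2)" by simp
    qed
  qed
qed

lemma bounded_L2:
  fixes f :: "real ^ 'd \<Rightarrow> 'b::euclidean_space"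
  assumes "\<Omega> \<in> lmeasurable" "f \<in> borel_measurable (lebesgue_on \<Omega>)" "\<And>x. norm (f x) \<le> B"
  shows "L2_on \<Omega> f"
proof -
  interpret finite_measure "lebesgue_on \<Omega>" using assms(1) by (rule finite_measure_lebesgue_on)
  have "integrable (lebesgue_on \<Omega>) (\<lambda>x. (norm (f x))\<^sup>2)"
    using assms(2,3) by (intro integrable_const_bound[where B = "B\<^sup>2"]) (auto intro!: power_mono)
  then show ?thesis using assms by (simp add: L2_on_def)
qed

lemma compact_support_L2:
  fixes f :: "real ^ 'd \<Rightarrow> real"
  assumes "\<Omega> \<in> lmeasurable" "continuous_on UNIV f" "compact K" "\<And>x. x \<notin> K \<Longrightarrow> f x = 0"
  shows "L2_on \<Omega> f"
proof -
  have "compact (f ` K)" using assms(2,3) compact_continuous_image continuous_on_subset by blast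
  then obtain B where "\<And>y. y \<in> f ` K \<Longrightarrow> norm y \<le> B"
    using compact_imp_bounded bounded_iff by metis
  then have "norm (f x) \<le> max B 0" for x using assms(4)[of x] by (cases "x \<in> K") (auto simp: le_max_iff_disj)
  moreover have "f \<in> borel_measurable (lebesgue_on \<Omega>)"
    using borel_measurable_continuous_onI[OF assms(2)]
    by (intro measurable_restrict_space1 measurable_completion) simp
  ultimately show ?thesis using bounded_L2 assms(1) by blast
qed

lemma test_function_L2:
  assumes "\<Omega> \<in> lmeasurable" "\<psi> \<in> test_functions \<Omega>"
  shows "L2_on \<Omega> \<psi>" "L2_on \<Omega> (partial_deriv i \<psi>)"
proof -
  let ?K = "closure {x. \<psi> x \<noteq> 0}"
  have K: "compact ?K" and sm: "smooth \<psi>" using assms(2) by (auto simp: test_functions_def)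
  have d: "\<psi> differentiable_on UNIV" "partial_deriv i \<psi> differentiable_on UNIV"
    using sm[unfolded smooth_def, THEN spec[of _ "[]"]] sm[unfolded smooth_def, THEN spec[of _ "[i]"]]
    by (simp_all only: foldr.simps id_apply comp_apply)
  have out: "\<psi> x = 0" if "x \<notin> ?K" for x
    using that closure_subset[of "{x. \<psi> x \<noteq> 0}"] by blast
  then show "L2_on \<Omega> \<psi>"
    by (rule compact_support_L2[OF assms(1) differentiable_imp_continuous_on[OF d(1)] K])
  have "partial_deriv i \<psi> x = 0" if "x \<notin> ?K" for x
  proof -
    have "((\<lambda>x. 0) has_derivative (\<lambda>h. 0)) (at x)" by simp
    then have "(\<psi> has_derivative (\<lambda>h. 0)) (at x)"
    proof (rule has_derivative_transform_within_open)
      show "open (- ?K)" using closed_closure by (rule open_Compl)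
      show "x \<in> - ?K" using that by simp
      show "0 = \<psi> y" if "y \<in> - ?K" for y 
        using out[of y, symmetric] that unfolding Compl_iff .
    qed
    from frechet_derivative_at[OF this, symmetric] show ?thesis by (simp add: partial_deriv_def)
  qed
  then show "L2_on \<Omega> (partial_deriv i \<psi>)"
    by (rule compact_support_L2[OF assms(1) differentiable_imp_continuous_on[OF d(2)] K])
qed

lemma L2_integrable:
  fixes f :: "real ^ 'd \<Rightarrow> real"
  assumes "\<Omega> \<in> lmeasurable" "L2_on \<Omega> f"
  shows "integrable (lebesgue_on \<Omega>) f"
proof -
  have "L2_on \<Omega> (\<lambda>x. 1::real)" by (rule bounded_L2[OF assms(1)]) auto
  from L2_mult_integrable[OF assms(2) this] show ?thesis by simp
qed

text \<open>
  The representative behind \<open>weak_grad\<close> is an arbitrary choice, so even additivity of \<open>weak_grad\<close> holds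
  only almost everywhere, and only because of this uniqueness.
\<close>
lemma weak_grad_unique:
  assumes "open \<Omega>" "\<Omega> \<in> lmeasurable" "is_weak_grad \<Omega> u g" "is_weak_grad \<Omega> u h"
  shows "AE x in lebesgue_on \<Omega>. g x = h x"
proof -
  have L2: "L2_on \<Omega> g" "L2_on \<Omega> h" using assms(3,4) by (auto simp: is_weak_grad_def)
  have "AE x in lebesgue_on \<Omega>. g x $ i - h x $ i = 0" for i
  proof (rule fundamental_lemma[OF assms(1)])
    show "integrable (lebesgue_on \<Omega>) (\<lambda>x. g x $ i - h x $ i)"
      by (intro L2_integrable assms(2) L2_diff L2_component L2)
    fix \<psi> assume \<psi>: "\<psi> \<in> test_functions \<Omega>"
    have I: "integrable (lebesgue_on \<Omega>) (\<lambda>x. g x $ i * \<psi> x)" "integrable (lebesgue_on \<Omega>) (\<lambda>x. h x $ i * \<psi> x)"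
      using L2_mult_integrable[OF L2_component[OF L2(1)] test_function_L2(1)[OF assms(2) \<psi>]]
        L2_mult_integrable[OF L2_component[OF L2(2)] test_function_L2(1)[OF assms(2) \<psi>]] by simp_all
    have "(LINT x|lebesgue_on \<Omega>. g x $ i * \<psi> x) = (LINT x|lebesgue_on \<Omega>. h x $ i * \<psi> x)"
    proof -
      have "- (LINT x|lebesgue_on \<Omega>. g x $ i * \<psi> x) = - (LINT x|lebesgue_on \<Omega>. h x $ i * \<psi> x)"
        using assms(3)[unfolded is_weak_grad_def, THEN conjunct2, rule_format, OF \<psi>, of i]
          assms(4)[unfolded is_weak_grad_def, THEN conjunct2, rule_format, OF \<psi>, of i] by linarith
      then show ?thesis by simp
    qed
    then show "(LINT x|lebesgue_on \<Omega>. (g x $ i - h x $ i) * \<psi> x) = 0"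
      using I by (simp add: left_diff_distrib)
  qed
  then have "AE x in lebesgue_on \<Omega>. \<forall>i. g x $ i - h x $ i = 0" by (simp add: AE_all_countable)
  then show ?thesis by eventually_elim (simp add: vec_eq_iff)
qed

lemma is_weak_grad_diff:
  assumes "\<Omega> \<in> lmeasurable" "L2_on \<Omega> u" "L2_on \<Omega> v" "is_weak_grad \<Omega> u g" "is_weak_grad \<Omega> v h"
  shows "is_weak_grad \<Omega> (\<lambda>x. u x - v x) (\<lambda>x. g x - h x)"
  unfolding is_weak_grad_def
proof (intro conjI ballI allI)
  have L2: "L2_on \<Omega> g" "L2_on \<Omega> h" using assms(4,5) by (auto simp: is_weak_grad_def)
  then show "L2_on \<Omega> (\<lambda>x. g x - h x)" by (rule L2_diff)
  fix \<psi> i assume \<psi>: "\<psi> \<in> test_functions \<Omega>"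
  note T = test_function_L2[OF assms(1) \<psi>]
  have I: "integrable (lebesgue_on \<Omega>) (\<lambda>x. g x $ i * \<psi> x)" "integrable (lebesgue_on \<Omega>) (\<lambda>x. h x $ i * \<psi> x)"
     "integrable (lebesgue_on \<Omega>) (\<lambda>x. u x * partial_deriv i \<psi> x)"
     "integrable (lebesgue_on \<Omega>) (\<lambda>x. v x * partial_deriv i \<psi> x)"
    using L2_mult_integrable[OF L2_component[OF L2(1)] T(1)] L2_mult_integrable[OF L2_component[OF L2(2)] T(1)]
      L2_mult_integrable[OF assms(2) T(2)] L2_mult_integrable[OF assms(3) T(2)] by simp_all
  show "(LINT x|lebesgue_on \<Omega>. (u x - v x) * partial_deriv i \<psi> x)
          = - (LINT x|lebesgue_on \<Omega>. (g x - h x) $ i * \<psi> x)"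
    using I assms(4,5) \<psi> by (simp add: is_weak_grad_def left_diff_distrib)
qed

lemma weak_grad_chosen: "is_weak_grad \<Omega> u g \<Longrightarrow> is_weak_grad \<Omega> u (weak_grad \<Omega> u)"
  unfolding weak_grad_def by (rule someI[of "is_weak_grad \<Omega> u" g])

lemma weak_grad_is_weak_grad: "u \<in> H1 \<Omega> \<Longrightarrow> is_weak_grad \<Omega> u (weak_grad \<Omega> u)"
  unfolding H1_def mem_Collect_eq by (elim conjE exE weak_grad_chosen)

lemma weak_grad_diff:
  assumes "open \<Omega>" "\<Omega> \<in> lmeasurable" "u \<in> H1 \<Omega>" "v \<in> H1 \<Omega>"
  shows "AE x in lebesgue_on \<Omega>. weak_grad \<Omega> (\<lambda>x. u x - v x) x = weak_grad \<Omega> u x - weak_grad \<Omega> v x"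
proof -
  have "is_weak_grad \<Omega> (\<lambda>x. u x - v x) (\<lambda>x. weak_grad \<Omega> u x - weak_grad \<Omega> v x)"
    using assms by (intro is_weak_grad_diff weak_grad_is_weak_grad) (auto simp: H1_def)
  from weak_grad_unique[OF assms(1,2) weak_grad_chosen[OF this] this] show ?thesis .
qed

lemma weak_grad_L2: "u \<in> H1 \<Omega> \<Longrightarrow> L2_on \<Omega> (weak_grad \<Omega> u)"
  using weak_grad_is_weak_grad[of u \<Omega>] unfolding is_weak_grad_def[of \<Omega> u "weak_grad \<Omega> u"] by (rule conjunct1)

lemma weak_jacobian_diff:
  assumes "open \<Omega>" "\<Omega> \<in> lmeasurable" "u \<in> H10_vec \<Omega>" "v \<in> H10_vec \<Omega>"
  shows "AE x in lebesgue_on \<Omega>.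
    weak_jacobian \<Omega> (\<lambda>x. u x - v x) x = weak_jacobian \<Omega> u x - weak_jacobian \<Omega> v x"
proof -
  have H: "(\<lambda>x. u x $ i) \<in> H1 \<Omega>" "(\<lambda>x. v x $ i) \<in> H1 \<Omega>" for i
    using assms(3,4) by (auto simp: H10_vec_def H10_def)
  have "AE x in lebesgue_on \<Omega>. \<forall>i. weak_grad \<Omega> (\<lambda>x. u x $ i - v x $ i) x
      = weak_grad \<Omega> (\<lambda>x. u x $ i) x - weak_grad \<Omega> (\<lambda>x. v x $ i) x"
    using weak_grad_diff[OF assms(1,2) H] by (simp add: AE_all_countable)
  then show ?thesis by eventually_elim (simp add: weak_jacobian_def vec_eq_iff)
qed

lemma sym_grad_diff:
  assumes "open \<Omega>" "\<Omega> \<in> lmeasurable" "u \<in> H10_vec \<Omega>" "v \<in> H10_vec \<Omega>"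
  shows "AE x in lebesgue_on \<Omega>. sym_grad \<Omega> (\<lambda>x. u x - v x) x = sym_grad \<Omega> u x - sym_grad \<Omega> v x"
  using weak_jacobian_diff[OF assms]
  by eventually_elim (simp only: sym_grad_def, simp add: transpose_def vec_eq_iff field_simps)

lemma weak_div_diff:
  assumes "open \<Omega>" "\<Omega> \<in> lmeasurable" "u \<in> H10_vec \<Omega>" "v \<in> H10_vec \<Omega>"
  shows "AE x in lebesgue_on \<Omega>. weak_div \<Omega> (\<lambda>x. u x - v x) x = weak_div \<Omega> u x - weak_div \<Omega> v x"
  using weak_jacobian_diff[OF assms]
  by eventually_elim (simp add: weak_div_def trace_def sum_subtractf)

lemma weak_jacobian_entry_L2:
  assumes "u \<in> H10_vec \<Omega>"
  shows "L2_on \<Omega> (\<lambda>x. weak_jacobian \<Omega> u x $ i $ j)"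
proof -
  have "(\<lambda>x. u x $ i) \<in> H1 \<Omega>" using assms by (auto simp: H10_vec_def H10_def)
  from L2_component[OF weak_grad_L2[OF this]] show ?thesis by (simp add: weak_jacobian_def)
qed

lemma sym_grad_measurable:
  assumes "u \<in> H10_vec \<Omega>"
  shows "sym_grad \<Omega> u \<in> borel_measurable (lebesgue_on \<Omega>)"
proof -
  have [measurable]: "(\<lambda>x. weak_jacobian \<Omega> u x $ i $ j) \<in> borel_measurable (lebesgue_on \<Omega>)" for i j
    using weak_jacobian_entry_L2[OF assms] by (simp add: L2_on_def)
  have "(\<lambda>x. sym_grad \<Omega> u x \<bullet> axis i (axis j 1)) \<in> borel_measurable (lebesgue_on \<Omega>)" for i j
    by (simp add: sym_grad_def transpose_def inner_axis)
  then show ?thesis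
    by (subst borel_measurable_euclidean_space) (auto simp: Basis_vec_def)
qed

lemma weak_div_L2:
  assumes "\<Omega> \<in> lmeasurable" "u \<in> H10_vec \<Omega>"
  shows "L2_on \<Omega> (weak_div \<Omega> u)"
proof -
  have "finite I \<Longrightarrow> L2_on \<Omega> (\<lambda>x. \<Sum>i\<in>I. weak_jacobian \<Omega> u x $ i $ i)" for I :: "'a set"
    by (induction I rule: finite_induct)
      (use bounded_L2[OF assms(1), of "\<lambda>x. 0::real" 0] in \<open>auto intro!: L2_add weak_jacobian_entry_L2 assms\<close>)
  then show ?thesis by (simp add: weak_div_def[abs_def] trace_def)
qed

lemma fun_space_diff:
  assumes "fin_dim_fun_space S" "f \<in> S" "g \<in> S" shows "(\<lambda>x. f x - g x) \<in> S"
proof -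
  have "(\<lambda>x. (-1) *\<^sub>R g x) \<in> S" using assms(1,3) unfolding fin_dim_fun_space_def by blast
  moreover have "\<And>f g. f \<in> S \<Longrightarrow> g \<in> S \<Longrightarrow> (\<lambda>x. f x + g x) \<in> S"
    using assms(1) unfolding fin_dim_fun_space_def by blast
  ultimately have "(\<lambda>x. f x + (-1) *\<^sub>R g x) \<in> S" using assms(2) by blast
  then show ?thesis by simp
qed

lemma discretely_div_free_diff:
  assumes "open \<Omega>" "\<Omega> \<in> lmeasurable" "vector_spaces \<Omega> Ch Uh Qh"
    and "u \<in> discretely_div_free \<Omega> Uh Qh" "v \<in> discretely_div_free \<Omega> Uh Qh"
  shows "(\<lambda>x. u x - v x) \<in> discretely_div_free \<Omega> Uh Qh"
proof -
  have H: "u \<in> H10_vec \<Omega>" "v \<in> H10_vec \<Omega>" and U: "u \<in> Uh" "v \<in> Uh"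
    using assms(3-5) by (auto simp: vector_spaces_def discretely_div_free_def)
  have d: "(\<lambda>x. u x - v x) \<in> Uh"
    using assms(3) U by (intro fun_space_diff) (auto simp: vector_spaces_def)
  then have H': "(\<lambda>x. u x - v x) \<in> H10_vec \<Omega>" using assms(3) by (auto simp: vector_spaces_def)
  have "(LINT x|lebesgue_on \<Omega>. q x * weak_div \<Omega> (\<lambda>x. u x - v x) x) = 0" if q: "q \<in> Qh" for q
  proof -
    have q2: "L2_on \<Omega> q" using q assms(3) by (auto simp: vector_spaces_def)
    note L = weak_div_L2[OF assms(2)]
    have I: "integrable (lebesgue_on \<Omega>) (\<lambda>x. q x * weak_div \<Omega> w x)" if "w \<in> H10_vec \<Omega>" for w
      using L2_mult_integrable[OF q2 L[OF that]] by simp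
    have "(LINT x|lebesgue_on \<Omega>. q x * weak_div \<Omega> (\<lambda>x. u x - v x) x)
        = (LINT x|lebesgue_on \<Omega>. q x * weak_div \<Omega> u x - q x * weak_div \<Omega> v x)"
    proof (rule integral_cong_AE)
      show "AE x in lebesgue_on \<Omega>. q x * weak_div \<Omega> (\<lambda>x. u x - v x) x
          = q x * weak_div \<Omega> u x - q x * weak_div \<Omega> v x"
        using weak_div_diff[OF assms(1,2) H] by eventually_elim (simp only: right_diff_distrib)
    qed (use I H H' in \<open>auto intro!: borel_measurable_diff borel_measurable_integrable\<close>)
    also have "\<dots> = 0" using I[OF H(1)] I[OF H(2)] assms(4,5) q
      by (simp add: discretely_div_free_def)
    finally show ?thesis .
  qed
  with d show ?thesis by (simp add: discretely_div_free_def)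
qed

section \<open>Growth of the potential and pointwise estimates\<close>

text \<open>
  The slope \<open>r \<phi>'' / \<phi>'\<close> lies in \<open>[1/3, 3]\<close> and stays away from 1, so \<open>\<phi>'\<close> grows at least like
  \<open>r powr (1/3)\<close> and at most like \<open>r\<^sup>3\<close>, and \<open>\<phi>' / r\<close> is strictly monotone.
\<close>
locale power_like_potential =
  fixes \<phi> :: "real \<Rightarrow> real"
  assumes standing: "standing_assumptions \<phi>"
    and slope: "(ereal (1/3) \<le> S_minus \<phi> \<and> S_minus \<phi> \<le> S_plus \<phi> \<and> S_plus \<phi> < 1) \<or>
            (1 < S_minus \<phi> \<and> S_minus \<phi> \<le> S_plus \<phi> \<and> S_plus \<phi> \<le> 3)"
begin

abbreviation \<psi> :: "real \<Rightarrow> real" where "\<psi> \<equiv> deriv \<phi>"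

lemma C3: "C3_open_half_line \<phi>"
  using standing by (simp add: standing_assumptions_def)

lemma deriv_iterate_DERIV:
  assumes "k < 3" "r > 0"
  shows "((deriv ^^ k) \<phi> has_real_derivative (deriv ^^ Suc k) \<phi> r) (at r)"
  using C3 assms by (auto simp: C3_open_half_line_def DERIV_deriv_iff_real_differentiable)

lemma DERIV_phi: "r > 0 \<Longrightarrow> (\<phi> has_real_derivative \<psi> r) (at r)"
  using deriv_iterate_DERIV[of 0 r] by simp

lemma DERIV_psi: "r > 0 \<Longrightarrow> (\<psi> has_real_derivative deriv \<psi> r) (at r)"
  using deriv_iterate_DERIV[of 1 r] by simp

lemma DERIV_psi': "r > 0 \<Longrightarrow> (deriv \<psi> has_real_derivative deriv (deriv \<psi>) r) (at r)"
  using deriv_iterate_DERIV[of 2 r] by (simp add: numeral_2_eq_2)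

lemma continuous_psi'': "continuous_on {0<..} (deriv (deriv \<psi>))"
  using C3 by (simp add: C3_open_half_line_def numeral_3_eq_3)

lemma phi_pos: "r > 0 \<Longrightarrow> \<phi> r > 0" and phi_0: "\<phi> 0 = 0"
  and phi_convex: "convex_on {0..} \<phi>" and phi_continuous: "continuous_on {0..} \<phi>"
  using standing by (auto simp: standing_assumptions_def N_function_def)

lemma phi_nonneg: "r \<ge> 0 \<Longrightarrow> \<phi> r \<ge> 0"
  using phi_pos[of r] phi_0 by (cases "r = 0") auto

lemma psi_pos: assumes "r > 0" shows "\<psi> r > 0"
proof -
  have "1 < (INF r\<in>{0<..}. ereal (r * \<psi> r / \<phi> r))"
    using standing by (simp add: standing_assumptions_def)
  also have "\<dots> \<le> ereal (r * \<psi> r / \<phi> r)" using assms by (intro INF_lower) simp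
  finally have "1 < r * \<psi> r / \<phi> r" by simp
  then have "\<phi> r < r * \<psi> r" using phi_pos[OF assms] by (simp add: field_simps)
  then have "0 < r * \<psi> r" using phi_pos[OF assms] by linarith
  then show ?thesis using assms by (simp add: zero_less_mult_iff)
qed

lemma S_bounds:
  assumes "r > 0"
  shows "S_minus \<phi> \<le> ereal (r * deriv \<psi> r / \<psi> r)" "ereal (r * deriv \<psi> r / \<psi> r) \<le> S_plus \<phi>"
  unfolding S_minus_def S_plus_def using assms by (auto intro: INF_lower SUP_upper)

lemma psi'_bounds:
  assumes "r > 0"
  shows "\<psi> r \<le> 3 * (r * deriv \<psi> r)" "r * deriv \<psi> r \<le> 3 * \<psi> r"
proof -
  have "ereal (1/3) \<le> S_minus \<phi>"
    using slope
  proof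
    assume "1 < S_minus \<phi> \<and> S_minus \<phi> \<le> S_plus \<phi> \<and> S_plus \<phi> \<le> 3"
    then have "ereal 1 \<le> S_minus \<phi>" unfolding one_ereal_def by (intro less_imp_le) simp
    then show ?thesis by (rule order_trans[rotated]) simp
  qed simp
  from order_trans[OF this S_bounds(1)[OF assms]] show "\<psi> r \<le> 3 * (r * deriv \<psi> r)"
    using psi_pos[OF assms] by (simp add: field_simps)
  have "S_plus \<phi> \<le> ereal 3"
    using slope
  proof
    assume "ereal (1 / 3) \<le> S_minus \<phi> \<and> S_minus \<phi> \<le> S_plus \<phi> \<and> S_plus \<phi> < 1"
    then have "S_plus \<phi> \<le> ereal 1" unfolding one_ereal_def by (intro less_imp_le) simp
    then show ?thesis by (rule order_trans) simp
  qed (simp add: numeral_eq_ereal)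
  from order_trans[OF S_bounds(2)[OF assms] this] show "r * deriv \<psi> r \<le> 3 * \<psi> r"
    using psi_pos[OF assms] by (simp add: field_simps)
qed

lemma slope_gap:
  obtains \<eta> where "\<eta> > 0"
    "(\<forall>r>0. r * deriv \<psi> r \<le> (1 - \<eta>) * \<psi> r) \<or> (\<forall>r>0. (1 + \<eta>) * \<psi> r \<le> r * deriv \<psi> r)"
  using slope
proof
  assume "ereal (1 / 3) \<le> S_minus \<phi> \<and> S_minus \<phi> \<le> S_plus \<phi> \<and> S_plus \<phi> < 1"
  then obtain z where z: "S_plus \<phi> = ereal z" "z < 1" by (cases "S_plus \<phi>") auto
  have "r * deriv \<psi> r \<le> (1 - (1 - z)) * \<psi> r" if "r > 0" for r
    using S_bounds(2)[OF that] z psi_pos[OF that] by (simp add: field_simps)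
  with that[of "1 - z"] z(2) show ?thesis by auto
next
  assume "1 < S_minus \<phi> \<and> S_minus \<phi> \<le> S_plus \<phi> \<and> S_plus \<phi> \<le> 3"
  then obtain z where z: "S_minus \<phi> = ereal z" "z > 1" by (cases "S_minus \<phi>") auto
  have "(1 + (z - 1)) * \<psi> r \<le> r * deriv \<psi> r" if "r > 0" for r
    using S_bounds(1)[OF that] z psi_pos[OF that] by (simp add: field_simps)
  with that[of "z - 1"] z(2) show ?thesis by auto
qed

lemma tangent: "0 < z \<Longrightarrow> 0 \<le> x \<Longrightarrow> \<phi> z + \<psi> z * (x - z) \<le> \<phi> x"
  using convex_on_imp_above_tangent[OF phi_convex, of z x "\<psi> z"] DERIV_phi[of z]
  by (auto simp: has_field_derivative_at_within interior_Ici)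

lemma mono_of_DERIV:
  fixes f f' :: "real \<Rightarrow> real"
  assumes "0 < b" "b \<le> a" "\<And>x. 0 < x \<Longrightarrow> (f has_real_derivative f' x) (at x)" "\<And>x. 0 < x \<Longrightarrow> 0 \<le> f' x"
  shows "f b \<le> f a"
proof (rule DERIV_nonneg_imp_nondecreasing[OF assms(2)])
  fix x assume "b \<le> x"
  with assms(1) have "0 < x" by simp
  then show "\<exists>y. (f has_real_derivative y) (at x) \<and> 0 \<le> y" using assms(3,4) by blast
qed

text \<open>
  The upper slope bound says that \<open>\<psi> r / r\<^sup>3\<close> is nonincreasing.
\<close>
lemma psi_upper_growth:
  assumes "0 < b" "b \<le> a" shows "\<psi> a * b ^ 3 \<le> \<psi> b * a ^ 3"
proof -
  have "- (\<psi> b / b ^ 3) \<le> - (\<psi> a / a ^ 3)"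
  proof (rule mono_of_DERIV[OF assms])
    fix x :: real assume x: "0 < x"
    show "((\<lambda>x. - (\<psi> x / x ^ 3)) has_real_derivative (3 * \<psi> x - x * deriv \<psi> x) / x ^ 4) (at x)"
      using x by (auto intro!: derivative_eq_intros DERIV_psi simp: field_simps eval_nat_numeral)
    show "0 \<le> (3 * \<psi> x - x * deriv \<psi> x) / x ^ 4" using psi'_bounds(2)[OF x] by simp
  qed
  then show ?thesis using assms by (simp add: field_simps)
qed

text \<open>
  The lower slope bound says that \<open>(\<psi> r)\<^sup>3 / r\<close> is nondecreasing.
\<close>
lemma psi_lower_growth:
  assumes "0 < b" "b \<le> a" shows "\<psi> b ^ 3 * a \<le> \<psi> a ^ 3 * b"
proof -
  have "\<psi> b ^ 3 / b \<le> \<psi> a ^ 3 / a"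
  proof (rule mono_of_DERIV[OF assms])
    fix x :: real assume x: "0 < x"
    show "((\<lambda>x. \<psi> x ^ 3 / x) has_real_derivative
        (\<psi> x)\<^sup>2 * (3 * (x * deriv \<psi> x) - \<psi> x) / x\<^sup>2) (at x)"
      using x by (auto intro!: derivative_eq_intros DERIV_psi simp: field_simps eval_nat_numeral)
    show "0 \<le> (\<psi> x)\<^sup>2 * (3 * (x * deriv \<psi> x) - \<psi> x) / x\<^sup>2" using psi'_bounds(1)[OF x] by simp
  qed
  then show ?thesis using assms by (simp add: field_simps)
qed

lemma psi_mono: assumes "0 < b" "b \<le> a" shows "\<psi> b \<le> \<psi> a"
proof (rule mono_of_DERIV[OF assms DERIV_psi])
  fix x :: real assume x: "0 < x"
  have "0 < 3 * (x * deriv \<psi> x)" using psi'_bounds(1)[OF x] psi_pos[OF x] by linarith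
  then show "0 \<le> deriv \<psi> x" using x by (simp add: zero_less_mult_iff)
qed

text \<open>
  For \<open>z = \<psi> b / \<psi> a\<close>, lower growth gives \<open>z\<^sup>3 \<le> b / a\<close>, and \<open>(z - 1)\<^sup>2 (z + 2) \<ge> 0\<close> turns the cube into the
  linear bound \<open>3 z \<le> b / a + 2\<close>.
\<close>
lemma psi_increment_lower:
  assumes "0 < b" "b \<le> a" shows "\<psi> a * (a - b) \<le> 3 * a * (\<psi> a - \<psi> b)"
proof -
  define z where "z = \<psi> b / \<psi> a"
  have pos: "\<psi> a > 0" "\<psi> b > 0" "a > 0" using assms by (auto intro: psi_pos)
  have "z ^ 3 \<le> b / a"
    using psi_lower_growth[OF assms] pos unfolding z_def by (simp add: field_simps)
  moreover have "0 \<le> (z - 1)\<^sup>2 * (z + 2)" using pos by (simp add: z_def)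
  then have "3 * z \<le> z ^ 3 + 2" by (simp add: field_simps eval_nat_numeral)
  ultimately have "3 * z \<le> b / a + 2" by linarith
  then show ?thesis using pos unfolding z_def by (simp add: field_simps)
qed

text \<open>
  The same cubic inequality, applied to \<open>x = b / a\<close>, makes \<open>\<psi> b \<ge> x\<^sup>3 \<psi> a\<close> linear in \<open>x\<close>.
\<close>
lemma psi_increment_upper:
  assumes "0 < b" "b \<le> a" shows "a * (\<psi> a - \<psi> b) \<le> 3 * \<psi> a * (a - b)"
proof -
  define x where "x = b / a"
  have pos: "\<psi> a > 0" "a > 0" using assms by (auto intro: psi_pos)
  have "\<psi> a * x ^ 3 \<le> \<psi> b"
    using psi_upper_growth[OF assms] pos unfolding x_def by (simp add: field_simps)
  moreover have "0 \<le> (x - 1)\<^sup>2 * (x + 2)" using assms pos by (simp add: x_def)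
  then have "3 * x - 2 \<le> x ^ 3" by (simp add: field_simps eval_nat_numeral)
  then have "\<psi> a * (3 * x - 2) \<le> \<psi> a * x ^ 3" using pos by (intro mult_left_mono) auto
  ultimately have "\<psi> a * (3 * x - 2) \<le> \<psi> b" by linarith
  then have "a * (\<psi> a * (3 * x - 2)) \<le> a * \<psi> b" using pos by (intro mult_left_mono) auto
  moreover have "a * x = b" using pos by (simp add: x_def)
  moreover have "a * (\<psi> a * (3 * x - 2)) = \<psi> a * (3 * (a * x) - 2 * a)" by (simp add: algebra_simps)
  ultimately have "\<psi> a * (3 * b - 2 * a) \<le> a * \<psi> b" by simp
  then show ?thesis by (simp add: algebra_simps)
qed

text \<open>
  Two tangent inequalities, from \<open>b\<close> to the midpoint and from the midpoint to \<open>a\<close>, replace the Bregman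
  distance by a product of increments.
\<close>
lemma bregman_midpoint:
  assumes "0 \<le> a" "0 < b" "0 < a + b"
  shows "(\<psi> ((a + b) / 2) - \<psi> b) * ((a - b) / 2) \<le> \<phi> a - \<phi> b - \<psi> b * (a - b)"
proof -
  let ?m = "(a + b) / 2"
  have "\<phi> ?m + \<psi> ?m * (a - ?m) \<le> \<phi> a" "\<phi> b + \<psi> b * (?m - b) \<le> \<phi> ?m"
    using assms tangent[of ?m a] tangent[of b ?m] by simp_all
  moreover have "a - ?m = (a - b) / 2" "?m - b = (a - b) / 2" by (simp_all add: field_simps)
  ultimately show ?thesis by (simp add: field_simps)
qed

text \<open>
  The increment of \<open>\<psi>\<close> over half of the interval is compared with the value at the larger end point
  \<open>M\<close>; for \<open>a > b\<close> the midpoint is at least \<open>M / 2\<close>, so upper growth loses only a constant.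
\<close>
lemma bregman_lower:
  assumes "0 < a" "0 < b" "M = max a b"
  shows "\<psi> M * (a - b)\<^sup>2 / (48 * M) \<le> \<phi> a - \<phi> b - \<psi> b * (a - b)"
proof -
  let ?m = "(a + b) / 2"
  have M: "M > 0" "\<psi> M > 0" using assms by (auto intro!: psi_pos simp: less_max_iff_disj)
  have "\<psi> M * (a - b)\<^sup>2 / (48 * M) \<le> (\<psi> ?m - \<psi> b) * ((a - b) / 2)"
  proof (cases "b \<le> a")
    case True
    then have Ma: "M = a" using assms by simp
    have m: "\<psi> ?m > 0" using assms by (auto intro: psi_pos)
    have "\<psi> a * ?m ^ 3 \<le> \<psi> ?m * a ^ 3" using assms True by (intro psi_upper_growth) auto
    moreover have "\<psi> a * (?m * (a / 2)\<^sup>2) \<le> \<psi> a * ?m ^ 3"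
      using assms True psi_pos[of a]
      by (auto intro!: mult_left_mono power_mono simp: eval_nat_numeral mult_mono)
    ultimately have "\<psi> a * (?m * (a / 2)\<^sup>2) \<le> \<psi> ?m * a ^ 3" by linarith
    then have "(\<psi> a * ?m) * (a * a) \<le> (4 * a * \<psi> ?m) * (a * a)"
      by (simp add: eval_nat_numeral algebra_simps)
    then have "\<psi> a * ?m \<le> 4 * a * \<psi> ?m" by (rule mult_right_le_imp_le) (use assms in auto)
    then have 1: "\<psi> a / a \<le> 4 * (\<psi> ?m / ?m)" using assms by (simp add: field_simps)
    have "\<psi> ?m * (?m - b) \<le> 3 * ?m * (\<psi> ?m - \<psi> b)"
      using assms True by (intro psi_increment_lower) auto
    moreover have "?m - b = (a - b) / 2" by (simp add: field_simps)
    ultimately have "\<psi> ?m / ?m * ((a - b) / 6) \<le> \<psi> ?m - \<psi> b" using assms by (simp add: field_simps)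
    then have "\<psi> ?m / ?m * ((a - b) / 6) * ((a - b) / 2) \<le> (\<psi> ?m - \<psi> b) * ((a - b) / 2)"
      using True by (intro mult_right_mono) auto
    moreover have "\<psi> a / a * ((a - b)\<^sup>2 / 48) \<le> 4 * (\<psi> ?m / ?m) * ((a - b)\<^sup>2 / 48)"
      using 1 by (intro mult_right_mono) auto
    moreover have "4 * x * ((a - b)\<^sup>2 / 48) = x * ((a - b) / 6) * ((a - b) / 2)" for x
      by (simp add: power2_eq_square)
    then have "4 * (\<psi> ?m / ?m) * ((a - b)\<^sup>2 / 48) = \<psi> ?m / ?m * ((a - b) / 6) * ((a - b) / 2)" .
    moreover have "\<psi> a * (a - b)\<^sup>2 / (48 * a) = \<psi> a / a * ((a - b)\<^sup>2 / 48)" by simp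
    ultimately show ?thesis unfolding Ma by linarith
  next
    case False
    then have Mb: "M = b" using assms by simp
    have "\<psi> b * (b - ?m) \<le> 3 * b * (\<psi> b - \<psi> ?m)"
      using assms False by (intro psi_increment_lower) auto
    moreover have "b - ?m = (b - a) / 2" by (simp add: field_simps)
    ultimately have "\<psi> b / b * ((b - a) / 6) \<le> \<psi> b - \<psi> ?m" using assms by (simp add: field_simps)
    then have 2: "\<psi> b / b * ((b - a) / 6) * ((b - a) / 2) \<le> (\<psi> b - \<psi> ?m) * ((b - a) / 2)"
      using False by (intro mult_right_mono) auto
    have "\<psi> b * (a - b)\<^sup>2 / (48 * b) = \<psi> b / b * ((b - a)\<^sup>2 / 48)"
      by (simp add: power2_commute)
    also have "\<dots> \<le> \<psi> b / b * ((b - a)\<^sup>2 / 12)"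
      using psi_pos[OF assms(2)] assms by (intro mult_left_mono) auto
    also have "\<dots> = \<psi> b / b * ((b - a) / 6) * ((b - a) / 2)"
      by (simp add: power2_eq_square)
    also note 2
    also have "(x - y) * ((b - a) / 2) = (y - x) * ((a - b) / 2)" for x y :: real
      by (simp add: field_simps)
    then have "(\<psi> b - \<psi> ?m) * ((b - a) / 2) = (\<psi> ?m - \<psi> b) * ((a - b) / 2)" .
    finally show ?thesis unfolding Mb .
  qed
  also have "\<dots> \<le> \<phi> a - \<phi> b - \<psi> b * (a - b)" using assms by (intro bregman_midpoint) auto
  finally show ?thesis .
qed

text \<open>
  Since \<open>|V(P)|\<^sup>2 = |P| \<psi>(|P|)\<close>, this is the case of parallel vectors. Rationalising the difference of the
  square roots leaves the increment of \<open>r \<psi> r\<close>, which is at most \<open>4 \<psi> a (a - b)\<close>.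
\<close>
lemma V_norm_increment_le:
  assumes "0 < b" "b \<le> a"
  shows "(sqrt (a * \<psi> a) - sqrt (b * \<psi> b))\<^sup>2 \<le> 16 * \<psi> a * (a - b)\<^sup>2 / a"
proof -
  have pos: "a > 0" "\<psi> a > 0" "\<psi> b > 0" using assms by (auto intro: psi_pos)
  let ?va = "sqrt (a * \<psi> a)" and ?vb = "sqrt (b * \<psi> b)"
  have va: "?va > 0" "?vb \<ge> 0" using pos assms by auto
  have le: "?vb \<le> ?va" using assms pos psi_mono[OF assms] by (auto intro!: mult_mono)
  have "(?va - ?vb) * ?va \<le> (?va - ?vb) * (?va + ?vb)" using va le by (intro mult_left_mono) auto
  also have "\<dots> = a * \<psi> a - b * \<psi> b" using pos assms by (simp add: algebra_simps)
  also have "\<dots> = a * (\<psi> a - \<psi> b) + \<psi> b * (a - b)" by (simp add: algebra_simps)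
  also have "\<dots> \<le> 3 * \<psi> a * (a - b) + \<psi> a * (a - b)"
    using psi_increment_upper[OF assms] psi_mono[OF assms] assms by (intro add_mono mult_right_mono) auto
  finally have "(?va - ?vb) * ?va \<le> 4 * \<psi> a * (a - b)" by simp
  then have "((?va - ?vb) * ?va)\<^sup>2 \<le> (4 * \<psi> a * (a - b))\<^sup>2" using le va by (intro power_mono) auto
  then have "(?va - ?vb)\<^sup>2 * (a * \<psi> a) \<le> (16 * \<psi> a * (a - b)\<^sup>2) * \<psi> a"
    using pos by (simp add: power_mult_distrib power2_eq_square algebra_simps)
  then have "((?va - ?vb)\<^sup>2 * a) * \<psi> a \<le> (16 * \<psi> a * (a - b)\<^sup>2) * \<psi> a"
    by (simp only: mult.assoc)
  then have "(?va - ?vb)\<^sup>2 * a \<le> 16 * \<psi> a * (a - b)\<^sup>2"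
    by (rule mult_right_le_imp_le) (rule pos)
  then show ?thesis using pos by (simp add: field_simps)
qed

lemma bregman_controls_V_norm:
  assumes "0 < a" "0 < b"
  shows "(sqrt (a * \<psi> a) - sqrt (b * \<psi> b))\<^sup>2 / 768 \<le> \<phi> a - \<phi> b - \<psi> b * (a - b)"
proof -
  define M where "M = max a b"
  have "(sqrt (a * \<psi> a) - sqrt (b * \<psi> b))\<^sup>2 \<le> 16 * \<psi> M * (a - b)\<^sup>2 / M"
    using V_norm_increment_le[of b a] V_norm_increment_le[of a b] assms
    by (cases "b \<le> a") (auto simp: M_def max_def power2_commute)
  then show ?thesis using bregman_lower[OF assms M_def] by simp
qed

text \<open>
  This bound and the next one settle the antiparallel case below, where nothing is gained from differences.
\<close>
lemma phi_lower: assumes "0 < a" shows "a * \<psi> a / 16 \<le> \<phi> a"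
proof -
  have "\<psi> a * (a / 2) ^ 3 \<le> \<psi> (a / 2) * a ^ 3" using assms by (intro psi_upper_growth) auto
  then have 1: "\<psi> a / 8 \<le> \<psi> (a / 2)" using assms by (simp add: field_simps eval_nat_numeral)
  have "\<phi> (a / 2) + \<psi> (a / 2) * (a - a / 2) \<le> \<phi> a" using assms by (intro tangent) auto
  moreover have "\<phi> (a / 2) \<ge> 0" using assms by (intro phi_nonneg) auto
  moreover have "\<psi> a / 8 * (a / 2) \<le> \<psi> (a / 2) * (a - a / 2)"
    using 1 assms psi_pos[of "a / 2"] by (intro mult_mono) auto
  ultimately show ?thesis by simp
qed

lemma conjugate_lower: assumes "0 < b" shows "b * \<psi> b / 12 \<le> b * \<psi> b - \<phi> b"
proof -
  have "(\<psi> ((0 + b) / 2) - \<psi> b) * ((0 - b) / 2) \<le> \<phi> 0 - \<phi> b - \<psi> b * (0 - b)"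
    using assms by (intro bregman_midpoint) auto
  moreover have "\<psi> b * (b - b / 2) \<le> 3 * b * (\<psi> b - \<psi> (b / 2))"
    using assms by (intro psi_increment_lower) auto
  ultimately show ?thesis by (simp add: phi_0 field_simps)
qed

lemma mu_square: "r > 0 \<Longrightarrow> mu \<phi> (r\<^sup>2) = \<psi> r / r"
  using mu_eq[OF C3, of "r\<^sup>2"] by simp

lemma norm_V_map: "(norm (V_map \<phi> P))\<^sup>2 = norm P * \<psi> (norm P)"
proof (cases "P = 0")
  case False
  then have "norm P > 0" by simp
  with psi_pos[OF this] have "\<psi> (norm P) / norm P > 0" by simp
  then have "(norm (V_map \<phi> P))\<^sup>2 = \<psi> (norm P) / norm P * (norm P)\<^sup>2"
    using \<open>norm P > 0\<close>
    by (simp only: V_map_def mu_square norm_scaleR power_mult_distrib power2_abs real_sqrt_pow2 less_imp_le)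
  then show ?thesis using False by (simp add: power2_eq_square)
qed (simp add: V_map_def)

text \<open>
  For fixed lengths \<open>a\<close>, \<open>b\<close> both sides are affine in the cosine \<open>k\<close> of the angle between \<open>P\<close> and \<open>R\<close>, so
  only the parallel and the antiparallel configuration have to be checked.
\<close>
lemma bregman_controls_V:
  "(norm (V_map \<phi> P - V_map \<phi> R))\<^sup>2 / 768 \<le> \<phi> (norm P) - \<phi> (norm R) - A_map \<phi> R \<bullet> (P - R)"
proof -
  define a b where "a = norm P" and "b = norm R"
  consider "P = 0" "R = 0" | "P = 0" "R \<noteq> 0" | "P \<noteq> 0" "R = 0" | "P \<noteq> 0" "R \<noteq> 0" by blast
  then show ?thesis
  proof cases
    case 1 then show ?thesis by (simp add: V_map_def A_map_def)
  next
    case 2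
    then have b: "b > 0" by (simp add: b_def)
    have "A_map \<phi> R \<bullet> (P - R) = - (b * \<psi> b)"
      using 2 b by (simp add: A_map_def mu_square b_def[symmetric] power2_norm_eq_inner[symmetric],
          simp add: power2_eq_square)
    moreover have "(norm (V_map \<phi> P - V_map \<phi> R))\<^sup>2 = b * \<psi> b"
      using norm_V_map[of R] 2 by (simp add: V_map_def b_def)
    ultimately show ?thesis using conjugate_lower[OF b] mult_pos_pos[OF b psi_pos[OF b]] 2 phi_0
      by (simp add: b_def[symmetric])
  next
    case 3
    then have a: "a > 0" by (simp add: a_def)
    have "(norm (V_map \<phi> P - V_map \<phi> R))\<^sup>2 = a * \<psi> a"
      using norm_V_map[of P] 3 by (simp add: V_map_def a_def)
    then show ?thesis using phi_lower[OF a] mult_pos_pos[OF a psi_pos[OF a]] 3 phi_0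
      by (simp add: a_def[symmetric] A_map_def)
  next
    case 4
    then have ab: "a > 0" "b > 0" by (simp_all add: a_def b_def)
    define k where "k = P \<bullet> R / (a * b)"
    have PR: "P \<bullet> R = a * b * k" using ab by (simp add: k_def)
    have "\<bar>P \<bullet> R\<bar> \<le> a * b" unfolding a_def b_def by (rule Cauchy_Schwarz_ineq2)
    then have k: "-1 \<le> k" "k \<le> 1" using ab by (auto simp: k_def field_simps abs_le_iff)
    define va vb where "va = sqrt (a * \<psi> a)" and "vb = sqrt (b * \<psi> b)"
    have pos: "\<psi> a > 0" "\<psi> b > 0" using ab by (auto intro: psi_pos)
    have v2: "va\<^sup>2 = a * \<psi> a" "vb\<^sup>2 = b * \<psi> b" using ab pos by (simp_all add: va_def vb_def)
    have VP: "V_map \<phi> P = (va / a) *\<^sub>R P" and VR: "V_map \<phi> R = (vb / b) *\<^sub>R R"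
      using ab by (simp_all add: V_map_def mu_square va_def vb_def real_sqrt_mult real_sqrt_divide
          real_div_sqrt flip: a_def b_def, simp_all add: field_simps)
    have "(norm (V_map \<phi> P - V_map \<phi> R))\<^sup>2
        = (norm (V_map \<phi> P))\<^sup>2 + (norm (V_map \<phi> R))\<^sup>2 - 2 * (V_map \<phi> P \<bullet> V_map \<phi> R)"
      by (simp add: power2_norm_eq_inner inner_diff_left inner_diff_right inner_commute)
    also have "V_map \<phi> P \<bullet> V_map \<phi> R = va * vb * k"
      unfolding VP VR using ab by (simp add: PR)
    finally have V: "(norm (V_map \<phi> P - V_map \<phi> R))\<^sup>2 = va\<^sup>2 + vb\<^sup>2 - 2 * (va * vb * k)"
      by (simp add: norm_V_map v2 flip: a_def b_def)
    have "A_map \<phi> R = (\<psi> b / b) *\<^sub>R R"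
      using ab by (simp add: A_map_def mu_square flip: b_def)
    then have A: "A_map \<phi> R \<bullet> (P - R) = \<psi> b * (a * k - b)"
      using ab PR by (simp add: inner_diff_right inner_commute[of R P] power2_norm_eq_inner[symmetric]
          b_def[symmetric] power2_eq_square field_simps)
    define L where "L k = \<phi> a - \<phi> b - \<psi> b * (a * k - b) - (va\<^sup>2 + vb\<^sup>2 - 2 * (va * vb * k)) / 768" for k
    have "L 1 \<ge> 0"
      using bregman_controls_V_norm[OF ab] unfolding L_def va_def[symmetric] vb_def[symmetric]
      by (simp add: power2_diff field_simps)
    moreover have "L (-1) \<ge> 0"
    proof -
      have arith: "0 \<le> x - y + w + z - (A + B + 2 * C) / 768"
        if "2 * C \<le> A + B" "A / 16 \<le> x" "B / 12 \<le> z - y" "0 \<le> w" "0 \<le> A" "0 \<le> B" for x y z w A B C :: real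
        using that by (simp add: field_simps)
      have "2 * (va * vb) \<le> va\<^sup>2 + vb\<^sup>2" using sum_squares_bound[of va vb] by (simp add: mult.assoc)
      moreover have "va\<^sup>2 / 16 \<le> \<phi> a" "vb\<^sup>2 / 12 \<le> b * \<psi> b - \<phi> b" "0 \<le> \<psi> b * a"
        using phi_lower[OF ab(1)] conjugate_lower[OF ab(2)] pos ab by (simp_all add: v2)
      ultimately have "0 \<le> \<phi> a - \<phi> b + \<psi> b * a + b * \<psi> b - (va\<^sup>2 + vb\<^sup>2 + 2 * (va * vb)) / 768"
        by (rule arith) (rule zero_le_power2)+
      also have "\<dots> = L (-1)" by (simp add: L_def algebra_simps)
      finally show ?thesis .
    qed
    ultimately have "0 \<le> (1 + k) / 2 * L 1 + (1 - k) / 2 * L (-1)" using k by simp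
    also have "\<dots> = L k" by (simp add: L_def field_simps)
    finally show ?thesis unfolding V A L_def a_def[symmetric] b_def[symmetric] by simp
  qed
qed

lemma isCont_psi: "r > 0 \<Longrightarrow> isCont \<psi> r"
  using DERIV_psi DERIV_isCont by blast

text \<open>
  The left side is largest at the point \<open>b = y\<close> with \<open>\<psi> y = \<tau>\<close>, where it is a Bregman distance and
  hence at most \<open>(\<psi> a - \<tau>) (a - y)\<close>. The point \<open>y\<close> is the derivative of the convex conjugate at \<open>\<tau>\<close>;
  it enters only through an interval that contains it.
\<close>
lemma energy_gap_through_dual_point:
  assumes "0 < a" "0 \<le> b" "0 < l" "l \<le> u" "\<psi> l \<le> \<tau>" "\<tau> \<le> \<psi> u" "l \<le> a" "a \<le> u"
  shows "\<phi> a - \<phi> b - \<tau> * (a - b) \<le> \<bar>\<psi> a - \<tau>\<bar> * (u - l)"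
proof -
  have "\<exists>y\<ge>l. y \<le> u \<and> \<psi> y = \<tau>"
    using assms by (intro IVT) (auto intro: isCont_psi)
  then obtain y where y: "l \<le> y" "y \<le> u" "\<psi> y = \<tau>" by blast
  have "\<phi> y + \<tau> * (b - y) \<le> \<phi> b" using tangent[of y b] y assms by auto
  moreover have "\<phi> a + \<psi> a * (y - a) \<le> \<phi> y" using tangent[of a y] y assms by auto
  ultimately have "\<phi> a - \<phi> b - \<tau> * (a - b) \<le> (\<psi> a - \<tau>) * (a - y)" by (simp add: algebra_simps)
  also have "\<dots> \<le> \<bar>(\<psi> a - \<tau>) * (a - y)\<bar>" by simp
  also have "\<dots> = \<bar>\<psi> a - \<tau>\<bar> * \<bar>a - y\<bar>" by (rule abs_mult)
  also have "\<dots> \<le> \<bar>\<psi> a - \<tau>\<bar> * (u - l)" using y assms by (intro mult_left_mono) auto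
  finally show ?thesis .
qed

text \<open>
  Rescale by \<open>k\<close>: with \<open>\<rho> = a / k\<close> and \<open>\<tau> = \<rho> \<psi> k\<close> one has to bound \<open>|\<psi> a - \<tau>| |a - y|\<close> by a multiple of
  \<open>k \<psi> k (\<rho> - 1)\<^sup>2 (\<rho> + 1)\<^sup>2\<close>. Monotonicity of \<open>\<psi> r / r\<close> bounds one factor by a multiple of
  \<open>|\<rho> - 1|\<close>, and the growth exponents \<open>1/3\<close> and \<open>3\<close> bound the other by a multiple of \<open>|\<rho>\<^sup>3 - 1|\<close> or \<open>|\<rho> - \<rho>\<^sup>3|\<close>; larger
  exponents would exceed the fourth power of \<open>\<rho>\<close> on the right.
\<close>
lemma energy_gap_scalar:
  assumes "0 < a" "0 \<le> b" "0 < k"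
    and ratio: "(\<forall>r s. 0 < r \<longrightarrow> r \<le> s \<longrightarrow> \<psi> s / s \<le> \<psi> r / r) \<or>
                (\<forall>r s. 0 < r \<longrightarrow> r \<le> s \<longrightarrow> \<psi> r / r \<le> \<psi> s / s)"
  shows "\<phi> a - \<phi> b - \<psi> k / k * a * (a - b) \<le> 2 * (\<psi> k / k ^ 3) * (k\<^sup>2 - a\<^sup>2)\<^sup>2"
proof -
  define \<rho> where "\<rho> = a / k"
  define \<tau> where "\<tau> = \<psi> k * \<rho>"
  have pos: "\<psi> k > 0" "\<psi> a > 0" "\<rho> > 0" using assms by (auto intro: psi_pos simp: \<rho>_def)
  have a: "a = k * \<rho>" using assms by (simp add: \<rho>_def)
  define B where "B = 2 * ((\<rho> - 1)\<^sup>2 * (\<rho> + 1)\<^sup>2)"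
  have gap: "\<phi> a - \<phi> b - \<tau> * (a - b) \<le> (\<psi> k * k) * B"
    if l: "0 < l" "l \<le> a" "a \<le> u" and \<tau>: "\<psi> l \<le> \<tau>" "\<tau> \<le> \<psi> u"
      and X: "\<bar>\<psi> a - \<tau>\<bar> \<le> \<psi> k * X" and Y: "u - l = k * Y" and XY: "X * Y \<le> B" for l u X Y
  proof -
    have "\<phi> a - \<phi> b - \<tau> * (a - b) \<le> \<bar>\<psi> a - \<tau>\<bar> * (u - l)"
      using energy_gap_through_dual_point[of a b l u \<tau>] l \<tau> assms by simp
    also have "\<dots> \<le> (\<psi> k * X) * (k * Y)"
      unfolding Y[symmetric] using X l by (intro mult_right_mono) auto
    also have "\<dots> = (\<psi> k * k) * (X * Y)" by (simp only: mult_ac)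
    also have "\<dots> \<le> (\<psi> k * k) * B" using XY pos assms by (intro mult_left_mono) auto
    finally show ?thesis .
  qed
  have grow: "\<psi> (k * \<rho> ^ 3) \<le> \<tau>" if "\<rho> \<le> 1"
  proof -
    have "k * \<rho> ^ 3 \<le> k" using that pos assms by (simp add: power_le_one)
    then have "\<psi> (k * \<rho> ^ 3) ^ 3 * k \<le> \<psi> k ^ 3 * (k * \<rho> ^ 3)"
      using assms pos by (intro psi_lower_growth) auto
    then have "\<psi> (k * \<rho> ^ 3) ^ 3 * k \<le> \<tau> ^ 3 * k" by (simp add: \<tau>_def power_mult_distrib algebra_simps)
    then have "\<psi> (k * \<rho> ^ 3) ^ 3 \<le> \<tau> ^ 3" using assms by simp
    moreover have "0 \<le> \<psi> (k * \<rho> ^ 3)" "0 \<le> \<tau>"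
      using pos assms psi_pos[of "k * \<rho> ^ 3"] by (simp_all add: \<tau>_def)
    ultimately show ?thesis by (simp add: power_mono_iff)
  qed
  have grow': "\<tau> \<le> \<psi> (k * \<rho> ^ 3)" if "1 \<le> \<rho>"
  proof -
    have "k \<le> k * \<rho> ^ 3" using that pos assms by simp
    then have "\<psi> k ^ 3 * (k * \<rho> ^ 3) \<le> \<psi> (k * \<rho> ^ 3) ^ 3 * k"
      using assms pos by (intro psi_lower_growth) auto
    then have "\<tau> ^ 3 * k \<le> \<psi> (k * \<rho> ^ 3) ^ 3 * k" by (simp add: \<tau>_def power_mult_distrib algebra_simps)
    then have "\<tau> ^ 3 \<le> \<psi> (k * \<rho> ^ 3) ^ 3" using assms by simp
    moreover have "0 \<le> \<psi> (k * \<rho> ^ 3)" "0 \<le> \<tau>"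
      using pos assms psi_pos[of "k * \<rho> ^ 3"] by (simp_all add: \<tau>_def)
    ultimately show ?thesis by (simp add: power_mono_iff)
  qed
  have cube: "\<rho> ^ 3 = \<rho> * \<rho> * \<rho>" by (simp add: eval_nat_numeral)
  have poly_le: "(\<rho> - 1)\<^sup>2 * z \<le> B" if "z \<le> \<rho>\<^sup>2 + \<rho> + 1" for z
  proof -
    have "2 * (\<rho> + 1)\<^sup>2 = 2 * \<rho>\<^sup>2 + 4 * \<rho> + 2" by (simp add: power2_sum)
    then have "z \<le> 2 * (\<rho> + 1)\<^sup>2" using that pos zero_le_power2[of \<rho>] by linarith
    then have "(\<rho> - 1)\<^sup>2 * z \<le> (\<rho> - 1)\<^sup>2 * (2 * (\<rho> + 1)\<^sup>2)" by (intro mult_left_mono) auto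
    then show ?thesis by (simp add: B_def)
  qed
  have "\<phi> a - \<phi> b - \<tau> * (a - b) \<le> (\<psi> k * k) * B"
  proof (cases "1 \<le> \<rho>")
    case True
    have ka: "k \<le> a" using True assms by (simp add: a)
    have a3: "a \<le> k * \<rho> ^ 3" using True assms by (simp add: a self_le_power)
    have key: "(\<rho> - 1) * (\<rho> ^ 3 - 1) \<le> B" "(\<rho> ^ 3 - 1) * (\<rho> - 1) \<le> B"
      using poly_le[of "\<rho>\<^sup>2 + \<rho> + 1"] by (simp_all add: cube power2_eq_square algebra_simps)
    from ratio show ?thesis
    proof
      assume "\<forall>r s. 0 < r \<longrightarrow> r \<le> s \<longrightarrow> \<psi> s / s \<le> \<psi> r / r"
      then have "\<psi> a / a \<le> \<psi> k / k" using ka assms by blast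
      then have le: "\<psi> a \<le> \<tau>" using assms by (simp add: \<tau>_def \<rho>_def field_simps)
      have k: "\<psi> k \<le> \<psi> a" by (rule psi_mono[OF assms(3) ka])
      have X: "\<bar>\<psi> a - \<tau>\<bar> \<le> \<psi> k * (\<rho> - 1)" using le k by (simp add: \<tau>_def algebra_simps)
      show ?thesis
        by (rule gap[OF assms(3) ka a3 order_trans[OF k le] grow'[OF True] X _ key(1)])
          (simp add: algebra_simps)
    next
      assume "\<forall>r s. 0 < r \<longrightarrow> r \<le> s \<longrightarrow> \<psi> r / r \<le> \<psi> s / s"
      then have "\<psi> k / k \<le> \<psi> a / a" using ka assms by blast
      then have le: "\<tau> \<le> \<psi> a" using assms by (simp add: \<tau>_def \<rho>_def field_simps)
      have k: "\<psi> k \<le> \<tau>" using True pos by (simp add: \<tau>_def)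
      have "\<psi> a * k ^ 3 \<le> \<psi> k * a ^ 3" by (rule psi_upper_growth[OF assms(3) ka])
      then have "\<psi> a * k ^ 3 \<le> (\<psi> k * \<rho> ^ 3) * k ^ 3" by (simp add: a power_mult_distrib algebra_simps)
      then have "\<psi> a \<le> \<psi> k * \<rho> ^ 3" using assms by simp
      then have X: "\<bar>\<psi> a - \<tau>\<bar> \<le> \<psi> k * (\<rho> ^ 3 - 1)" using le k by (simp add: algebra_simps)
      show ?thesis
        by (rule gap[OF assms(3) ka order_refl k le X _ key(2)]) (simp add: a algebra_simps)
    qed
  next
    case False
    then have r1: "\<rho> \<le> 1" by simp
    have ak: "a \<le> k" using r1 assms by (simp add: a)
    have r3: "k * \<rho> ^ 3 \<le> a" using r1 pos assms power_decreasing[of 1 3 \<rho>] by (simp add: a)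
    have key: "(1 - \<rho>) * (\<rho> - \<rho> ^ 3) \<le> B" "(\<rho> - \<rho> ^ 3) * (1 - \<rho>) \<le> B"
      using poly_le[of "\<rho>\<^sup>2 + \<rho>"] by (simp_all add: cube power2_eq_square algebra_simps)
    from ratio show ?thesis
    proof
      assume "\<forall>r s. 0 < r \<longrightarrow> r \<le> s \<longrightarrow> \<psi> s / s \<le> \<psi> r / r"
      then have "\<psi> k / k \<le> \<psi> a / a" using ak assms by blast
      then have le: "\<tau> \<le> \<psi> a" using assms by (simp add: \<tau>_def \<rho>_def field_simps)
      have k: "\<psi> a \<le> \<psi> k" by (rule psi_mono[OF assms(1) ak])
      have X: "\<bar>\<psi> a - \<tau>\<bar> \<le> \<psi> k * (1 - \<rho>)" using le k by (simp add: \<tau>_def algebra_simps)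
      have l: "0 < k * \<rho> ^ 3" using assms pos by simp
      show ?thesis
        by (rule gap[OF l r3 order_refl grow[OF r1] le X _ key(1)]) (simp add: a algebra_simps)
    next
      assume "\<forall>r s. 0 < r \<longrightarrow> r \<le> s \<longrightarrow> \<psi> r / r \<le> \<psi> s / s"
      then have "\<psi> a / a \<le> \<psi> k / k" using ak assms by blast
      then have le: "\<psi> a \<le> \<tau>" using assms by (simp add: \<tau>_def \<rho>_def field_simps)
      have k: "\<tau> \<le> \<psi> k" using r1 pos by (simp add: \<tau>_def)
      have "\<psi> k * a ^ 3 \<le> \<psi> a * k ^ 3" by (rule psi_upper_growth[OF assms(1) ak])
      then have "(\<psi> k * \<rho> ^ 3) * k ^ 3 \<le> \<psi> a * k ^ 3" by (simp add: a power_mult_distrib algebra_simps)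
      then have "\<psi> k * \<rho> ^ 3 \<le> \<psi> a" using assms by simp
      then have X: "\<bar>\<psi> a - \<tau>\<bar> \<le> \<psi> k * (\<rho> - \<rho> ^ 3)" using le by (simp add: \<tau>_def algebra_simps)
      show ?thesis
        by (rule gap[OF assms(1) order_refl ak le k X _ key(2)]) (simp add: a algebra_simps)
    qed
  qed
  also have "(\<psi> k * k) * B = 2 * (\<psi> k * k) * ((\<rho> - 1)\<^sup>2 * (\<rho> + 1)\<^sup>2)" by (simp add: B_def)
  also have "2 * (\<psi> k * k) * ((\<rho> - 1)\<^sup>2 * (\<rho> + 1)\<^sup>2) = 2 * (\<psi> k / k ^ 3) * (k\<^sup>2 - a\<^sup>2)\<^sup>2"
  proof -
    have "k\<^sup>2 - a\<^sup>2 = - (k\<^sup>2 * ((\<rho> - 1) * (\<rho> + 1)))" by (simp add: a power2_eq_square algebra_simps)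
    then have "(k\<^sup>2 - a\<^sup>2)\<^sup>2 = k ^ 4 * ((\<rho> - 1)\<^sup>2 * (\<rho> + 1)\<^sup>2)"
      by (simp only: power2_minus power_mult_distrib power_mult[symmetric]) simp
    moreover have "\<psi> k / k ^ 3 * k ^ 4 = \<psi> k * k" using assms by (simp add: eval_nat_numeral)
    ultimately show ?thesis by (metis (no_types, lifting) mult.assoc)
  qed
  finally show ?thesis by (simp add: \<tau>_def \<rho>_def field_simps)
qed

text \<open>
  With explicit formulas for the first two derivatives of \<open>\<mu>\<close>, continuity of the second one is inherited from \<open>\<phi>\<close>.
\<close>
definition mu' :: "real \<Rightarrow> real" where
  "mu' r = (sqrt r * deriv \<psi> (sqrt r) - \<psi> (sqrt r)) / (2 * sqrt r ^ 3)"

lemma DERIV_mu: assumes "r > 0" shows "(mu \<phi> has_real_derivative mu' r) (at r)"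
proof -
  have s: "sqrt r > 0" using assms by simp
  have square_to_cube: "x / y\<^sup>2 * (inverse y / 2) = x / (2 * y ^ 3)" for x y :: real
    by (cases "y = 0") (simp_all add: field_simps power2_eq_square power3_eq_cube)
  have "((\<lambda>s. \<psi> s / s) has_real_derivative (s * deriv \<psi> s - \<psi> s) / s\<^sup>2) (at s)" if "s > 0" for s
    using that by (auto intro!: derivative_eq_intros DERIV_psi simp: field_simps power2_eq_square)
  from DERIV_chain2[OF this[OF s] DERIV_real_sqrt[OF assms]]
  have "((\<lambda>r. \<psi> (sqrt r) / sqrt r) has_real_derivative mu' r) (at r)"
    unfolding mu'_def square_to_cube .
  then show ?thesis
    by (rule has_field_derivative_transform_within_open[where S = "{0<..}"])
      (use assms in \<open>auto simp: mu_eq[OF C3]\<close>)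
qed

lemma deriv_mu: "r > 0 \<Longrightarrow> deriv (mu \<phi>) r = mu' r"
  using DERIV_mu DERIV_imp_deriv by blast

lemma DERIV_mu_deriv: "r > 0 \<Longrightarrow> (mu \<phi> has_real_derivative deriv (mu \<phi>) r) (at r)"
  using DERIV_mu deriv_mu by simp

definition mu'' :: "real \<Rightarrow> real" where
  "mu'' r = (let s = sqrt r in
     (s\<^sup>2 * deriv (deriv \<psi>) s - 3 * (s * deriv \<psi> s - \<psi> s)) / (4 * s ^ 5))"

lemma DERIV_mu':
  assumes "r > 0" shows "(deriv (mu \<phi>) has_real_derivative mu'' r) (at r)"
proof -
  have s: "sqrt r > 0" using assms by simp
  have fourth_to_fifth: "x / (2 * y ^ 4) * (inverse y / 2) = x / (4 * y ^ 5)" for x y :: real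
    by (cases "y = 0") (simp_all add: field_simps eval_nat_numeral)
  have "((\<lambda>s. (s * deriv \<psi> s - \<psi> s) / (2 * s ^ 3)) has_real_derivative
      (s\<^sup>2 * deriv (deriv \<psi>) s - 3 * (s * deriv \<psi> s - \<psi> s)) / (2 * s ^ 4)) (at s)" if "s > 0" for s
    using that by (auto intro!: derivative_eq_intros DERIV_psi DERIV_psi' simp: field_simps eval_nat_numeral)
  from DERIV_chain2[OF this[OF s] DERIV_real_sqrt[OF assms]]
  have "(mu' has_real_derivative mu'' r) (at r)"
    unfolding mu'_def[abs_def] mu''_def Let_def fourth_to_fifth .
  then show ?thesis
    by (rule has_field_derivative_transform_within_open[where S = "{0<..}"])
      (use assms in \<open>auto simp: deriv_mu\<close>)
qed

lemma deriv_mu': "r > 0 \<Longrightarrow> deriv (deriv (mu \<phi>)) r = mu'' r"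
  using DERIV_mu' DERIV_imp_deriv by blast

lemma DERIV_mu_deriv2:
  "r > 0 \<Longrightarrow> (deriv (mu \<phi>) has_real_derivative deriv (deriv (mu \<phi>)) r) (at r)"
  using DERIV_mu' deriv_mu' by simp

lemma continuous_mu: "continuous_on {0<..} (mu \<phi>)" "continuous_on {0<..} (deriv (mu \<phi>))"
  by (auto intro!: continuous_at_imp_continuous_on DERIV_isCont DERIV_mu_deriv DERIV_mu_deriv2)

lemma continuous_mu'': "continuous_on {0<..} (deriv (deriv (mu \<phi>)))"
proof -
  have c: "continuous_on {0<..} \<psi>" "continuous_on {0<..} (deriv \<psi>)"
    by (auto intro!: continuous_at_imp_continuous_on DERIV_isCont DERIV_psi DERIV_psi')
  have "continuous_on {0<..} mu''"
    unfolding mu''_def[abs_def] Let_def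
    by (intro continuous_intros continuous_on_compose2[OF continuous_psi'']
        continuous_on_compose2[OF c(1)] continuous_on_compose2[OF c(2)]) auto
  then show ?thesis by (rule continuous_on_eq) (simp add: deriv_mu')
qed

lemma mu_pos: "r > 0 \<Longrightarrow> mu \<phi> r > 0"
  by (simp add: mu_eq[OF C3] psi_pos)

lemma psi_ratio_monotone:
  "(\<forall>r s. 0 < r \<longrightarrow> r \<le> s \<longrightarrow> \<psi> s / s \<le> \<psi> r / r) \<or>
   (\<forall>r s. 0 < r \<longrightarrow> r \<le> s \<longrightarrow> \<psi> r / r \<le> \<psi> s / s)"
proof -
  have D: "((\<lambda>r. \<psi> r / r) has_real_derivative (r * deriv \<psi> r - \<psi> r) / r\<^sup>2) (at r)" if "r > 0" for r
    using that by (auto intro!: derivative_eq_intros DERIV_psi simp: field_simps power2_eq_square)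
  obtain \<eta> where "\<eta> > 0" and \<eta>: "(\<forall>r>0. r * deriv \<psi> r \<le> (1 - \<eta>) * \<psi> r) \<or>
      (\<forall>r>0. (1 + \<eta>) * \<psi> r \<le> r * deriv \<psi> r)"
    by (rule slope_gap)
  have \<eta>\<psi>: "\<eta> * \<psi> r > 0" if "r > 0" for r using \<open>\<eta> > 0\<close> psi_pos[OF that] by simp
  from \<eta> show ?thesis
  proof
    assume h: "\<forall>r>0. r * deriv \<psi> r \<le> (1 - \<eta>) * \<psi> r"
    have "- (\<psi> r / r) \<le> - (\<psi> s / s)" if "0 < r" "r \<le> s" for r s
    proof (rule mono_of_DERIV[OF that DERIV_minus[OF D]])
      fix x :: real assume x: "0 < x"
      have "x * deriv \<psi> x - \<psi> x \<le> 0" using h x \<eta>\<psi>[OF x] by (fastforce simp: algebra_simps)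
      then show "0 \<le> - ((x * deriv \<psi> x - \<psi> x) / x\<^sup>2)" by (simp add: divide_nonpos_nonneg)
    qed
    then show ?thesis by simp
  next
    assume h: "\<forall>r>0. (1 + \<eta>) * \<psi> r \<le> r * deriv \<psi> r"
    have "\<psi> r / r \<le> \<psi> s / s" if "0 < r" "r \<le> s" for r s
    proof (rule mono_of_DERIV[OF that D])
      fix x :: real assume x: "0 < x"
      have "x * deriv \<psi> x - \<psi> x \<ge> 0" using h x \<eta>\<psi>[OF x] by (fastforce simp: algebra_simps)
      then show "0 \<le> (x * deriv \<psi> x - \<psi> x) / x\<^sup>2" by simp
    qed
    then show ?thesis by simp
  qed
qed

text \<open>
  At \<open>k\<^sup>2\<close> the derivative of \<open>\<mu>\<close> is \<open>(k \<psi>' - \<psi>) / (2 k\<^sup>3)\<close>, and the slope \<open>k \<psi>' / \<psi>\<close> keeps a fixed distance from 1.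
\<close>
lemma mu'_lower:
  obtains \<eta> where "\<eta> > 0" "\<And>k. k > 0 \<Longrightarrow> \<eta> * (\<psi> k / k ^ 3) \<le> \<bar>deriv (mu \<phi>) (k\<^sup>2)\<bar>"
proof -
  obtain \<eta> where "\<eta> > 0" and \<eta>: "(\<forall>r>0. r * deriv \<psi> r \<le> (1 - \<eta>) * \<psi> r) \<or>
      (\<forall>r>0. (1 + \<eta>) * \<psi> r \<le> r * deriv \<psi> r)"
    by (rule slope_gap)
  have "\<eta> / 2 * (\<psi> k / k ^ 3) \<le> \<bar>deriv (mu \<phi>) (k\<^sup>2)\<bar>" if k: "k > 0" for k
  proof -
    have "\<eta> * \<psi> k \<le> \<bar>k * deriv \<psi> k - \<psi> k\<bar>"
      using \<eta>
    proof
      assume "\<forall>r>0. r * deriv \<psi> r \<le> (1 - \<eta>) * \<psi> r"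
      with k have "k * deriv \<psi> k \<le> (1 - \<eta>) * \<psi> k" by blast
      then show ?thesis by (simp add: algebra_simps)
    next
      assume "\<forall>r>0. (1 + \<eta>) * \<psi> r \<le> r * deriv \<psi> r"
      with k have "(1 + \<eta>) * \<psi> k \<le> k * deriv \<psi> k" by blast
      then show ?thesis by (simp add: algebra_simps)
    qed
    then have "\<eta> * \<psi> k / (2 * k ^ 3) \<le> \<bar>k * deriv \<psi> k - \<psi> k\<bar> / (2 * k ^ 3)"
      using k by (intro divide_right_mono) auto
    then show ?thesis using k by (simp add: deriv_mu mu'_def abs_mult power_abs)
  qed
  then show ?thesis using that[of "\<eta> / 2"] \<open>\<eta> > 0\<close> by simp
qed

text \<open>
  By Cauchy-Schwarz the left side is largest when \<open>R\<close> is parallel to \<open>P\<close>, which is the scalar estimate.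
\<close>
lemma energy_gap:
  obtains K where "K > 0"
    "\<And>(P :: 'm::euclidean_space) R c. c > 0 \<Longrightarrow>
       \<phi> (norm P) - \<phi> (norm R) - mu \<phi> c * (P \<bullet> (P - R))
         \<le> K * (\<bar>deriv (mu \<phi>) c\<bar> * (c - (norm P)\<^sup>2)\<^sup>2)"
proof -
  obtain \<eta> where \<eta>: "\<eta> > 0" "\<And>k. k > 0 \<Longrightarrow> \<eta> * (\<psi> k / k ^ 3) \<le> \<bar>deriv (mu \<phi>) (k\<^sup>2)\<bar>"
    by (rule mu'_lower) blast
  have "\<phi> (norm P) - \<phi> (norm R) - mu \<phi> c * (P \<bullet> (P - R))
         \<le> 2 / \<eta> * (\<bar>deriv (mu \<phi>) c\<bar> * (c - (norm P)\<^sup>2)\<^sup>2)"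
    if c: "c > 0" for P R :: "'m" and c
  proof (cases "P = 0")
    case True
    have "0 \<le> 2 / \<eta> * (\<bar>deriv (mu \<phi>) c\<bar> * (c - (norm P)\<^sup>2)\<^sup>2)" using \<eta> by simp
    with True show ?thesis using phi_nonneg[of "norm R"] phi_0 by simp
  next
    case False
    define k where "k = sqrt c"
    have k: "k > 0" "c = k\<^sup>2" using c by (auto simp: k_def)
    have m: "mu \<phi> c = \<psi> k / k" "\<psi> k / k > 0" using k psi_pos[of k] by (simp_all add: mu_square)
    have "P \<bullet> (P - R) \<ge> norm P * (norm P - norm R)"
      using norm_cauchy_schwarz[of P R]
      by (simp add: inner_diff_right power2_norm_eq_inner[symmetric] power2_eq_square algebra_simps)
    then have "mu \<phi> c * (norm P * (norm P - norm R)) \<le> mu \<phi> c * (P \<bullet> (P - R))"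
      using m by (intro mult_left_mono) auto
    then have "\<phi> (norm P) - \<phi> (norm R) - mu \<phi> c * (P \<bullet> (P - R))
      \<le> \<phi> (norm P) - \<phi> (norm R) - \<psi> k / k * norm P * (norm P - norm R)"
      unfolding m(1) by (simp only: mult.assoc)
    also have "\<dots> \<le> 2 * (\<psi> k / k ^ 3) * (k\<^sup>2 - (norm P)\<^sup>2)\<^sup>2"
      using False k by (intro energy_gap_scalar psi_ratio_monotone) auto
    also have "2 * (\<psi> k / k ^ 3) \<le> 2 / \<eta> * \<bar>deriv (mu \<phi>) c\<bar>"
      using \<eta>(2)[OF k(1)] \<eta>(1) k by (simp add: field_simps)
    finally show ?thesis
      by (simp add: k(2) mult.assoc mult_right_mono)
  qed
  then show ?thesis using that[of "2 / \<eta>"] \<eta> by simp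
qed
end

section \<open>Measurability and norm equivalence\<close>

text \<open>
  Coefficients are positive only almost everywhere, while \<open>\<mu>\<close> is arbitrary at negative arguments, so
  compositions with coefficients are measurable only thanks to completeness of Lebesgue measure.
\<close>
lemma borel_measurable_AE_cong_complete:
  fixes f g :: "real ^ 'd \<Rightarrow> 'b::euclidean_space"
  assumes \<Omega>: "\<Omega> \<in> sets lebesgue" and f: "f \<in> borel_measurable (lebesgue_on \<Omega>)"
    and ae: "AE x in lebesgue_on \<Omega>. f x = g x"
  shows "g \<in> borel_measurable (lebesgue_on \<Omega>)"
proof -
  have f': "(\<lambda>x. if x \<in> \<Omega> then f x else 0) \<in> borel_measurable lebesgue"
    using f by (simp add: borel_measurable_if[OF \<Omega>])
  have "AE x in lebesgue. x \<in> \<Omega> \<longrightarrow> f x = g x"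
    using ae by (subst (asm) AE_restrict_space_iff) (use \<Omega> in auto)
  then have ae': "AE x in lebesgue. (if x \<in> \<Omega> then f x else 0) = (if x \<in> \<Omega> then g x else 0)"
    by eventually_elim auto
  have "(\<lambda>x. if x \<in> \<Omega> then g x else 0) \<in> borel_measurable lebesgue"
  proof (rule measurableI)
    fix A :: "'b set" assume A: "A \<in> sets borel"
    have "(\<lambda>x. if x \<in> \<Omega> then g x else 0) -` A \<inter> space lebesgue \<in> sets lebesgue"
    proof (rule completion.in_sets_AE)
      show "(\<lambda>x. if x \<in> \<Omega> then f x else 0) -` A \<inter> space lebesgue \<in> sets lebesgue"
        using f' A by (rule measurable_sets)
      show "AE x in lebesgue. (x \<in> (\<lambda>x. if x \<in> \<Omega> then f x else 0) -` A \<inter> space lebesgue)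
          = (x \<in> (\<lambda>x. if x \<in> \<Omega> then g x else 0) -` A \<inter> space lebesgue)"
        using ae' by eventually_elim auto
    qed simp
    then show "(\<lambda>x. if x \<in> \<Omega> then g x else 0) -` A \<inter> space lebesgue \<in> sets lebesgue" .
  qed simp
  then show ?thesis by (simp add: borel_measurable_if[OF \<Omega>])
qed

lemma borel_measurable_comp_pos:
  fixes f :: "real \<Rightarrow> real" and c :: "real ^ 'd \<Rightarrow> real"
  assumes \<Omega>: "\<Omega> \<in> sets lebesgue" and c: "c \<in> borel_measurable (lebesgue_on \<Omega>)"
    and pos: "AE x in lebesgue_on \<Omega>. c x > 0" and f: "continuous_on {0<..} f"
  shows "(\<lambda>x. f (c x)) \<in> borel_measurable (lebesgue_on \<Omega>)"
proof (rule borel_measurable_AE_cong_complete[OF \<Omega>])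
  have "(\<lambda>r. if r \<in> {0<..} then f r else 0) \<in> borel_measurable borel"
    by (rule borel_measurable_continuous_on_if) (use f in auto)
  from measurable_compose[OF c this]
  show "(\<lambda>x. if c x \<in> {0<..} then f (c x) else 0) \<in> borel_measurable (lebesgue_on \<Omega>)" .
  show "AE x in lebesgue_on \<Omega>. (if c x \<in> {0<..} then f (c x) else 0) = f (c x)"
    using pos by eventually_elim simp
qed

definition ess_bounded :: "'a measure \<Rightarrow> ('a \<Rightarrow> real) \<Rightarrow> bool" where
  "ess_bounded M f \<longleftrightarrow> f \<in> borel_measurable M \<and> (\<exists>K. AE x in M. \<bar>f x\<bar> \<le> K)"

definition orthonormal_family :: "'a measure \<Rightarrow> ('a \<Rightarrow> real) set \<Rightarrow> bool" where
  "orthonormal_family M E \<longleftrightarrow> finite E \<and> (\<forall>e\<in>E. ess_bounded M e) \<and>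
     (\<forall>e\<in>E. \<forall>e'\<in>E. (LINT x|M. e x * e' x) = (if e = e' then 1 else 0))"

definition projection :: "'a measure \<Rightarrow> ('a \<Rightarrow> real) set \<Rightarrow> ('a \<Rightarrow> real) \<Rightarrow> 'a \<Rightarrow> real" where
  "projection M E f x = (\<Sum>e\<in>E. (LINT y|M. f y * e y) * e x)"

context finite_measure
begin

lemma ess_bounded_integrable: "ess_bounded M f \<Longrightarrow> integrable M f"
  unfolding ess_bounded_def by (auto intro!: integrable_const_bound)

lemma ess_bounded_mult:
  assumes "ess_bounded M f" "ess_bounded M g" shows "ess_bounded M (\<lambda>x. f x * g x)"
proof -
  from assms obtain K L where "AE x in M. \<bar>f x\<bar> \<le> K" "AE x in M. \<bar>g x\<bar> \<le> L"
    unfolding ess_bounded_def by blast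
  then have "AE x in M. \<bar>f x * g x\<bar> \<le> K * L"
    by eventually_elim (auto simp: abs_mult intro!: mult_mono)
  moreover have "(\<lambda>x. f x * g x) \<in> borel_measurable M"
    using assms unfolding ess_bounded_def by (intro borel_measurable_times) blast+
  ultimately show ?thesis unfolding ess_bounded_def by blast
qed

lemma ess_bounded_add:
  assumes "ess_bounded M f" "ess_bounded M g" shows "ess_bounded M (\<lambda>x. f x + g x)"
proof -
  from assms obtain K L where "AE x in M. \<bar>f x\<bar> \<le> K" "AE x in M. \<bar>g x\<bar> \<le> L"
    unfolding ess_bounded_def by blast
  then have "AE x in M. \<bar>f x + g x\<bar> \<le> K + L" by eventually_elim linarith
  moreover have "(\<lambda>x. f x + g x) \<in> borel_measurable M"
    using assms unfolding ess_bounded_def by (intro borel_measurable_add) blast+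
  ultimately show ?thesis unfolding ess_bounded_def by blast
qed

lemma ess_bounded_const: "ess_bounded M (\<lambda>x. c)"
  unfolding ess_bounded_def by (intro conjI exI[of _ "\<bar>c\<bar>"]) auto

lemma ess_bounded_scale: "ess_bounded M f \<Longrightarrow> ess_bounded M (\<lambda>x. c * f x)"
  by (rule ess_bounded_mult[OF ess_bounded_const])

lemma ess_bounded_sum:
  "finite I \<Longrightarrow> (\<And>i. i \<in> I \<Longrightarrow> ess_bounded M (h i)) \<Longrightarrow> ess_bounded M (\<lambda>x. \<Sum>i\<in>I. h i x)"
proof (induction I rule: finite_induct)
  case (insert i I)
  have "ess_bounded M (\<lambda>x. h i x + (\<Sum>i\<in>I. h i x))"
    by (intro ess_bounded_add insert.IH insert.prems) simp_all
  then show ?case using insert.hyps by simp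
qed (simp add: ess_bounded_const)

lemma integral_mult_sum:
  assumes "finite I" "ess_bounded M g" "\<And>i. i \<in> I \<Longrightarrow> ess_bounded M (h i)"
  shows "(LINT x|M. (\<Sum>i\<in>I. a i * h i x) * g x) = (\<Sum>i\<in>I. a i * (LINT x|M. h i x * g x))"
proof -
  have "(LINT x|M. (\<Sum>i\<in>I. a i * h i x) * g x) = (LINT x|M. (\<Sum>i\<in>I. a i * (h i x * g x)))"
    by (simp only: sum_distrib_right mult.assoc)
  also have "\<dots> = (\<Sum>i\<in>I. (LINT x|M. a i * (h i x * g x)))"
    by (intro Bochner_Integration.integral_sum integrable_mult_right ess_bounded_integrable
        ess_bounded_mult assms)
  finally show ?thesis by simp
qed

lemma orthonormal_family_member: "orthonormal_family M E \<Longrightarrow> e \<in> E \<Longrightarrow> ess_bounded M e"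
  unfolding orthonormal_family_def by blast

lemma ess_bounded_projection:
  assumes "orthonormal_family M E" shows "ess_bounded M (projection M E f)"
proof -
  have "finite E" using assms unfolding orthonormal_family_def by blast
  then show ?thesis unfolding projection_def[abs_def]
    by (intro ess_bounded_sum ess_bounded_scale orthonormal_family_member[OF assms])
qed

lemma projection_linear:
  assumes E: "orthonormal_family M E" and C: "finite C" "\<And>b. b \<in> C \<Longrightarrow> ess_bounded M b"
    and reproduced: "\<And>b. b \<in> C \<Longrightarrow> AE x in M. b x = projection M E b x"
  shows "AE x in M. (\<Sum>b\<in>C. a b * b x) = projection M E (\<lambda>x. \<Sum>b\<in>C. a b * b x) x"
proof -
  have I: "(LINT y|M. (\<Sum>b\<in>C. a b * b y) * e y) = (\<Sum>b\<in>C. a b * (LINT y|M. b y * e y))"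
    if "e \<in> E" for e
    by (rule integral_mult_sum[OF C(1) orthonormal_family_member[OF E that] C(2)])
  have "AE x in M. \<forall>b\<in>C. b x = projection M E b x"
    using C(1) reproduced by (intro AE_finite_allI)
  then show ?thesis
  proof eventually_elim
    fix x assume h: "\<forall>b\<in>C. b x = projection M E b x"
    have "(\<Sum>b\<in>C. a b * b x) = (\<Sum>b\<in>C. \<Sum>e\<in>E. a b * ((LINT y|M. b y * e y) * e x))"
    proof (rule sum.cong[OF refl])
      fix b assume "b \<in> C"
      with h have "b x = projection M E b x" by blast
      then show "a b * b x = (\<Sum>e\<in>E. a b * ((LINT y|M. b y * e y) * e x))"
        by (simp only: projection_def sum_distrib_left)
    qed
    also have "\<dots> = (\<Sum>e\<in>E. \<Sum>b\<in>C. a b * ((LINT y|M. b y * e y) * e x))" by (rule sum.swap)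
    also have "\<dots> = (\<Sum>e\<in>E. (LINT y|M. (\<Sum>b\<in>C. a b * b y) * e y) * e x)"
    proof (rule sum.cong[OF refl])
      fix e assume "e \<in> E"
      show "(\<Sum>b\<in>C. a b * ((LINT y|M. b y * e y) * e x)) = (LINT y|M. (\<Sum>b\<in>C. a b * b y) * e y) * e x"
        unfolding I[OF \<open>e \<in> E\<close>] by (simp only: sum_distrib_right mult.assoc)
    qed
    finally show "(\<Sum>b\<in>C. a b * b x) = projection M E (\<lambda>x. \<Sum>b\<in>C. a b * b x) x"
      by (simp only: projection_def)
  qed
qed

text \<open>
  A Gram-Schmidt step: the normalised remainder of \<open>f\<close> is added, unless it vanishes almost everywhere.
\<close>
lemma orthonormal_family_extend:
  assumes E: "orthonormal_family M E" and f: "ess_bounded M f"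
  obtains E' where "orthonormal_family M E'" "AE x in M. f x = projection M E' f x"
    "\<And>b. ess_bounded M b \<Longrightarrow> AE x in M. b x = projection M E b x \<Longrightarrow> AE x in M. b x = projection M E' b x"
proof -
  have fin: "finite E" using E unfolding orthonormal_family_def by blast
  note Eb = orthonormal_family_member[OF E]
  have on: "(LINT x|M. e x * e' x) = (if e = e' then 1 else 0)" if "e \<in> E" "e' \<in> E" for e e'
    using E that unfolding orthonormal_family_def by blast
  define p where "p = projection M E f"
  define g where "g x = f x - p x" for x
  have p: "ess_bounded M p" unfolding p_def by (rule ess_bounded_projection[OF E])
  have g: "ess_bounded M g"
    using ess_bounded_add[OF f ess_bounded_scale[OF p, of "-1"]] by (simp add: g_def[abs_def])
  have ortho: "(LINT x|M. g x * e x) = 0" if e: "e \<in> E" for e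
  proof -
    have "(LINT x|M. p x * e x) = (\<Sum>e'\<in>E. (LINT y|M. f y * e' y) * (LINT x|M. e' x * e x))"
      unfolding p_def projection_def by (rule integral_mult_sum[OF fin Eb[OF e] Eb])
    also have "\<dots> = (\<Sum>e'\<in>E. if e' = e then (LINT y|M. f y * e y) else 0)"
      using on[OF _ e] by (intro sum.cong) auto
    also have "\<dots> = (LINT y|M. f y * e y)" using fin e by simp
    finally have "(LINT x|M. p x * e x) = (LINT y|M. f y * e y)" .
    moreover have "(LINT x|M. g x * e x) = (LINT x|M. f x * e x) - (LINT x|M. p x * e x)"
      unfolding g_def left_diff_distrib
      by (intro Bochner_Integration.integral_diff ess_bounded_integrable ess_bounded_mult f p Eb e)
    ultimately show ?thesis by simp
  qed
  define n where "n = (LINT x|M. g x * g x)"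
  have n0: "n \<ge> 0" unfolding n_def by (intro Bochner_Integration.integral_nonneg) auto
  show ?thesis
  proof (cases "n = 0")
    case True
    have "AE x in M. g x * g x = 0"
      using True integral_nonneg_eq_0_iff_AE[OF ess_bounded_integrable[OF ess_bounded_mult[OF g g]]]
      by (simp add: n_def)
    then have "AE x in M. f x = projection M E f x" by eventually_elim (simp add: g_def p_def)
    with E show ?thesis by (rule that)
  next
    case False
    with n0 have n: "n > 0" by simp
    define h where "h x = g x / sqrt n" for x
    have h: "ess_bounded M h"
      using ess_bounded_scale[OF g, of "1 / sqrt n"] by (simp add: h_def[abs_def])
    have hh: "(LINT x|M. h x * h x) = 1"
    proof -
      have "h x * h x = (1 / n) * (g x * g x)" for x using n by (simp add: h_def)
      then show ?thesis using n by (simp add: n_def)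
    qed
    have he: "(LINT x|M. h x * e x) = 0" if "e \<in> E" for e
    proof -
      have "h x * e x = (1 / sqrt n) * (g x * e x)" for x by (simp add: h_def)
      then show ?thesis using ortho[OF that] by simp
    qed
    have hE: "h \<notin> E" using hh he[of h] by auto
    have ph: "(LINT x|M. projection M E b x * h x) = 0" for b
    proof -
      have "(LINT x|M. projection M E b x * h x)
          = (\<Sum>e\<in>E. (LINT y|M. b y * e y) * (LINT x|M. e x * h x))"
        unfolding projection_def by (rule integral_mult_sum[OF fin h Eb])
      also have "\<dots> = 0" using he by (intro sum.neutral) (simp add: mult.commute)
      finally show ?thesis .
    qed
    have proj_insert: "projection M (insert h E) b x = (LINT y|M. b y * h y) * h x + projection M E b x" for b x
      using fin hE by (simp add: projection_def)
    have f_split: "f x = sqrt n * h x + p x" for x using n by (simp add: h_def g_def)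
    have fh: "(LINT x|M. f x * h x) = sqrt n"
    proof -
      have "f x * h x = sqrt n * (h x * h x) + p x * h x" for x
        unfolding f_split by (simp only: distrib_right mult.assoc)
      then show ?thesis
        using ess_bounded_integrable[OF ess_bounded_mult[OF h h]]
          ess_bounded_integrable[OF ess_bounded_mult[OF p h]] hh ph[of f] by (simp add: p_def)
    qed
    show ?thesis
    proof (rule that[of "insert h E"])
      have eh: "(LINT x|M. e x * h x) = 0" if "e \<in> E" for e
        using he[OF that] by (simp only: mult.commute[of "h _"])
      have "(LINT x|M. e x * e' x) = (if e = e' then 1 else 0)"
        if "e \<in> insert h E" "e' \<in> insert h E" for e e'
      proof (cases "e = h")
        case True
        then show ?thesis using that(2) hh he[of e'] hE by (cases "e' = h") auto
      next
        case False
        then have "e \<in> E" using that by blast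
        then show ?thesis using that(2) eh[of e] on[of e e'] hE by (cases "e' = h") auto
      qed
      moreover have "ess_bounded M e" if "e \<in> insert h E" for e
        using that h Eb[of e] by blast
      ultimately show "orthonormal_family M (insert h E)"
        using fin unfolding orthonormal_family_def by blast
      show "AE x in M. f x = projection M (insert h E) f x"
        using n by (intro AE_I2) (simp only: proj_insert fh p_def[symmetric], rule f_split)
      fix b assume b: "ess_bounded M b" "AE x in M. b x = projection M E b x"
      have "(LINT x|M. b x * h x) = (LINT x|M. projection M E b x * h x)"
      proof (rule integral_cong_AE)
        show "AE x in M. b x * h x = projection M E b x * h x"
          using b(2) by eventually_elim simp
      qed (intro borel_measurable_integrable ess_bounded_integrable ess_bounded_mult b h
          ess_bounded_projection E)+
      with ph show "AE x in M. b x = projection M (insert h E) b x"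
        using b(2) by (simp add: proj_insert)
    qed
  qed
qed

lemma orthonormal_basis_exists:
  assumes "finite B" "\<And>b. b \<in> B \<Longrightarrow> ess_bounded M b"
  shows "\<exists>E. orthonormal_family M E \<and> (\<forall>b\<in>B. AE x in M. b x = projection M E b x)"
  using assms
proof (induction B rule: finite_induct)
  case empty
  show ?case by (rule exI[of _ "{}"]) (simp add: orthonormal_family_def)
next
  case (insert f C)
  from insert.IH[OF insert.prems[OF insertI2]] obtain E
    where E: "orthonormal_family M E" "\<forall>b\<in>C. AE x in M. b x = projection M E b x" by blast
  show ?case
  proof (rule orthonormal_family_extend[OF E(1) insert.prems[OF insertI1]])
    fix E' assume E': "orthonormal_family M E'" "AE x in M. f x = projection M E' f x"
      and keep: "\<And>b. ess_bounded M b \<Longrightarrow> AE x in M. b x = projection M E b x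
        \<Longrightarrow> AE x in M. b x = projection M E' b x"
    have "AE x in M. b x = projection M E' b x" if "b \<in> C" for b
      using keep[OF insert.prems[OF insertI2[OF that]] bspec[OF E(2) that]] .
    with E' show ?thesis by (intro exI[of _ E']) simp
  qed
qed

text \<open>
  In an orthonormal basis of bounded functions the coefficients of \<open>f\<close> are integrals of \<open>f\<close> against
  bounded functions, hence controlled by the \<open>L\<^sup>1\<close> norm; so is \<open>f\<close> itself in the sup norm.
\<close>
lemma finite_span_sup_bound:
  assumes B: "finite B" "\<And>b. b \<in> B \<Longrightarrow> ess_bounded M b"
  obtains K where "K \<ge> 0"
    "\<And>a. AE x in M. \<bar>\<Sum>b\<in>B. a b * b x\<bar> \<le> K * (LINT x|M. \<bar>\<Sum>b\<in>B. a b * b x\<bar>)"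
proof -
  from orthonormal_basis_exists[OF B] obtain E where E: "orthonormal_family M E"
    and EB: "\<And>b. b \<in> B \<Longrightarrow> AE x in M. b x = projection M E b x" by blast
  have fin: "finite E" using E unfolding orthonormal_family_def by blast
  note Eb = orthonormal_family_member[OF E]
  have "\<forall>e\<in>E. \<exists>K. AE x in M. \<bar>e x\<bar> \<le> K" using Eb unfolding ess_bounded_def by blast
  then obtain k where k: "\<forall>e\<in>E. AE x in M. \<bar>e x\<bar> \<le> k e" by (rule bchoice[THEN exE])
  have k': "AE x in M. \<bar>e x\<bar> \<le> \<bar>k e\<bar>" if "e \<in> E" for e
    using bspec[OF k that] by eventually_elim linarith
  show ?thesis
  proof (rule that[of "\<Sum>e\<in>E. \<bar>k e\<bar> * \<bar>k e\<bar>"])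
    show "0 \<le> (\<Sum>e\<in>E. \<bar>k e\<bar> * \<bar>k e\<bar>)" by (intro sum_nonneg) simp
    fix a
    define f where "f x = (\<Sum>b\<in>B. a b * b x)" for x
    have f: "ess_bounded M f" unfolding f_def[abs_def] by (intro ess_bounded_sum ess_bounded_scale B)
    have fe: "\<bar>LINT y|M. f y * e y\<bar> \<le> \<bar>k e\<bar> * (LINT y|M. \<bar>f y\<bar>)" if e: "e \<in> E" for e
    proof -
      have "\<bar>LINT y|M. f y * e y\<bar> \<le> (LINT y|M. \<bar>f y * e y\<bar>)" by (rule integral_abs_bound)
      also have "\<dots> \<le> (LINT y|M. \<bar>k e\<bar> * \<bar>f y\<bar>)"
      proof (rule integral_mono_AE)
        show "AE y in M. \<bar>f y * e y\<bar> \<le> \<bar>k e\<bar> * \<bar>f y\<bar>"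
          using k'[OF e] by eventually_elim (simp only: abs_mult mult.commute[of "\<bar>f _\<bar>"], rule mult_right_mono, auto)
      qed (intro integrable_abs integrable_mult_right ess_bounded_integrable ess_bounded_mult f Eb[OF e])+
      finally show ?thesis by simp
    qed
    have "AE x in M. f x = projection M E f x"
      unfolding f_def[abs_def] by (rule projection_linear[OF E B EB])
    moreover have "AE x in M. \<forall>e\<in>E. \<bar>e x\<bar> \<le> \<bar>k e\<bar>" using fin k' by (intro AE_finite_allI)
    ultimately have "AE x in M. \<bar>f x\<bar> \<le> (\<Sum>e\<in>E. \<bar>k e\<bar> * \<bar>k e\<bar>) * (LINT x|M. \<bar>f x\<bar>)"
    proof eventually_elim
      fix x assume r: "f x = projection M E f x" and b: "\<forall>e\<in>E. \<bar>e x\<bar> \<le> \<bar>k e\<bar>"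
      let ?I = "LINT y|M. \<bar>f y\<bar>"
      have "\<bar>f x\<bar> \<le> (\<Sum>e\<in>E. \<bar>(LINT y|M. f y * e y) * e x\<bar>)"
        unfolding r projection_def by (rule sum_abs)
      also have "\<dots> \<le> (\<Sum>e\<in>E. \<bar>k e\<bar> * ?I * \<bar>k e\<bar>)"
        unfolding abs_mult using fe b by (intro sum_mono mult_mono) auto
      also have "\<dots> = (\<Sum>e\<in>E. \<bar>k e\<bar> * \<bar>k e\<bar>) * ?I"
        by (simp only: sum_distrib_right mult.assoc mult.commute[of ?I])
      finally show "\<bar>f x\<bar> \<le> (\<Sum>e\<in>E. \<bar>k e\<bar> * \<bar>k e\<bar>) * ?I" .
    qed
    then show "AE x in M. \<bar>\<Sum>b\<in>B. a b * b x\<bar>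
        \<le> (\<Sum>e\<in>E. \<bar>k e\<bar> * \<bar>k e\<bar>) * (LINT x|M. \<bar>\<Sum>b\<in>B. a b * b x\<bar>)"
      unfolding f_def .
  qed
qed

end

lemma Linf_bound:
  assumes "Linf_on \<Omega> f" obtains K where "AE x in lebesgue_on \<Omega>. \<bar>f x\<bar> \<le> K"
proof -
  have fin: "Linf_norm \<Omega> f < \<infinity>" using assms by (simp add: Linf_on_def)
  have ae: "AE x in lebesgue_on \<Omega>. ereal \<bar>f x\<bar> \<le> Linf_norm \<Omega> f"
    unfolding Linf_norm_def by (rule esssup_AE)
  have "AE x in lebesgue_on \<Omega>. \<bar>f x\<bar> \<le> \<bar>real_of_ereal (Linf_norm \<Omega> f)\<bar>"
    using ae by eventually_elim (use fin in \<open>cases "Linf_norm \<Omega> f"; auto\<close>)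
  then show ?thesis by (rule that)
qed

lemma coefficient_space_sup_bound:
  assumes "\<Omega> \<in> lmeasurable" "coefficient_space \<Omega> Ch"
  obtains K where "K \<ge> 0" "\<And>f. f \<in> Ch \<Longrightarrow> AE x in lebesgue_on \<Omega>. \<bar>f x\<bar> \<le> K * (LINT x|lebesgue_on \<Omega>. \<bar>f x\<bar>)"
proof -
  have fm: "finite_measure (lebesgue_on \<Omega>)" using assms(1) by (rule finite_measure_lebesgue_on)
  obtain B where B: "finite B" "B \<subseteq> Ch" "\<And>f. f \<in> Ch \<Longrightarrow> \<exists>a. f = (\<lambda>x. \<Sum>b\<in>B. a b *\<^sub>R b x)"
    using assms(2) unfolding coefficient_space_def fin_dim_fun_space_def by blast
  have L: "Linf_on \<Omega> b" if "b \<in> B" for b using assms(2) B(2) that by (auto simp: coefficient_space_def)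
  have "ess_bounded (lebesgue_on \<Omega>) b" if b: "b \<in> B" for b
  proof -
    obtain K where "AE x in lebesgue_on \<Omega>. \<bar>b x\<bar> \<le> K" using L[OF b] by (rule Linf_bound)
    with L[OF b] show ?thesis unfolding ess_bounded_def Linf_on_def by blast
  qed
  note B' = this
  show ?thesis
  proof (rule finite_measure.finite_span_sup_bound[OF fm B(1) B'])
    fix K :: real assume K: "K \<ge> 0" "\<And>a. AE x in lebesgue_on \<Omega>.
      \<bar>\<Sum>b\<in>B. a b * b x\<bar> \<le> K * (LINT x|lebesgue_on \<Omega>. \<bar>\<Sum>b\<in>B. a b * b x\<bar>)"
    show ?thesis
    proof (rule that[OF K(1)])
      fix f assume "f \<in> Ch"
      then obtain a where "f = (\<lambda>x. \<Sum>b\<in>B. a b *\<^sub>R b x)" using B(3) by blast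
      then show "AE x in lebesgue_on \<Omega>. \<bar>f x\<bar> \<le> K * (LINT x|lebesgue_on \<Omega>. \<bar>f x\<bar>)"
        using K(2)[of a] by simp
    qed
  qed
qed

section \<open>Dini derivatives and difference quotients\<close>

text \<open>
  The set where \<open>w\<close> stays below a line of small slope \<open>e\<close> is compact, and the Dini bound continues it
  to the right of any of its points; hence its maximum is \<open>T\<close>.
\<close>
lemma nonincreasing_of_upper_Dini:
  fixes w :: "real \<Rightarrow> real"
  assumes cont: "continuous_on {0..} w" and T: "0 \<le> T"
    and Dini: "\<And>t e. 0 \<le> t \<Longrightarrow> 0 < e \<Longrightarrow> eventually (\<lambda>s. w s \<le> w t + e * (s - t)) (at_right t)"
  shows "w T \<le> w 0"
proof (rule field_le_epsilon)
  fix d :: real assume d: "d > 0"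
  \<comment> \<open>The slope is so small that the line rises by at most d up to time T; adding 1 avoids division by 0.\<close>
  define e where "e = d / (T + 1)"
  have e: "e > 0" "e * T \<le> d" using d T by (auto simp: e_def field_simps)
  define S where "S = {t \<in> {0..T}. w t \<le> w 0 + e * t}"
  have "compact S"
  proof -
    have "continuous_on {0..T} w" using cont by (rule continuous_on_subset) auto
    then have "closed ({0..T} \<inter> (\<lambda>t. w t - e * t) -` {..w 0})"
      by (intro continuous_closed_preimage continuous_intros) auto
    moreover have "S = {0..T} \<inter> (\<lambda>t. w t - e * t) -` {..w 0}"
      unfolding S_def by (auto simp: algebra_simps)
    ultimately have "closed S" by simp
    moreover have "bounded S" by (rule bounded_subset[OF bounded_closed_interval[of 0 T]]) (auto simp: S_def)
    ultimately show ?thesis by (simp add: compact_eq_bounded_closed)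
  qed
  moreover have "0 \<in> S" using T by (simp add: S_def)
  ultimately obtain \<tau> where \<tau>: "\<tau> \<in> S" "\<And>t. t \<in> S \<Longrightarrow> t \<le> \<tau>"
    using compact_attains_sup[of S] by blast
  have "\<tau> = T"
  proof (rule ccontr)
    assume "\<tau> \<noteq> T"
    then have lt: "\<tau> < T" "0 \<le> \<tau>" using \<tau>(1) by (auto simp: S_def)
    have "eventually (\<lambda>s. w s \<le> w \<tau> + e * (s - \<tau>)) (at_right \<tau>)" by (rule Dini[OF lt(2) e(1)])
    moreover have "eventually (\<lambda>s. s \<in> {\<tau><..<T}) (at_right \<tau>)" by (rule eventually_at_right_real[OF lt(1)])
    ultimately have "eventually (\<lambda>s. w s \<le> w \<tau> + e * (s - \<tau>) \<and> s \<in> {\<tau><..<T}) (at_right \<tau>)"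
      by (rule eventually_conj)
    then obtain s where s: "w s \<le> w \<tau> + e * (s - \<tau>)" "\<tau> < s" "s < T"
      using eventually_happens'[OF trivial_limit_at_right_real] by fastforce
    have "w \<tau> \<le> w 0 + e * \<tau>" using \<tau>(1) by (simp add: S_def)
    with s have "w s \<le> w 0 + e * s" by (simp add: algebra_simps)
    then have "s \<in> S" using s lt by (simp add: S_def)
    with \<tau>(2) s show False by fastforce
  qed
  then have "w T \<le> w 0 + e * T" using \<tau>(1) by (simp add: S_def)
  with e show "w T \<le> w 0 + d" by linarith
qed

text \<open>
  Multiplication by \<open>exp (\<kappa> t)\<close> reduces the claim to monotonicity.
\<close>
lemma Gronwall_upper_Dini:
  fixes d :: "real \<Rightarrow> real"
  assumes cont: "continuous_on {0..} d" and T: "0 \<le> T"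
    and Dini: "\<And>t e. 0 \<le> t \<Longrightarrow> 0 < e \<Longrightarrow>
      eventually (\<lambda>s. d s \<le> d t + (s - t) * (- \<kappa> * d t + e)) (at_right t)"
  shows "d T \<le> exp (- \<kappa> * T) * d 0"
proof -
  have "exp (\<kappa> * T) * d T \<le> exp (\<kappa> * 0) * d 0"
  proof (rule nonincreasing_of_upper_Dini[where w = "\<lambda>t. exp (\<kappa> * t) * d t", OF _ T])
    show "continuous_on {0..} (\<lambda>t. exp (\<kappa> * t) * d t)" by (intro continuous_intros cont)
    fix t e :: real assume t: "0 \<le> t" and e: "0 < e"
    define e' where "e' = e / (2 * exp (\<kappa> * t))"
    have e': "e' > 0" "exp (\<kappa> * t) * e' = e / 2" using e by (simp_all add: e'_def)
    define f where "f s = exp (\<kappa> * s) * (d t + (s - t) * (- \<kappa> * d t + e'))" for s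
    have "(f has_real_derivative e / 2) (at t)"
      unfolding f_def using e'(2)
      by (auto intro!: derivative_eq_intros simp: algebra_simps)
    then have "((\<lambda>s. (f s - f t) / (s - t)) \<longlongrightarrow> e / 2) (at_right t)"
      unfolding has_field_derivative_iff by (rule tendsto_within_subset) simp
    then have "eventually (\<lambda>s. (f s - f t) / (s - t) < e) (at_right t)"
      by (rule order_tendstoD(2)) (use e in simp)
    moreover have "eventually (\<lambda>s. d s \<le> d t + (s - t) * (- \<kappa> * d t + e')) (at_right t)"
      by (rule Dini[OF t e'(1)])
    moreover have "eventually (\<lambda>s. t < s) (at_right t)" by (simp add: eventually_at_right_less)
    ultimately show "eventually (\<lambda>s. exp (\<kappa> * s) * d s \<le> exp (\<kappa> * t) * d t + e * (s - t)) (at_right t)"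
    proof eventually_elim
      case (elim s)
      have "exp (\<kappa> * s) * d s \<le> f s" unfolding f_def using elim by (intro mult_left_mono) auto
      moreover have "f t = exp (\<kappa> * t) * d t" by (simp add: f_def)
      moreover have "f s - f t < e * (s - t)" using elim by (simp add: pos_divide_less_eq)
      ultimately show ?case by simp
    qed
  qed
  then show ?thesis by (simp add: exp_minus field_simps)
qed

lemma DERIV_chain_sequence:
  fixes f :: "real \<Rightarrow> real"
  assumes f: "(f has_real_derivative f') (at y)" and y: "yn \<longlonglongrightarrow> y" and h: "hn \<longlonglongrightarrow> 0"
    and v: "(\<lambda>n. (yn n - y) / hn n) \<longlonglongrightarrow> v"
  shows "(\<lambda>n. (f (yn n) - f y) / hn n) \<longlonglongrightarrow> f' * v"
proof -
  obtain g where g: "\<And>z. f z - f y = g z * (z - y)" "isCont g y" "g y = f'"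
    using f by (auto simp: CARAT_DERIV)
  have "(\<lambda>n. g (yn n) * ((yn n - y) / hn n)) \<longlonglongrightarrow> g y * v"
    by (intro tendsto_mult v isCont_tendsto_compose[OF g(2) y])
  then show ?thesis by (simp add: g(1,3))
qed

lemma DERIV_lipschitz_on_interval:
  fixes f f' :: "real \<Rightarrow> real"
  assumes m: "0 < m" and cont: "continuous_on {0<..} f'"
    and der: "\<And>x. 0 < x \<Longrightarrow> (f has_real_derivative f' x) (at x)"
  obtains L where "0 \<le> L" "\<And>x y. x \<in> {m..M} \<Longrightarrow> y \<in> {m..M} \<Longrightarrow> \<bar>f x - f y\<bar> \<le> L * \<bar>x - y\<bar>"
proof -
  have "compact (f' ` {m..M})"
    using m by (intro compact_continuous_image continuous_on_subset[OF cont]) auto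
  then have "bounded (f' ` {m..M})" by (rule compact_imp_bounded)
  then obtain L where L: "0 < L" "\<And>x. x \<in> {m..M} \<Longrightarrow> norm (f' x) \<le> L"
    unfolding bounded_pos by auto
  show ?thesis
  proof (rule that[of L])
    fix x y assume "x \<in> {m..M}" "y \<in> {m..M}"
    then have "norm (f x - f y) \<le> L * norm (x - y)"
      using m L(2) by (intro field_differentiable_bound[of "{m..M}" f f'])
        (auto intro!: has_field_derivative_at_within der)
    then show "\<bar>f x - f y\<bar> \<le> L * \<bar>x - y\<bar>" by simp
  qed (use L in auto)
qed

lemma (in finite_measure) bounded_convergence:
  fixes f :: "nat \<Rightarrow> 'a \<Rightarrow> real"
  assumes "\<And>n. f n \<in> borel_measurable M" "g \<in> borel_measurable M"
    and "\<And>n. AE x in M. \<bar>f n x\<bar> \<le> K" "AE x in M. (\<lambda>n. f n x) \<longlonglongrightarrow> g x"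
  shows "(\<lambda>n. LINT x|M. f n x) \<longlonglongrightarrow> (LINT x|M. g x)"
  by (rule integral_dominated_convergence[where w = "\<lambda>_. K"]) (use assms in auto)

lemma (in finite_measure) ess_bounded_measurable: "ess_bounded M f \<Longrightarrow> f \<in> borel_measurable M"
  by (simp add: ess_bounded_def)

section \<open>The flow of coefficients\<close>

text \<open>
  This abstracts from the two problems: \<open>D\<close> is the gradient on \<open>Uh\<close> or the symmetric gradient on
  discretely divergence-free fields. Test functions are always differences of solutions, so linearity
  enters through differences, and for \<open>D\<close> only almost everywhere.
\<close>
locale coefficient_flow = power_like_potential \<phi> for \<phi> +
  fixes \<Omega> :: "(real ^ 'd) set" and Ch :: "(real ^ 'd \<Rightarrow> real) set"
    and Wh :: "(real ^ 'd \<Rightarrow> 'v::real_vector) set"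
    and D :: "(real ^ 'd \<Rightarrow> 'v) \<Rightarrow> real ^ 'd \<Rightarrow> 'm::euclidean_space"
    and F :: "(real ^ 'd \<Rightarrow> 'v) \<Rightarrow> real"
    and u :: "(real ^ 'd \<Rightarrow> real) \<Rightarrow> real ^ 'd \<Rightarrow> 'v"
    and c0 :: "real ^ 'd \<Rightarrow> real" and c :: "real \<Rightarrow> real ^ 'd \<Rightarrow> real"
  assumes \<Omega>: "\<Omega> \<in> lmeasurable"
    and Ch: "coefficient_space \<Omega> Ch"
    and Wh_diff: "\<And>v w. v \<in> Wh \<Longrightarrow> w \<in> Wh \<Longrightarrow> (\<lambda>x. v x - w x) \<in> Wh"
    and F_diff: "\<And>v w. v \<in> Wh \<Longrightarrow> w \<in> Wh \<Longrightarrow> F (\<lambda>x. v x - w x) = F v - F w"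
    and D_diff: "\<And>v w. v \<in> Wh \<Longrightarrow> w \<in> Wh \<Longrightarrow>
      AE x in lebesgue_on \<Omega>. D (\<lambda>x. v x - w x) x = D v x - D w x"
    and D_measurable: "\<And>v. v \<in> Wh \<Longrightarrow> D v \<in> borel_measurable (lebesgue_on \<Omega>)"
    and squares: "squares_in \<Omega> D Wh Ch"
    and solution: "\<And>b. b \<in> positive_cone \<Omega> Ch \<Longrightarrow> weighted_solution \<Omega> \<phi> Wh D F b (u b)"
    and flow: "flow_solution \<Omega> Ch D u c0 c"
begin

abbreviation M :: "(real ^ 'd) measure" where "M \<equiv> lebesgue_on \<Omega>"

abbreviation Du :: "real \<Rightarrow> real ^ 'd \<Rightarrow> 'm" where "Du t \<equiv> D (u (c t))"

abbreviation diss :: "real \<Rightarrow> real" where "diss \<equiv> dissipation \<Omega> \<phi> D u c"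

abbreviation velocity_error :: "real \<Rightarrow> real \<Rightarrow> real ^ 'd \<Rightarrow> real" where
  "velocity_error t s x \<equiv> (c s x - c t x) / (s - t) - ((norm (Du t x))\<^sup>2 - c t x)"

text \<open>
  These bounds dominate all difference quotients at time \<open>t\<close>. \<open>D\<close> is applied to the difference of the
  solutions, which is a test function.
\<close>
abbreviation near :: "real \<Rightarrow> real \<Rightarrow> real \<Rightarrow> real \<Rightarrow> bool" where
  "near t m K s \<equiv> AE x in M. m \<le> c s x \<and> c s x \<le> K \<and> \<bar>c s x - c t x\<bar> \<le> K * \<bar>s - t\<bar>
     \<and> norm (D (\<lambda>x. u (c s) x - u (c t) x) x) \<le> K * \<bar>s - t\<bar> \<and> norm (Du t x) \<le> K"

lemma \<Omega>_sets: "\<Omega> \<in> sets lebesgue" using \<Omega> by auto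

sublocale fm: finite_measure M by (rule finite_measure_lebesgue_on[OF \<Omega>])

lemma u_mem: "b \<in> positive_cone \<Omega> Ch \<Longrightarrow> u b \<in> Wh"
  and u_eq: "b \<in> positive_cone \<Omega> Ch \<Longrightarrow> v \<in> Wh \<Longrightarrow>
      (LINT x|M. mu \<phi> (b x) * (D (u b) x \<bullet> D v x)) = F v"
  using solution unfolding weighted_solution_def by blast+

lemma c_cone: "0 \<le> t \<Longrightarrow> c t \<in> positive_cone \<Omega> Ch"
  using flow unfolding flow_solution_def by blast

lemma Ch_ess_bounded: "f \<in> Ch \<Longrightarrow> ess_bounded M f"
proof -
  assume "f \<in> Ch"
  then have L: "Linf_on \<Omega> f" using Ch unfolding coefficient_space_def by blast
  from L obtain K where "AE x in M. \<bar>f x\<bar> \<le> K" by (rule Linf_bound)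
  with L show ?thesis unfolding ess_bounded_def Linf_on_def by blast
qed

lemma cone_bounds:
  assumes "b \<in> positive_cone \<Omega> Ch"
  obtains m K where "0 < m" "AE x in M. m \<le> b x \<and> b x \<le> K"
proof -
  have b: "b \<in> Ch" "ess_inf \<Omega> b > 0" using assms unfolding positive_cone_def by auto
  obtain K where K: "AE x in M. \<bar>b x\<bar> \<le> K" using Ch_ess_bounded[OF b(1)] unfolding ess_bounded_def by blast
  obtain m where m: "0 < ereal m" "ereal m < ess_inf \<Omega> b" using ereal_dense2[OF b(2)] by blast
  have "AE x in M. - ereal (b x) \<le> esssup M (\<lambda>x. - ereal (b x))" by (rule esssup_AE)
  then have "AE x in M. m \<le> b x"
  proof eventually_elim
    case (elim x)
    then have "ess_inf \<Omega> b \<le> ereal (b x)" unfolding ess_inf_def by (simp add: ereal_uminus_le_reorder)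
    with m(2) have "ereal m < ereal (b x)" by (rule less_le_trans)
    then show ?case by simp
  qed
  with K have "AE x in M. m \<le> b x \<and> b x \<le> K" by eventually_elim auto
  with m(1) show ?thesis using that by simp
qed

lemma cone_comp_ess_bounded:
  assumes b: "b \<in> positive_cone \<Omega> Ch" and f: "continuous_on {0<..} f"
  shows "ess_bounded M (\<lambda>x. f (b x))"
proof -
  obtain m K where mK: "0 < m" "AE x in M. m \<le> b x \<and> b x \<le> K" using cone_bounds[OF b] .
  have "compact (f ` {m..K})"
    using mK(1) by (intro compact_continuous_image continuous_on_subset[OF f]) auto
  then have "bounded (f ` {m..K})" by (rule compact_imp_bounded)
  then obtain L where "\<forall>y\<in>f ` {m..K}. norm y \<le> L" unfolding bounded_iff by blast
  then have L: "\<bar>f y\<bar> \<le> L" if "y \<in> {m..K}" for y using that by auto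
  have "AE x in M. \<bar>f (b x)\<bar> \<le> L" using mK(2) by eventually_elim (rule L, simp)
  moreover have "(\<lambda>x. f (b x)) \<in> borel_measurable M"
  proof (rule borel_measurable_comp_pos[OF \<Omega>_sets _ _ f])
    show "b \<in> borel_measurable M"
      using b Ch_ess_bounded unfolding positive_cone_def ess_bounded_def by blast
    show "AE x in M. b x > 0" using mK(2) by eventually_elim (use mK(1) in linarith)
  qed
  ultimately show ?thesis unfolding ess_bounded_def by blast
qed

text \<open>
  The square \<open>|D v|\<^sup>2\<close> is itself a coefficient, so the norm equivalence on \<open>Ch\<close> bounds it uniformly.
\<close>
lemma D_square_bound:
  obtains K where "0 \<le> K" "\<And>v. v \<in> Wh \<Longrightarrow> AE x in M. (norm (D v x))\<^sup>2 \<le> K * (LINT x|M. (norm (D v x))\<^sup>2)"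
proof (rule coefficient_space_sup_bound[OF \<Omega> Ch])
  fix K assume K: "0 \<le> K" "\<And>f. f \<in> Ch \<Longrightarrow> AE x in M. \<bar>f x\<bar> \<le> K * (LINT x|M. \<bar>f x\<bar>)"
  show ?thesis
  proof (rule that[OF K(1)])
    fix v assume v: "v \<in> Wh"
    then obtain f where f: "f \<in> Ch" "AE x in M. f x = (norm (D v x))\<^sup>2"
      using squares unfolding squares_in_def by blast
    have "(LINT x|M. \<bar>f x\<bar>) = (LINT x|M. (norm (D v x))\<^sup>2)"
    proof (rule integral_cong_AE)
      show "(\<lambda>x. \<bar>f x\<bar>) \<in> borel_measurable M"
        using Ch_ess_bounded[OF f(1)] unfolding ess_bounded_def by (intro borel_measurable_abs) blast
      show "(\<lambda>x. (norm (D v x))\<^sup>2) \<in> borel_measurable M"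
        using D_measurable[OF v] by measurable
      show "AE x in M. \<bar>f x\<bar> = (norm (D v x))\<^sup>2" using f(2) by eventually_elim simp
    qed
    with K(2)[OF f(1)] have "AE x in M. \<bar>f x\<bar> \<le> K * (LINT x|M. (norm (D v x))\<^sup>2)" by simp
    with f(2) show "AE x in M. (norm (D v x))\<^sup>2 \<le> K * (LINT x|M. (norm (D v x))\<^sup>2)"
      by eventually_elim simp
  qed
qed

lemma D_bounded:
  assumes v: "v \<in> Wh" obtains K where "AE x in M. norm (D v x) \<le> K"
proof (rule D_square_bound)
  fix K assume K: "\<And>v. v \<in> Wh \<Longrightarrow> AE x in M. (norm (D v x))\<^sup>2 \<le> K * (LINT x|M. (norm (D v x))\<^sup>2)"
  have "AE x in M. norm (D v x) \<le> sqrt (K * (LINT x|M. (norm (D v x))\<^sup>2))"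
    using K[OF v] by eventually_elim (rule real_le_rsqrt)
  then show ?thesis by (rule that)
qed

lemma D_inner_ess_bounded:
  assumes v: "v \<in> Wh" and w: "w \<in> Wh" shows "ess_bounded M (\<lambda>x. D v x \<bullet> D w x)"
proof -
  obtain K where K: "AE x in M. norm (D v x) \<le> K" using D_bounded[OF v] .
  obtain L where L: "AE x in M. norm (D w x) \<le> L" using D_bounded[OF w] .
  have "AE x in M. \<bar>D v x \<bullet> D w x\<bar> \<le> K * L"
    using K L
  proof eventually_elim
    case (elim x)
    have "\<bar>D v x \<bullet> D w x\<bar> \<le> norm (D v x) * norm (D w x)" by (rule Cauchy_Schwarz_ineq2)
    also have "\<dots> \<le> K * L" using elim by (intro mult_mono) (auto intro: order_trans[OF norm_ge_zero])
    finally show ?case .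
  qed
  moreover have "(\<lambda>x. D v x \<bullet> D w x) \<in> borel_measurable M"
    by (intro borel_measurable_inner D_measurable v w)
  ultimately show ?thesis unfolding ess_bounded_def by blast
qed

lemma D_square_ess_bounded: "v \<in> Wh \<Longrightarrow> ess_bounded M (\<lambda>x. (norm (D v x))\<^sup>2)"
  using D_inner_ess_bounded[of v v] by (simp add: power2_norm_eq_inner)

lemmas ess_bounded_intros = fm.ess_bounded_mult fm.ess_bounded_add fm.ess_bounded_const
  cone_comp_ess_bounded D_inner_ess_bounded D_square_ess_bounded continuous_mu continuous_mu''

lemma ess_bounded_diff:
  assumes "ess_bounded M f" "ess_bounded M g" shows "ess_bounded M (\<lambda>x. f x - g x)"
  using fm.ess_bounded_add[OF assms(1) fm.ess_bounded_scale[OF assms(2), of "-1"]] by simp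

lemma ess_bounded_divide_const:
  assumes "ess_bounded M f" shows "ess_bounded M (\<lambda>x. f x / k)"
  using fm.ess_bounded_scale[OF assms, of "inverse k"] by (simp add: divide_inverse mult.commute)

lemma continuous_inverse_mu: "continuous_on {0<..} (\<lambda>r. inverse (mu \<phi> r))"
  by (intro continuous_on_inverse continuous_mu) (use mu_pos in fastforce)

text \<open>
  Both equations are tested with the difference \<open>w\<close> of the two solutions.
\<close>
lemma energy_identity:
  assumes b: "b \<in> positive_cone \<Omega> Ch" and b': "b' \<in> positive_cone \<Omega> Ch"
  defines "w \<equiv> (\<lambda>x. u b' x - u b x)"
  shows "(LINT x|M. mu \<phi> (b' x) * (norm (D w x))\<^sup>2)
    = (LINT x|M. (mu \<phi> (b x) - mu \<phi> (b' x)) * (D (u b) x \<bullet> D w x))"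
proof -
  have w: "w \<in> Wh" unfolding w_def by (rule Wh_diff[OF u_mem[OF b'] u_mem[OF b]])
  have I: "ess_bounded M (\<lambda>x. mu \<phi> (a x) * (D (u a') x \<bullet> D w x))"
    if "a \<in> positive_cone \<Omega> Ch" "a' \<in> positive_cone \<Omega> Ch" for a a'
    using that w by (intro ess_bounded_intros u_mem)
  have "(LINT x|M. mu \<phi> (b' x) * (norm (D w x))\<^sup>2)
      = (LINT x|M. mu \<phi> (b' x) * (D (u b') x \<bullet> D w x) - mu \<phi> (b' x) * (D (u b) x \<bullet> D w x))"
  proof (rule integral_cong_AE)
    show "AE x in M. mu \<phi> (b' x) * (norm (D w x))\<^sup>2
        = mu \<phi> (b' x) * (D (u b') x \<bullet> D w x) - mu \<phi> (b' x) * (D (u b) x \<bullet> D w x)"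
      using D_diff[OF u_mem[OF b'] u_mem[OF b]] unfolding w_def[symmetric]
    proof eventually_elim
      case (elim x)
      have "(norm (D w x))\<^sup>2 = (D (u b') x - D (u b) x) \<bullet> D w x"
        by (simp add: power2_norm_eq_inner elim[symmetric])
      then show ?case by (simp only: inner_diff_left right_diff_distrib)
    qed
  qed (intro fm.ess_bounded_measurable ess_bounded_diff I b b' ess_bounded_intros w)+
  also have "\<dots> = (LINT x|M. mu \<phi> (b x) * (D (u b) x \<bullet> D w x)) - (LINT x|M. mu \<phi> (b' x) * (D (u b) x \<bullet> D w x))"
    using u_eq[OF b w] u_eq[OF b' w]
    by (subst Bochner_Integration.integral_diff) (auto intro!: fm.ess_bounded_integrable I b b')
  also have "\<dots> = (LINT x|M. (mu \<phi> (b x) - mu \<phi> (b' x)) * (D (u b) x \<bullet> D w x))"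
    unfolding left_diff_distrib
    by (rule Bochner_Integration.integral_diff[symmetric]) (intro fm.ess_bounded_integrable I b b')+
  finally show ?thesis .
qed

text \<open>
  Young's inequality in the energy identity; half of the left side is absorbed.
\<close>
lemma energy_bound:
  assumes b: "b \<in> positive_cone \<Omega> Ch" and b': "b' \<in> positive_cone \<Omega> Ch"
  defines "w \<equiv> (\<lambda>x. u b' x - u b x)"
  shows "(LINT x|M. mu \<phi> (b' x) * (norm (D w x))\<^sup>2)
    \<le> (LINT x|M. (mu \<phi> (b x) - mu \<phi> (b' x))\<^sup>2 * (norm (D (u b) x))\<^sup>2 * inverse (mu \<phi> (b' x)))"
    (is "?X \<le> ?Y")
proof -
  have w: "w \<in> Wh" unfolding w_def by (rule Wh_diff[OF u_mem[OF b'] u_mem[OF b]])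
  obtain m K where mK: "0 < m" "AE x in M. m \<le> b' x \<and> b' x \<le> K" using cone_bounds[OF b'] .
  let ?f = "\<lambda>x. (mu \<phi> (b x) - mu \<phi> (b' x)) * (D (u b) x \<bullet> D w x)"
  let ?y = "\<lambda>x. (mu \<phi> (b x) - mu \<phi> (b' x))\<^sup>2 * (norm (D (u b) x))\<^sup>2 * inverse (mu \<phi> (b' x))"
  let ?x = "\<lambda>x. mu \<phi> (b' x) * (norm (D w x))\<^sup>2"
  have B: "ess_bounded M ?f" "ess_bounded M ?y" "ess_bounded M ?x"
    unfolding power2_eq_square[of "mu \<phi> _ - mu \<phi> _"]
    by (intro ess_bounded_intros ess_bounded_diff u_mem b b' w continuous_inverse_mu)+
  have "?X = (LINT x|M. ?f x)" unfolding w_def by (rule energy_identity[OF b b'])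
  also have "\<dots> \<le> (LINT x|M. ?y x / 2 + ?x x / 2)"
  proof (rule integral_mono_AE)
    show "AE x in M. ?f x \<le> ?y x / 2 + ?x x / 2"
      using mK(2)
    proof eventually_elim
      case (elim x)
      define \<mu> \<delta> where "\<mu> = mu \<phi> (b' x)" and "\<delta> = mu \<phi> (b x) - mu \<phi> (b' x)"
      have \<mu>: "\<mu> > 0" using elim mK(1) by (auto simp: \<mu>_def intro: mu_pos)
      have "0 \<le> (norm (\<delta> *\<^sub>R D (u b) x - \<mu> *\<^sub>R D w x))\<^sup>2" by simp
      also have "\<dots> = \<delta>\<^sup>2 * (norm (D (u b) x))\<^sup>2 - 2 * \<mu> * (\<delta> * (D (u b) x \<bullet> D w x)) + \<mu>\<^sup>2 * (norm (D w x))\<^sup>2"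
        by (simp only: power2_norm_eq_inner inner_diff_left inner_diff_right inner_scaleR_left
            inner_scaleR_right inner_commute[of "D w x" "D (u b) x"])
          (simp add: power2_eq_square algebra_simps)
      finally have "2 * \<mu> * (\<delta> * (D (u b) x \<bullet> D w x)) \<le> \<delta>\<^sup>2 * (norm (D (u b) x))\<^sup>2 + \<mu>\<^sup>2 * (norm (D w x))\<^sup>2"
        by linarith
      then have "\<delta> * (D (u b) x \<bullet> D w x) \<le> (\<delta>\<^sup>2 * (norm (D (u b) x))\<^sup>2 + \<mu>\<^sup>2 * (norm (D w x))\<^sup>2) / (2 * \<mu>)"
        using \<mu> by (simp add: pos_le_divide_eq mult.commute)
      also have "\<dots> = \<delta>\<^sup>2 * (norm (D (u b) x))\<^sup>2 * inverse \<mu> / 2 + \<mu> * (norm (D w x))\<^sup>2 / 2"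
        using \<mu> by (simp add: field_simps power2_eq_square)
      finally show ?case unfolding \<mu>_def \<delta>_def .
    qed
  qed (intro fm.ess_bounded_integrable fm.ess_bounded_add ess_bounded_divide_const B)+
  also have "\<dots> = ?Y / 2 + ?X / 2"
    using fm.ess_bounded_integrable[OF B(2)] fm.ess_bounded_integrable[OF B(3)] by simp
  finally show ?thesis by simp
qed

lemma flow_quotient_AE_bound:
  "AE x in M. ereal \<bar>velocity_error t s x\<bar>
     \<le> Linf_norm \<Omega> (velocity_error t s)"
  unfolding Linf_norm_def by (rule esssup_AE)

lemma flow_quotient_limit:
  assumes "0 \<le> t"
  shows "((\<lambda>s. Linf_norm \<Omega> (velocity_error t s)) \<longlongrightarrow> 0)
     (at t within {0..})"
  using flow assms unfolding flow_solution_def by blast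

lemma flow_quotient_tendsto:
  assumes t: "0 \<le> t" and s: "\<And>n. 0 \<le> s n" "\<And>n. s n \<noteq> t" "s \<longlonglongrightarrow> t"
  shows "AE x in M. (\<lambda>n. (c (s n) x - c t x) / (s n - t)) \<longlonglongrightarrow> (norm (Du t x))\<^sup>2 - c t x"
proof -
  have fl: "filterlim s (at t within {0..}) sequentially"
    unfolding filterlim_at using s by (auto intro!: always_eventually)
  note lim = filterlim_compose[OF flow_quotient_limit[OF t] fl]
  have "AE x in M. \<forall>n. ereal \<bar>velocity_error t (s n) x\<bar>
     \<le> Linf_norm \<Omega> (velocity_error t (s n))"
    by (simp only: AE_all_countable) (rule allI, rule flow_quotient_AE_bound)
  then show ?thesis
  proof eventually_elim
    case (elim x)
    have "(\<lambda>n. ereal \<bar>velocity_error t (s n) x\<bar>) \<longlonglongrightarrow> 0"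
      by (rule tendsto_sandwich[OF _ _ tendsto_const lim]) (use elim in \<open>auto intro!: always_eventually\<close>)
    then have "(\<lambda>n. \<bar>velocity_error t (s n) x\<bar>) \<longlonglongrightarrow> 0"
      by (simp add: zero_ereal_def)
    then have "(\<lambda>n. velocity_error t (s n) x) \<longlonglongrightarrow> 0"
      by (rule tendsto_rabs_zero_cancel)
    then show ?case by (simp only: Lim_null[symmetric])
  qed
qed

text \<open>
  The coefficient moves at bounded speed because its velocity \<open>|D u|\<^sup>2 - c\<close> is bounded. The energy bound
  then shows that \<open>D u\<close> is Lipschitz in \<open>L\<^sup>2\<close>, and \<open>D_square_bound\<close> upgrades this to the sup norm.
\<close>
lemma flow_locally_Lipschitz:
  assumes t: "0 \<le> t"
  obtains \<eta> m K where "0 < \<eta>" "0 < m" "0 \<le> K"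
    "\<And>s. 0 \<le> s \<Longrightarrow> \<bar>s - t\<bar> < \<eta> \<Longrightarrow> near t m K s"
proof -
  note ct = c_cone[OF t]
  obtain m b where mb: "0 < m" "AE x in M. m \<le> c t x \<and> c t x \<le> b" using cone_bounds[OF ct] .
  obtain p0 where "AE x in M. norm (Du t x) \<le> p0" using D_bounded[OF u_mem[OF ct]] .
  then have p: "AE x in M. norm (Du t x) \<le> \<bar>p0\<bar>" by eventually_elim linarith
  define p where "p = \<bar>p0\<bar>"
  have p0: "p \<ge> 0" by (simp add: p_def)
  \<comment> \<open>The summand 1 absorbs the error of the difference quotient of \<open>c\<close> near \<open>t\<close>.\<close>
  define K1 where "K1 = 1 + p\<^sup>2 + \<bar>b\<bar>"
  have K1: "K1 > 0" using zero_le_power2[of p] unfolding K1_def by linarith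
  have "eventually (\<lambda>s. Linf_norm \<Omega> (velocity_error t s) < 1)
      (at t within {0..})"
    by (rule order_tendstoD(2)[OF flow_quotient_limit[OF t]]) simp
  then obtain \<eta>1 where \<eta>1: "\<eta>1 > 0" "\<And>s. 0 \<le> s \<Longrightarrow> s \<noteq> t \<Longrightarrow> dist s t < \<eta>1 \<Longrightarrow>
      Linf_norm \<Omega> (velocity_error t s) < 1"
    unfolding eventually_at by auto
  have lip: "AE x in M. \<bar>c s x - c t x\<bar> \<le> K1 * \<bar>s - t\<bar>" if s: "0 \<le> s" "\<bar>s - t\<bar> < \<eta>1" for s
  proof (cases "s = t")
    case False
    from \<eta>1(2)[OF s(1) False] s(2)
    have L: "Linf_norm \<Omega> (velocity_error t s) < ereal 1"
      by (simp add: dist_real_def one_ereal_def)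
    show ?thesis using flow_quotient_AE_bound[of s t] p mb(2)
    proof eventually_elim
      case (elim x)
      from le_less_trans[OF elim(1) L]
      have "\<bar>velocity_error t s x\<bar> < 1" by simp
      moreover have "(norm (Du t x))\<^sup>2 \<le> p\<^sup>2" using elim(2) unfolding p_def by (intro power_mono) auto
      moreover have "\<bar>c t x\<bar> \<le> \<bar>b\<bar>" using elim(3) mb(1) by linarith
      moreover have "0 \<le> (norm (Du t x))\<^sup>2" by simp
      ultimately have "\<bar>(c s x - c t x) / (s - t)\<bar> \<le> K1" unfolding K1_def by linarith
      then have "\<bar>c s x - c t x\<bar> / \<bar>s - t\<bar> \<le> K1" by (simp only: abs_divide)
      then show ?case using False by (simp add: pos_divide_le_eq)
    qed
  qed simp
  \<comment> \<open>Within this time the coefficient moves by at most \<open>m / 2\<close> and stays above \<open>m / 2\<close>.\<close>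
  define \<eta> where "\<eta> = min \<eta>1 (m / (2 * K1))"
  have \<eta>: "\<eta> > 0" using \<eta>1(1) mb(1) K1 by (simp add: \<eta>_def)
  define B where "B = \<bar>b\<bar> + m"
  have range: "AE x in M. m / 2 \<le> c s x \<and> c s x \<le> B \<and> \<bar>c s x - c t x\<bar> \<le> K1 * \<bar>s - t\<bar>"
    if s: "0 \<le> s" "\<bar>s - t\<bar> < \<eta>" for s
  proof -
    have s1: "\<bar>s - t\<bar> < \<eta>1" and s2: "\<bar>s - t\<bar> \<le> m / (2 * K1)" using s(2) unfolding \<eta>_def by auto
    have "K1 * \<bar>s - t\<bar> \<le> K1 * (m / (2 * K1))" using s2 K1 by (intro mult_left_mono) auto
    also have "\<dots> = m / 2" using K1 by simp
    finally have small: "K1 * \<bar>s - t\<bar> \<le> m / 2" .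
    show ?thesis using lip[OF s(1) s1] mb(2)
    proof eventually_elim
      case (elim x)
      then show ?case using small mb(1) unfolding B_def by linarith
    qed
  qed
  obtain L where L: "0 \<le> L" "\<And>x y. x \<in> {m/2..B} \<Longrightarrow> y \<in> {m/2..B} \<Longrightarrow> \<bar>mu \<phi> x - mu \<phi> y\<bar> \<le> L * \<bar>x - y\<bar>"
    using DERIV_lipschitz_on_interval[of "m/2" "deriv (mu \<phi>)" "mu \<phi>" B]
      mb(1) continuous_mu(2) DERIV_mu_deriv by auto
  have "\<exists>z\<in>{m/2..B}. \<forall>y\<in>{m/2..B}. mu \<phi> z \<le> mu \<phi> y"
    using mb(1) by (intro continuous_attains_inf continuous_on_subset[OF continuous_mu(1)])
      (auto simp: B_def)
  then obtain z where z: "z \<in> {m/2..B}" "\<And>y. y \<in> {m/2..B} \<Longrightarrow> mu \<phi> z \<le> mu \<phi> y" by blast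
  define \<mu>0 where "\<mu>0 = mu \<phi> z"
  have \<mu>0: "\<mu>0 > 0" unfolding \<mu>0_def using z(1) mb(1) by (intro mu_pos) auto
  obtain K0 where K0: "0 \<le> K0" "\<And>v. v \<in> Wh \<Longrightarrow> AE x in M. (norm (D v x))\<^sup>2 \<le> K0 * (LINT x|M. (norm (D v x))\<^sup>2)"
    by (rule D_square_bound) (rule that, assumption+)
  define Q where "Q = (L * K1)\<^sup>2 * p\<^sup>2 * inverse \<mu>0"
  have Q: "Q \<ge> 0" using \<mu>0 by (simp add: Q_def)
  define V where "V = measure M (space M)"
  define R where "R = sqrt (K0 * (Q * V / \<mu>0))"
  have E: "AE x in M. norm (D (\<lambda>x. u (c s) x - u (c t) x) x) \<le> R * \<bar>s - t\<bar>"
    if s: "0 \<le> s" "\<bar>s - t\<bar> < \<eta>" for s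
  proof -
    note cs = c_cone[OF s(1)]
    define w where "w = (\<lambda>x. u (c s) x - u (c t) x)"
    have w: "w \<in> Wh" unfolding w_def by (rule Wh_diff[OF u_mem[OF cs] u_mem[OF ct]])
    have ct_range: "AE x in M. m / 2 \<le> c t x \<and> c t x \<le> B"
      using mb(2) by eventually_elim (use mb(1) in \<open>auto simp: B_def\<close>)
    let ?y = "\<lambda>x. (mu \<phi> (c t x) - mu \<phi> (c s x))\<^sup>2 * (norm (Du t x))\<^sup>2 * inverse (mu \<phi> (c s x))"
    have Bd: "ess_bounded M ?y" "ess_bounded M (\<lambda>x. mu \<phi> (c s x) * (norm (D w x))\<^sup>2)"
      "ess_bounded M (\<lambda>x. (norm (D w x))\<^sup>2)"
      unfolding power2_eq_square[of "mu \<phi> _ - mu \<phi> _"]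
      by (intro ess_bounded_intros ess_bounded_diff u_mem ct cs w continuous_inverse_mu)+
    have "\<mu>0 * (LINT x|M. (norm (D w x))\<^sup>2) = (LINT x|M. \<mu>0 * (norm (D w x))\<^sup>2)" by simp
    also have "\<dots> \<le> (LINT x|M. mu \<phi> (c s x) * (norm (D w x))\<^sup>2)"
    proof (rule integral_mono_AE)
      show "AE x in M. \<mu>0 * (norm (D w x))\<^sup>2 \<le> mu \<phi> (c s x) * (norm (D w x))\<^sup>2"
        using range[OF s] by eventually_elim (auto intro!: mult_right_mono z(2) simp: \<mu>0_def)
    qed (intro fm.ess_bounded_integrable fm.ess_bounded_scale Bd)+
    also have "\<dots> \<le> (LINT x|M. ?y x)" unfolding w_def by (rule energy_bound[OF ct cs])
    also have "\<dots> \<le> (LINT x|M. Q * \<bar>s - t\<bar>\<^sup>2)"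
    proof (rule integral_mono_AE)
      show "AE x in M. ?y x \<le> Q * \<bar>s - t\<bar>\<^sup>2"
        using range[OF s] ct_range p
      proof eventually_elim
        case (elim x)
        have "\<bar>mu \<phi> (c t x) - mu \<phi> (c s x)\<bar> \<le> L * \<bar>c t x - c s x\<bar>" using elim by (intro L(2)) auto
        also have "\<dots> \<le> L * (K1 * \<bar>s - t\<bar>)"
          using elim L(1) by (intro mult_left_mono) (auto simp: abs_minus_commute)
        finally have "\<bar>mu \<phi> (c t x) - mu \<phi> (c s x)\<bar>\<^sup>2 \<le> (L * (K1 * \<bar>s - t\<bar>))\<^sup>2" by (rule power_mono) simp
        then have 1: "(mu \<phi> (c t x) - mu \<phi> (c s x))\<^sup>2 \<le> (L * K1 * \<bar>s - t\<bar>)\<^sup>2" by (simp add: mult.assoc)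
        have 2: "(norm (Du t x))\<^sup>2 \<le> p\<^sup>2" using elim unfolding p_def by (intro power_mono) auto
        have "\<mu>0 \<le> mu \<phi> (c s x)" unfolding \<mu>0_def using elim by (intro z(2)) auto
        then have 3: "inverse (mu \<phi> (c s x)) \<le> inverse \<mu>0" "0 \<le> inverse (mu \<phi> (c s x))"
          using \<mu>0 by (auto intro: le_imp_inverse_le)
        have "?y x \<le> (L * K1 * \<bar>s - t\<bar>)\<^sup>2 * p\<^sup>2 * inverse \<mu>0"
          using 1 2 3 by (intro mult_mono) auto
        then show ?case by (simp add: Q_def power_mult_distrib mult_ac)
      qed
    qed (intro fm.ess_bounded_integrable Bd fm.ess_bounded_const)+
    also have "\<dots> = Q * \<bar>s - t\<bar>\<^sup>2 * V" by (simp add: V_def)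
    finally have "(LINT x|M. (norm (D w x))\<^sup>2) \<le> Q * V / \<mu>0 * \<bar>s - t\<bar>\<^sup>2"
      using \<mu>0 by (simp add: field_simps)
    then have "K0 * (LINT x|M. (norm (D w x))\<^sup>2) \<le> K0 * (Q * V / \<mu>0 * \<bar>s - t\<bar>\<^sup>2)"
      using K0(1) by (rule mult_left_mono)
    also have "\<dots> = (R * \<bar>s - t\<bar>)\<^sup>2"
    proof -
      have "0 \<le> K0 * (Q * V / \<mu>0)" using K0(1) Q \<mu>0 by (simp add: V_def)
      then show ?thesis unfolding R_def power_mult_distrib by (simp add: mult.assoc)
    qed
    finally have le: "K0 * (LINT x|M. (norm (D w x))\<^sup>2) \<le> (R * \<bar>s - t\<bar>)\<^sup>2" .
    have R0: "0 \<le> R * \<bar>s - t\<bar>" unfolding R_def using K0(1) Q \<mu>0 by (simp add: V_def)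
    show ?thesis unfolding w_def[symmetric] using K0(2)[OF w]
    proof eventually_elim
      case (elim x)
      then have "(norm (D w x))\<^sup>2 \<le> (R * \<bar>s - t\<bar>)\<^sup>2" using le by linarith
      then show ?case using R0 by (rule power2_le_imp_le)
    qed
  qed
  define K where "K = max (max B K1) (max R p)"
  have K: "B \<le> K" "K1 \<le> K" "R \<le> K" "p \<le> K" unfolding K_def by auto
  show ?thesis
  proof (rule that[of \<eta> "m / 2" K])
    show "0 \<le> K" using K p0 by linarith
    fix s assume s: "0 \<le> s" "\<bar>s - t\<bar> < \<eta>"
    have k: "K1 * \<bar>s - t\<bar> \<le> K * \<bar>s - t\<bar>" "R * \<bar>s - t\<bar> \<le> K * \<bar>s - t\<bar>"
      using K by (auto intro!: mult_right_mono)
    show "near t (m / 2) K s"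
      using range[OF s] E[OF s] p
    proof eventually_elim
      case (elim x)
      then show ?case using k K unfolding p_def by auto
    qed
  qed (use \<eta> mb(1) in auto)
qed

end

section \<open>Differentiating the dissipation along the flow\<close>

text \<open>
  The hypotheses of dominated convergence on a finite measure space, packed so that they are inherited
  by sums and products.
\<close>
definition boundedly_convergent ::
    "'a measure \<Rightarrow> (nat \<Rightarrow> 'a \<Rightarrow> real) \<Rightarrow> ('a \<Rightarrow> real) \<Rightarrow> bool" where
  "boundedly_convergent M f g \<longleftrightarrow> (\<forall>n. f n \<in> borel_measurable M) \<and> g \<in> borel_measurable M \<and>
     (\<exists>C. \<forall>n. AE x in M. \<bar>f n x\<bar> \<le> C) \<and> (AE x in M. (\<lambda>n. f n x) \<longlonglongrightarrow> g x)"

context finite_measure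
begin

lemma boundedly_convergentI:
  assumes "\<And>n. f n \<in> borel_measurable M" "g \<in> borel_measurable M"
    "\<And>n. AE x in M. \<bar>f n x\<bar> \<le> C" "AE x in M. (\<lambda>n. f n x) \<longlonglongrightarrow> g x"
  shows "boundedly_convergent M f g"
  using assms unfolding boundedly_convergent_def by blast

lemma boundedly_convergent_integral:
  assumes "boundedly_convergent M f g"
  shows "(\<lambda>n. LINT x|M. f n x) \<longlonglongrightarrow> (LINT x|M. g x)"
proof -
  from assms obtain C where "\<And>n. AE x in M. \<bar>f n x\<bar> \<le> C" unfolding boundedly_convergent_def by blast
  with assms show ?thesis unfolding boundedly_convergent_def by (intro bounded_convergence[where K = C]) blast+
qed

lemma boundedly_convergent_const: "ess_bounded M f \<Longrightarrow> boundedly_convergent M (\<lambda>n. f) f"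
  unfolding ess_bounded_def boundedly_convergent_def by auto

lemma boundedly_convergent_add:
  assumes "boundedly_convergent M f g" "boundedly_convergent M f' g'"
  shows "boundedly_convergent M (\<lambda>n x. f n x + f' n x) (\<lambda>x. g x + g' x)"
proof -
  from assms obtain C C' where C: "\<And>n. AE x in M. \<bar>f n x\<bar> \<le> C" "\<And>n. AE x in M. \<bar>f' n x\<bar> \<le> C'"
    unfolding boundedly_convergent_def by blast
  note m = assms[unfolded boundedly_convergent_def]
  show ?thesis
  proof (rule boundedly_convergentI)
    show "AE x in M. \<bar>f n x + f' n x\<bar> \<le> C + C'" for n using C(1)[of n] C(2)[of n] by eventually_elim linarith
    have "AE x in M. (\<lambda>n. f n x) \<longlonglongrightarrow> g x" "AE x in M. (\<lambda>n. f' n x) \<longlonglongrightarrow> g' x" using m by blast+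
    then show "AE x in M. (\<lambda>n. f n x + f' n x) \<longlonglongrightarrow> g x + g' x"
      by eventually_elim (rule tendsto_add)
  qed (use m in \<open>blast intro: borel_measurable_add\<close>)+
qed

lemma boundedly_convergent_mult:
  assumes "boundedly_convergent M f g" "boundedly_convergent M f' g'"
  shows "boundedly_convergent M (\<lambda>n x. f n x * f' n x) (\<lambda>x. g x * g' x)"
proof -
  from assms obtain C C' where C: "\<And>n. AE x in M. \<bar>f n x\<bar> \<le> C" "\<And>n. AE x in M. \<bar>f' n x\<bar> \<le> C'"
    unfolding boundedly_convergent_def by blast
  note m = assms[unfolded boundedly_convergent_def]
  show ?thesis
  proof (rule boundedly_convergentI)
    show "AE x in M. \<bar>f n x * f' n x\<bar> \<le> C * C'" for n
      using C(1)[of n] C(2)[of n] by eventually_elim (auto simp: abs_mult intro!: mult_mono)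
    have "AE x in M. (\<lambda>n. f n x) \<longlonglongrightarrow> g x" "AE x in M. (\<lambda>n. f' n x) \<longlonglongrightarrow> g' x" using m by blast+
    then show "AE x in M. (\<lambda>n. f n x * f' n x) \<longlonglongrightarrow> g x * g' x"
      by eventually_elim (rule tendsto_mult)
  qed (use m in \<open>blast intro: borel_measurable_times\<close>)+
qed

lemma boundedly_convergent_scale:
  "boundedly_convergent M f g \<Longrightarrow> boundedly_convergent M (\<lambda>n x. k * f n x) (\<lambda>x. k * g x)"
  by (rule boundedly_convergent_mult[OF boundedly_convergent_const[OF ess_bounded_const]])

lemma boundedly_convergent_diff:
  assumes "boundedly_convergent M f g" "boundedly_convergent M f' g'"
  shows "boundedly_convergent M (\<lambda>n x. f n x - f' n x) (\<lambda>x. g x - g' x)"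
  using boundedly_convergent_add[OF assms(1) boundedly_convergent_scale[OF assms(2), of "-1"]] by simp

lemma boundedly_convergent_bounded_times_null:
  assumes "\<And>n. \<rho> n \<in> borel_measurable M" "\<And>n. AE x in M. \<bar>\<rho> n x\<bar> \<le> C"
    and f: "boundedly_convergent M f (\<lambda>x. 0)"
  shows "boundedly_convergent M (\<lambda>n x. \<rho> n x * f n x) (\<lambda>x. 0)"
proof -
  from f obtain C' where C': "\<And>n. AE x in M. \<bar>f n x\<bar> \<le> C'" unfolding boundedly_convergent_def by blast
  note m = f[unfolded boundedly_convergent_def]
  show ?thesis
  proof (rule boundedly_convergentI)
    show "AE x in M. \<bar>\<rho> n x * f n x\<bar> \<le> C * C'" for n
      using assms(2)[of n] C'[of n] by eventually_elim (auto simp: abs_mult intro!: mult_mono)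
    have "AE x in M. \<forall>n. \<bar>\<rho> n x\<bar> \<le> C" using assms(2) by (simp only: AE_all_countable) blast
    moreover have "AE x in M. (\<lambda>n. f n x) \<longlonglongrightarrow> 0" using m by blast
    ultimately show "AE x in M. (\<lambda>n. \<rho> n x * f n x) \<longlonglongrightarrow> 0"
    proof eventually_elim
      case (elim x)
      have "(\<lambda>n. C * \<bar>f n x\<bar>) \<longlonglongrightarrow> C * 0" using elim(2) by (intro tendsto_mult tendsto_const tendsto_rabs_zero)
      then have lim: "(\<lambda>n. C * \<bar>f n x\<bar>) \<longlonglongrightarrow> 0" by simp
      show ?case
      proof (rule Lim_null_comparison[OF _ lim])
        show "eventually (\<lambda>n. norm (\<rho> n x * f n x) \<le> C * \<bar>f n x\<bar>) sequentially"
          using elim(1) by (intro always_eventually) (auto simp: abs_mult intro!: mult_right_mono)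
      qed
    qed
    show "(\<lambda>x. \<rho> n x * f n x) \<in> borel_measurable M" for n
      using m assms(1) by (intro borel_measurable_times) blast+
  qed simp
qed

lemma boundedly_convergent_rate:
  assumes f: "\<And>n. f n \<in> borel_measurable M" and g: "ess_bounded M g"
    and rate: "\<And>n. AE x in M. \<bar>f n x - g x\<bar> \<le> C * h n" and h: "h \<longlonglongrightarrow> 0" "\<And>n. h n \<le> H" and C: "0 \<le> C"
  shows "boundedly_convergent M f g"
proof -
  from g obtain G where G: "AE x in M. \<bar>g x\<bar> \<le> G" and gm: "g \<in> borel_measurable M" unfolding ess_bounded_def by blast
  show ?thesis
  proof (rule boundedly_convergentI[OF f gm])
    show "AE x in M. \<bar>f n x\<bar> \<le> G + C * H" for n
      using rate[of n] G
    proof eventually_elim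
      case (elim x)
      moreover have "C * h n \<le> C * H" using h(2) C by (rule mult_left_mono)
      ultimately show ?case by linarith
    qed
    have "AE x in M. \<forall>n. \<bar>f n x - g x\<bar> \<le> C * h n" using rate by (simp only: AE_all_countable) blast
    then show "AE x in M. (\<lambda>n. f n x) \<longlonglongrightarrow> g x"
    proof eventually_elim
      case (elim x)
      have "(\<lambda>n. C * h n) \<longlonglongrightarrow> C * 0" using h(1) by (intro tendsto_mult tendsto_const)
      then have lim: "(\<lambda>n. C * h n) \<longlonglongrightarrow> 0" by simp
      have "(\<lambda>n. f n x - g x) \<longlonglongrightarrow> 0"
        by (rule Lim_null_comparison[OF _ lim]) (use elim in \<open>auto intro!: always_eventually\<close>)
      then show ?case by (simp only: Lim_null[symmetric])
    qed
  qed
qed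

end

context power_like_potential
begin

text \<open>
  With \<open>y = c\<close> and \<open>q = |D u|\<^sup>2\<close> this is the integrand that bounds the time derivative of the dissipation. The
  last summand, present only for \<open>\<sigma> = -1\<close>, bounds twice the energy of the time derivative of \<open>u\<close>.
\<close>
definition decay_density :: "real \<Rightarrow> real \<Rightarrow> real \<Rightarrow> real" where
  "decay_density \<sigma> y q = - (\<sigma> / 2) * deriv (deriv (mu \<phi>)) y * (y - q) ^ 3
     - \<sigma> * deriv (mu \<phi>) y * (y - q)\<^sup>2
     + (1 - \<sigma>) * ((deriv (mu \<phi>) y)\<^sup>2 * (y - q)\<^sup>2 * q * inverse (mu \<phi> y))"

end

context coefficient_flow
begin

definition residual :: "real \<Rightarrow> real ^ 'd \<Rightarrow> real" where
  "residual t x = c t x - (norm (Du t x))\<^sup>2"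

lemma c_ess_bounded: "0 \<le> t \<Longrightarrow> ess_bounded M (c t)"
  using c_cone[of t] Ch_ess_bounded unfolding positive_cone_def by blast

lemma residual_ess_bounded: "0 \<le> t \<Longrightarrow> ess_bounded M (residual t)"
  unfolding residual_def[abs_def]
  by (intro ess_bounded_diff c_ess_bounded D_square_ess_bounded u_mem c_cone)

lemma c_pos: assumes "0 \<le> t" shows "AE x in M. 0 < c t x"
proof -
  obtain m K where "0 < m" "AE x in M. m \<le> c t x \<and> c t x \<le> K" using cone_bounds[OF c_cone[OF assms]] .
  note mK = this
  show ?thesis using mK(2) by eventually_elim (use mK(1) in linarith)
qed

context
  fixes t \<eta> m K :: real and s :: "nat \<Rightarrow> real"
  assumes t: "0 \<le> t" and s0: "\<And>n. 0 \<le> s n" and s: "s \<longlonglongrightarrow> t" and s\<eta>: "\<And>n. \<bar>s n - t\<bar> < \<eta>"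
    and m: "0 < m" and K: "0 \<le> K"
    and local_bounds: "\<And>n. near t m K (s n)"
begin

abbreviation E :: "nat \<Rightarrow> real ^ 'd \<Rightarrow> 'm" where "E n \<equiv> D (\<lambda>x. u (c (s n)) x - u (c t) x)"
abbreviation P :: "real ^ 'd \<Rightarrow> 'm" where "P \<equiv> Du t"

lemma diff_mem: "(\<lambda>x. u (c (s n)) x - u (c t) x) \<in> Wh"
  by (intro Wh_diff u_mem c_cone t s0)

lemma P_mem: "u (c t) \<in> Wh" by (intro u_mem c_cone t)

lemma h_tendsto: "(\<lambda>n. \<bar>s n - t\<bar>) \<longlonglongrightarrow> 0"
  using s by (intro tendsto_rabs_zero) (simp only: Lim_null[symmetric])

lemma h_le: "\<bar>s n - t\<bar> \<le> \<eta>" using s\<eta>[of n] by simp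

text \<open>
  The increment of \<open>|D u|\<^sup>2\<close> is expanded around \<open>P\<close>, with \<open>E n\<close> the increment of \<open>D u\<close>.
\<close>
lemma residual_expansion:
  "AE x in M. residual (s n) x = residual t x + (c (s n) x - c t x) - 2 * (P x \<bullet> E n x) - (norm (E n x))\<^sup>2"
  using D_diff[OF u_mem[OF c_cone[OF s0]] u_mem[OF c_cone[OF t]], of n]
proof eventually_elim
  case (elim x)
  then have eq: "D (u (c (s n))) x = P x + E n x" by simp
  show ?case unfolding residual_def eq
    by (simp add: power2_norm_eq_inner inner_add_left inner_add_right inner_commute[of "E n x" "P x"])
qed

lemma inner_bound: "AE x in M. \<bar>P x \<bullet> E n x\<bar> \<le> K * (K * \<bar>s n - t\<bar>)"
  using local_bounds[of n]
proof eventually_elim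
  case (elim x)
  have "\<bar>P x \<bullet> E n x\<bar> \<le> norm (P x) * norm (E n x)" by (rule Cauchy_Schwarz_ineq2)
  also have "\<dots> \<le> K * (K * \<bar>s n - t\<bar>)" using elim K by (intro mult_mono) auto
  finally show ?case .
qed

lemma square_bound: "AE x in M. (norm (E n x))\<^sup>2 \<le> K\<^sup>2 * \<eta> * \<bar>s n - t\<bar>"
  using local_bounds[of n]
proof eventually_elim
  case (elim x)
  have "(norm (E n x))\<^sup>2 \<le> (K * \<bar>s n - t\<bar>)\<^sup>2" using elim by (intro power_mono) auto
  also have "\<dots> = K\<^sup>2 * \<bar>s n - t\<bar> * \<bar>s n - t\<bar>" by (simp add: power_mult_distrib power2_eq_square)
  also have "\<dots> \<le> K\<^sup>2 * \<eta> * \<bar>s n - t\<bar>" using h_le[of n] by (intro mult_right_mono mult_left_mono) auto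
  finally show ?case .
qed

lemma c_convergent: "boundedly_convergent M (\<lambda>n. c (s n)) (c t)"
proof (rule fm.boundedly_convergent_rate[OF _ _ _ h_tendsto h_le K])
  show "c (s n) \<in> borel_measurable M" for n by (intro fm.ess_bounded_measurable c_ess_bounded s0)
  show "ess_bounded M (c t)" by (rule c_ess_bounded[OF t])
  show "AE x in M. \<bar>c (s n) x - c t x\<bar> \<le> K * \<bar>s n - t\<bar>" for n
    using local_bounds[of n] by eventually_elim blast
qed

lemma comp_convergent:
  assumes f: "continuous_on {0<..} f"
  shows "boundedly_convergent M (\<lambda>n x. f (c (s n) x)) (\<lambda>x. f (c t x))"
proof -
  have "compact (f ` {m..K})"
    using m by (intro compact_continuous_image continuous_on_subset[OF f]) auto
  then have "bounded (f ` {m..K})" by (rule compact_imp_bounded)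
  then obtain L where "\<forall>y\<in>f ` {m..K}. norm y \<le> L" unfolding bounded_iff by blast
  then have L: "\<bar>f y\<bar> \<le> L" if "y \<in> {m..K}" for y using that by auto
  show ?thesis
  proof (rule fm.boundedly_convergentI)
    show "(\<lambda>x. f (c (s n) x)) \<in> borel_measurable M" for n
      by (intro fm.ess_bounded_measurable cone_comp_ess_bounded c_cone s0 f)
    show "(\<lambda>x. f (c t x)) \<in> borel_measurable M"
      by (intro fm.ess_bounded_measurable cone_comp_ess_bounded c_cone t f)
    show "AE x in M. \<bar>f (c (s n) x)\<bar> \<le> L" for n
      using local_bounds[of n] by eventually_elim (rule L, simp)
    have "AE x in M. (\<lambda>n. c (s n) x) \<longlonglongrightarrow> c t x"
      using c_convergent unfolding boundedly_convergent_def by blast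
    then show "AE x in M. (\<lambda>n. f (c (s n) x)) \<longlonglongrightarrow> f (c t x)"
      using c_pos[OF t]
    proof eventually_elim
      case (elim x)
      have "isCont f (c t x)" using f elim(2) by (simp add: continuous_on_eq_continuous_at)
      then show ?case using elim(1) by (rule isCont_tendsto_compose)
    qed
  qed
qed

lemma residual_convergent: "boundedly_convergent M (\<lambda>n. residual (s n)) (residual t)"
proof (rule fm.boundedly_convergent_rate[OF _ _ _ h_tendsto h_le])
  show "residual (s n) \<in> borel_measurable M" for n by (intro fm.ess_bounded_measurable residual_ess_bounded s0)
  show "ess_bounded M (residual t)" by (rule residual_ess_bounded[OF t])
  have \<eta>: "0 \<le> \<eta>" using h_le[of 0] by linarith
  then show "0 \<le> K + 2 * K * K + K\<^sup>2 * \<eta>" using K by simp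
  show "AE x in M. \<bar>residual (s n) x - residual t x\<bar> \<le> (K + 2 * K * K + K\<^sup>2 * \<eta>) * \<bar>s n - t\<bar>" for n
    using residual_expansion[of n] inner_bound[of n] square_bound[of n] local_bounds[of n]
  proof eventually_elim
    case (elim x)
    have "\<bar>residual (s n) x - residual t x\<bar>
        \<le> \<bar>c (s n) x - c t x\<bar> + 2 * \<bar>P x \<bullet> E n x\<bar> + (norm (E n x))\<^sup>2"
      unfolding elim(1) using zero_le_power2[of "norm (E n x)"] by linarith
    also have "\<dots> \<le> K * \<bar>s n - t\<bar> + 2 * (K * (K * \<bar>s n - t\<bar>)) + K\<^sup>2 * \<eta> * \<bar>s n - t\<bar>"
      using elim by (intro add_mono mult_left_mono) auto
    finally show ?case by (simp add: algebra_simps)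
  qed
qed

lemma dissipation_convergent:
  "(\<lambda>n. diss (s n)) \<longlonglongrightarrow> diss t"
proof -
  have "boundedly_convergent M
      (\<lambda>n x. \<bar>deriv (mu \<phi>) (c (s n) x)\<bar> * (residual (s n) x * residual (s n) x))
      (\<lambda>x. \<bar>deriv (mu \<phi>) (c t x)\<bar> * (residual t x * residual t x))"
    by (intro fm.boundedly_convergent_mult residual_convergent
        comp_convergent[of "\<lambda>r. \<bar>deriv (mu \<phi>) r\<bar>"] continuous_on_rabs continuous_mu)
  from tendsto_mult[OF tendsto_const[of "1/2"] fm.boundedly_convergent_integral[OF this]]
  show ?thesis by (simp only: dissipation_def residual_def power2_eq_square)
qed

lemma c_range: "AE x in M. m \<le> c t x \<and> c t x \<le> K"
proof -
  have "AE x in M. \<forall>n. m \<le> c (s n) x \<and> c (s n) x \<le> K"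
    using local_bounds by (simp only: AE_all_countable) (blast intro: eventually_mono)
  moreover have "AE x in M. (\<lambda>n. c (s n) x) \<longlonglongrightarrow> c t x"
    using c_convergent unfolding boundedly_convergent_def by blast
  ultimately show ?thesis
  proof eventually_elim
    case (elim x)
    then show ?case using LIMSEQ_le_const[OF elim(2), of m] LIMSEQ_le_const2[OF elim(2), of K] by blast
  qed
qed

context
  assumes right: "\<And>n. t < s n"
begin

lemma difference_quotient_convergent:
  assumes f: "\<And>r. 0 < r \<Longrightarrow> (f has_real_derivative f' r) (at r)" and f': "continuous_on {0<..} f'"
  shows "boundedly_convergent M (\<lambda>n x. (f (c (s n) x) - f (c t x)) / (s n - t))
     (\<lambda>x. f' (c t x) * ((norm (P x))\<^sup>2 - c t x))"
proof -
  have f_cont: "continuous_on {0<..} f"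
    by (intro continuous_at_imp_continuous_on ballI DERIV_isCont[OF f]) simp
  note meas = fm.ess_bounded_measurable
  obtain L where L: "0 \<le> L" "\<And>x y. x \<in> {m..K} \<Longrightarrow> y \<in> {m..K} \<Longrightarrow> \<bar>f x - f y\<bar> \<le> L * \<bar>x - y\<bar>"
    by (rule DERIV_lipschitz_on_interval[OF m f' f, where M = K]) (assumption, rule that)
  show ?thesis
  proof (rule fm.boundedly_convergentI)
    show "(\<lambda>x. (f (c (s n) x) - f (c t x)) / (s n - t)) \<in> borel_measurable M" for n
      by (intro meas ess_bounded_divide_const ess_bounded_diff cone_comp_ess_bounded c_cone s0 t f_cont)
    show "(\<lambda>x. f' (c t x) * ((norm (P x))\<^sup>2 - c t x)) \<in> borel_measurable M"
      by (intro meas fm.ess_bounded_mult ess_bounded_diff cone_comp_ess_bounded c_cone t f'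
          D_square_ess_bounded P_mem c_ess_bounded)
    show "AE x in M. \<bar>(f (c (s n) x) - f (c t x)) / (s n - t)\<bar> \<le> L * K" for n
      using local_bounds[of n] c_range
    proof eventually_elim
      case (elim x)
      have "\<bar>f (c (s n) x) - f (c t x)\<bar> \<le> L * \<bar>c (s n) x - c t x\<bar>" using elim by (intro L(2)) auto
      also have "\<dots> \<le> L * (K * \<bar>s n - t\<bar>)" using elim L(1) by (intro mult_left_mono) auto
      finally show ?case using right[of n] by (simp add: abs_divide pos_divide_le_eq mult.assoc)
    qed
    have "AE x in M. (\<lambda>n. (c (s n) x - c t x) / (s n - t)) \<longlonglongrightarrow> (norm (P x))\<^sup>2 - c t x"
      using right s by (intro flow_quotient_tendsto t s0) (auto simp: less_imp_neq[symmetric])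
    moreover have "AE x in M. (\<lambda>n. c (s n) x) \<longlonglongrightarrow> c t x"
      using c_convergent unfolding boundedly_convergent_def by blast
    ultimately show "AE x in M. (\<lambda>n. (f (c (s n) x) - f (c t x)) / (s n - t))
        \<longlonglongrightarrow> f' (c t x) * ((norm (P x))\<^sup>2 - c t x)"
      using c_pos[OF t]
    proof eventually_elim
      case (elim x)
      have "(\<lambda>n. s n - t) \<longlonglongrightarrow> 0" using s by (simp only: Lim_null[symmetric])
      then show ?case by (rule DERIV_chain_sequence[OF f[OF elim(3)] elim(2) _ elim(1)])
    qed
  qed
qed

text \<open>
  The difference quotient of the dissipation splits exactly into the integral of \<open>a n\<close> and
  \<open>- 2 \<sigma> X n\<close>, where \<open>X n\<close> is the energy of the difference quotient of \<open>u\<close>. In \<open>a n\<close> the quotient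
  \<open>\<rho> n\<close> of \<open>u\<close> is only known to be bounded, but the bracket multiplying it tends to 0,
  because the energy was split off with exactly the matching weight. Finally \<open>0 \<le> X n \<le> \<integral> y n\<close> disposes of \<open>X n\<close> for either sign.
\<close>
lemma dissipation_quotient_le:
  assumes \<sigma>: "\<sigma> = 1 \<or> \<sigma> = -1" and sign: "\<And>r. 0 < r \<Longrightarrow> \<bar>deriv (mu \<phi>) r\<bar> = \<sigma> * deriv (mu \<phi>) r"
  shows "\<exists>Z. Z \<longlonglongrightarrow> (LINT x|M. decay_density \<sigma> (c t x) ((norm (P x))\<^sup>2)) \<and>
    (\<forall>n. (diss (s n) - diss t) / (s n - t) \<le> Z n)"
proof -
  let ?\<mu> = "mu \<phi>" and ?\<mu>' = "deriv (mu \<phi>)" and ?\<mu>'' = "deriv (deriv (mu \<phi>))"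
  let ?r = "residual t" and ?rn = "\<lambda>n. residual (s n)" and ?q = "\<lambda>x. (norm (P x))\<^sup>2"
  define h where "h n = s n - t" for n
  have h: "h n > 0" for n using right[of n] by (simp add: h_def)
  have habs: "\<bar>s n - t\<bar> = h n" for n using h[of n] by (simp add: h_def)
  define D0 where "D0 n x = (?\<mu> (c (s n) x) - ?\<mu> (c t x)) / h n" for n x
  define D1 where "D1 n x = (?\<mu>' (c (s n) x) - ?\<mu>' (c t x)) / h n" for n x
  define v where "v n x = (c (s n) x - c t x) / h n" for n x
  define \<rho> where "\<rho> n x = (P x \<bullet> E n x) / h n" for n x
  define e where "e n x = (norm (E n x))\<^sup>2 / h n" for n x
  define a where "a n x = \<sigma> / 2 * (D1 n x * (?rn n x * ?rn n x)
      + (?\<mu>' (c t x) * (?rn n x + ?r x)) * (v n x - e n x))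
      - \<sigma> * (\<rho> n x * (?\<mu>' (c t x) * (?rn n x + ?r x) + 2 * D0 n x))" for n x
  define y where "y n x = D0 n x * D0 n x * ?q x * inverse (?\<mu> (c (s n) x))" for n x
  define X where "X n = (LINT x|M. ?\<mu> (c (s n) x) * (norm (E n x))\<^sup>2) / (h n)\<^sup>2" for n
  note c1 = continuous_mu(1) and c2 = continuous_mu(2) and c3 = continuous_mu''
  note cs = c_cone[OF s0] and ct = c_cone[OF t]
  have \<mu>'_b: "ess_bounded M (\<lambda>x. ?\<mu>' (c t x))" by (rule cone_comp_ess_bounded[OF ct c2])
  have r_q: "?r x = c t x - ?q x" for x by (simp add: residual_def)

  have D0_lim: "boundedly_convergent M D0 (\<lambda>x. ?\<mu>' (c t x) * (?q x - c t x))"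
    unfolding D0_def[abs_def] h_def by (rule difference_quotient_convergent[OF DERIV_mu_deriv c2])
  have D1_lim: "boundedly_convergent M D1 (\<lambda>x. ?\<mu>'' (c t x) * (?q x - c t x))"
    unfolding D1_def[abs_def] h_def by (rule difference_quotient_convergent[OF DERIV_mu_deriv2 c3])
  have v_lim: "boundedly_convergent M v (\<lambda>x. 1 * (?q x - c t x))"
    unfolding v_def[abs_def] h_def by (rule difference_quotient_convergent[where f = "\<lambda>r. r" and f' = "\<lambda>r. 1"]) auto
  have E2: "ess_bounded M (\<lambda>x. (norm (E n x))\<^sup>2)" for n by (rule D_square_ess_bounded[OF diff_mem])
  have PE: "ess_bounded M (\<lambda>x. P x \<bullet> E n x)" for n by (rule D_inner_ess_bounded[OF P_mem diff_mem])
  have e_lim: "boundedly_convergent M e (\<lambda>x. 0)"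
  proof (rule fm.boundedly_convergent_rate[OF _ fm.ess_bounded_const _ h_tendsto h_le])
    show "e n \<in> borel_measurable M" for n
      unfolding e_def[abs_def] by (intro fm.ess_bounded_measurable ess_bounded_divide_const E2)
    show "AE x in M. \<bar>e n x - 0\<bar> \<le> K\<^sup>2 * \<bar>s n - t\<bar>" for n
      using local_bounds[of n]
    proof eventually_elim
      case (elim x)
      have "(norm (E n x))\<^sup>2 \<le> (K * h n)\<^sup>2" using elim unfolding habs by (intro power_mono) auto
      also have "\<dots> = K\<^sup>2 * h n * h n" by (simp add: power_mult_distrib power2_eq_square)
      finally show ?case unfolding habs e_def using h[of n] by (simp add: pos_divide_le_eq)
    qed
  qed simp
  have \<rho>_meas: "\<rho> n \<in> borel_measurable M" for n
    unfolding \<rho>_def[abs_def] by (intro fm.ess_bounded_measurable ess_bounded_divide_const PE)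
  have \<rho>_bound: "AE x in M. \<bar>\<rho> n x\<bar> \<le> K * K" for n
    using inner_bound[of n]
  proof eventually_elim
    case (elim x)
    then show ?case unfolding habs \<rho>_def using h[of n] by (simp add: abs_divide pos_divide_le_eq mult.assoc)
  qed
  have \<mu>'_lim: "boundedly_convergent M (\<lambda>n x. ?\<mu>' (c t x)) (\<lambda>x. ?\<mu>' (c t x))"
    by (intro fm.boundedly_convergent_const cone_comp_ess_bounded ct c2)
  have r_lim: "boundedly_convergent M (\<lambda>n x. ?r x) (\<lambda>x. ?r x)"
    by (intro fm.boundedly_convergent_const residual_ess_bounded t)
  have q_lim: "boundedly_convergent M (\<lambda>n x. ?q x) (\<lambda>x. ?q x)"
    by (intro fm.boundedly_convergent_const D_square_ess_bounded P_mem)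
  have rn_lim: "boundedly_convergent M (\<lambda>n x. ?rn n x) (\<lambda>x. ?r x)" by (rule residual_convergent)

  \<comment> \<open>The two limits are \<open>2 \<mu>'(c) r\<close> and \<open>- 2 \<mu>'(c) r\<close>.\<close>
  have bracket: "boundedly_convergent M (\<lambda>n x. ?\<mu>' (c t x) * (?rn n x + ?r x) + 2 * D0 n x) (\<lambda>x. 0)"
  proof -
    have "boundedly_convergent M (\<lambda>n x. ?\<mu>' (c t x) * (?rn n x + ?r x) + 2 * D0 n x)
        (\<lambda>x. ?\<mu>' (c t x) * (?r x + ?r x) + 2 * (?\<mu>' (c t x) * (?q x - c t x)))"
      by (intro fm.boundedly_convergent_add fm.boundedly_convergent_mult fm.boundedly_convergent_scale
          \<mu>'_lim r_lim rn_lim D0_lim)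
    moreover have "?\<mu>' (c t x) * (?r x + ?r x) + 2 * (?\<mu>' (c t x) * (?q x - c t x)) = 0" for x
      by (simp add: r_q algebra_simps)
    ultimately show ?thesis by simp
  qed
  define La where "La x = \<sigma> / 2 * (?\<mu>'' (c t x) * (?q x - c t x) * (?r x * ?r x)
      + (?\<mu>' (c t x) * (?r x + ?r x)) * (1 * (?q x - c t x) - 0)) - \<sigma> * 0" for x
  define Ly where "Ly x = ?\<mu>' (c t x) * (?q x - c t x) * (?\<mu>' (c t x) * (?q x - c t x)) * ?q x
      * inverse (?\<mu> (c t x))" for x
  have a_lim: "boundedly_convergent M a La"
    unfolding a_def[abs_def] La_def[abs_def]
    by (intro fm.boundedly_convergent_diff fm.boundedly_convergent_scale fm.boundedly_convergent_add
        fm.boundedly_convergent_mult D1_lim rn_lim r_lim \<mu>'_lim v_lim e_lim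
        fm.boundedly_convergent_bounded_times_null[OF \<rho>_meas \<rho>_bound bracket])
  have y_lim: "boundedly_convergent M y Ly"
    unfolding y_def[abs_def] Ly_def[abs_def]
    by (intro fm.boundedly_convergent_mult D0_lim q_lim comp_convergent[OF continuous_inverse_mu])
  have density: "decay_density \<sigma> (c t x) (?q x) = La x + (1 - \<sigma>) * Ly x" for x
    unfolding decay_density_def La_def Ly_def r_q by (simp add: power2_eq_square power3_eq_cube algebra_simps)
  have La_int: "integrable M La" unfolding La_def[abs_def]
    by (intro fm.ess_bounded_integrable ess_bounded_diff fm.ess_bounded_mult fm.ess_bounded_add
        fm.ess_bounded_const cone_comp_ess_bounded ct c2 c3 residual_ess_bounded t
        D_square_ess_bounded P_mem c_ess_bounded)
  have Ly_int: "integrable M Ly" unfolding Ly_def[abs_def]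
    by (intro fm.ess_bounded_integrable ess_bounded_diff fm.ess_bounded_mult
        cone_comp_ess_bounded ct c2 D_square_ess_bounded P_mem c_ess_bounded t continuous_inverse_mu)
  have lim: "(\<lambda>n. (LINT x|M. a n x) + (1 - \<sigma>) * (LINT x|M. y n x))
      \<longlonglongrightarrow> (LINT x|M. decay_density \<sigma> (c t x) (?q x))"
  proof -
    have "(\<lambda>n. (LINT x|M. a n x) + (1 - \<sigma>) * (LINT x|M. y n x))
        \<longlonglongrightarrow> (LINT x|M. La x) + (1 - \<sigma>) * (LINT x|M. Ly x)"
      by (intro tendsto_add tendsto_mult tendsto_const fm.boundedly_convergent_integral a_lim y_lim)
    also have "(LINT x|M. La x) + (1 - \<sigma>) * (LINT x|M. Ly x) = (LINT x|M. decay_density \<sigma> (c t x) (?q x))"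
      unfolding density using La_int Ly_int by simp
    finally show ?thesis .
  qed

  have le: "(diss (s n) - diss t) / (s n - t)
      \<le> (LINT x|M. a n x) + (1 - \<sigma>) * (LINT x|M. y n x)" for n
  proof -
    let ?D0\<rho> = "\<lambda>x. D0 n x * \<rho> n x"
    have D0_b: "ess_bounded M (D0 n)" unfolding D0_def[abs_def]
      by (intro ess_bounded_divide_const ess_bounded_diff cone_comp_ess_bounded cs ct c1)
    have \<rho>_b: "ess_bounded M (\<rho> n)" unfolding \<rho>_def[abs_def] by (intro ess_bounded_divide_const PE)
    have D0\<rho>_int: "integrable M ?D0\<rho>" by (intro fm.ess_bounded_integrable fm.ess_bounded_mult D0_b \<rho>_b)
    have a_int: "integrable M (a n)"
    proof -
      have "ess_bounded M (D1 n)" unfolding D1_def[abs_def]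
        by (intro ess_bounded_divide_const ess_bounded_diff cone_comp_ess_bounded cs ct c2)
      moreover have "ess_bounded M (v n)" unfolding v_def[abs_def]
        by (intro ess_bounded_divide_const ess_bounded_diff c_ess_bounded s0 t)
      moreover have "ess_bounded M (e n)" unfolding e_def[abs_def] by (intro ess_bounded_divide_const E2)
      ultimately show ?thesis unfolding a_def[abs_def]
        by (intro fm.ess_bounded_integrable ess_bounded_diff fm.ess_bounded_mult fm.ess_bounded_add
          fm.ess_bounded_const \<mu>'_b residual_ess_bounded[OF t] residual_ess_bounded[OF s0] D0_b \<rho>_b)
    qed
    have dissip: "diss \<tau> = (LINT x|M. \<sigma> / 2 * (?\<mu>' (c \<tau> x) * (residual \<tau> x * residual \<tau> x)))"
      and dissip_int: "integrable M (\<lambda>x. \<sigma> / 2 * (?\<mu>' (c \<tau> x) * (residual \<tau> x * residual \<tau> x)))"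
      if "0 \<le> \<tau>" for \<tau>
    proof -
      have B: "ess_bounded M (\<lambda>x. ?\<mu>' (c \<tau> x) * (residual \<tau> x * residual \<tau> x))"
        by (intro fm.ess_bounded_mult cone_comp_ess_bounded c_cone that c2 residual_ess_bounded)
      then show "integrable M (\<lambda>x. \<sigma> / 2 * (?\<mu>' (c \<tau> x) * (residual \<tau> x * residual \<tau> x)))"
        by (intro integrable_mult_right fm.ess_bounded_integrable)
      have "(LINT x|M. \<bar>?\<mu>' (c \<tau> x)\<bar> * (residual \<tau> x)\<^sup>2)
          = (LINT x|M. \<sigma> * (?\<mu>' (c \<tau> x) * (residual \<tau> x * residual \<tau> x)))"
      proof (rule integral_cong_AE)
        show "AE x in M. \<bar>?\<mu>' (c \<tau> x)\<bar> * (residual \<tau> x)\<^sup>2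
            = \<sigma> * (?\<mu>' (c \<tau> x) * (residual \<tau> x * residual \<tau> x))"
          using c_pos[OF that] by eventually_elim (simp only: sign power2_eq_square mult.assoc)
        show "(\<lambda>x. \<bar>?\<mu>' (c \<tau> x)\<bar> * (residual \<tau> x)\<^sup>2) \<in> borel_measurable M"
          unfolding power2_eq_square
          by (intro fm.ess_bounded_measurable fm.ess_bounded_mult
              cone_comp_ess_bounded[of _ "\<lambda>r. \<bar>?\<mu>' r\<bar>"] continuous_on_rabs c_cone that c2 residual_ess_bounded)
        show "(\<lambda>x. \<sigma> * (?\<mu>' (c \<tau> x) * (residual \<tau> x * residual \<tau> x))) \<in> borel_measurable M"
          by (intro fm.ess_bounded_measurable fm.ess_bounded_scale B)
      qed
      then show "diss \<tau> = (LINT x|M. \<sigma> / 2 * (?\<mu>' (c \<tau> x) * (residual \<tau> x * residual \<tau> x)))"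
        unfolding dissipation_def residual_def[symmetric] by simp
    qed
    have "(diss (s n) - diss t) / h n
      = (LINT x|M. (\<sigma> / 2 * (?\<mu>' (c (s n) x) * (?rn n x * ?rn n x)) - \<sigma> / 2 * (?\<mu>' (c t x) * (?r x * ?r x))) / h n)"
      unfolding dissip[OF s0] dissip[OF t] using dissip_int[OF s0[of n]] dissip_int[OF t] by simp
    also have "\<dots> = (LINT x|M. a n x + 2 * \<sigma> * ?D0\<rho> x)"
    proof (rule integral_cong_AE)
      show "AE x in M. (\<sigma> / 2 * (?\<mu>' (c (s n) x) * (?rn n x * ?rn n x)) - \<sigma> / 2 * (?\<mu>' (c t x) * (?r x * ?r x))) / h n
          = a n x + 2 * \<sigma> * ?D0\<rho> x"
        using residual_expansion[of n]
      proof eventually_elim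
        case (elim x)
        have "(A * (R * R) - B * (r * r)) / k
            = (A - B) / k * (R * R) + B * (R + r) * ((R - r) / k)" for A B R r k :: real
          by (simp only: divide_inverse) (simp add: algebra_simps)
        from arg_cong[OF this, of "(*) (\<sigma> / 2)"]
        have 1: "(\<sigma> / 2 * (?\<mu>' (c (s n) x) * (?rn n x * ?rn n x)) - \<sigma> / 2 * (?\<mu>' (c t x) * (?r x * ?r x))) / h n
          = \<sigma> / 2 * (D1 n x * (?rn n x * ?rn n x) + ?\<mu>' (c t x) * (?rn n x + ?r x) * ((?rn n x - ?r x) / h n))"
          unfolding D1_def by (simp only: right_diff_distrib[symmetric] times_divide_eq_right)
        have 2: "(?rn n x - ?r x) / h n = v n x - e n x - 2 * \<rho> n x"
          unfolding elim v_def e_def \<rho>_def by (simp only: divide_inverse) (simp add: algebra_simps)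
        show ?case unfolding 1 2 a_def by (simp add: algebra_simps)
      qed
    qed (intro borel_measurable_integrable integrable_divide Bochner_Integration.integrable_diff
        Bochner_Integration.integrable_add integrable_mult_right dissip_int s0 t a_int D0\<rho>_int)+
    also have "\<dots> = (LINT x|M. a n x) + 2 * \<sigma> * (LINT x|M. ?D0\<rho> x)"
      using a_int D0\<rho>_int by simp
    also have "(LINT x|M. ?D0\<rho> x) = - X n"
    proof -
      have "X n = (LINT x|M. (?\<mu> (c t x) - ?\<mu> (c (s n) x)) * (P x \<bullet> E n x)) / (h n)\<^sup>2"
        unfolding X_def using energy_identity[OF ct cs] by simp
      also have "\<dots> = (LINT x|M. (?\<mu> (c t x) - ?\<mu> (c (s n) x)) * (P x \<bullet> E n x) / (h n)\<^sup>2)"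
        by simp
      also have "\<dots> = (LINT x|M. - ?D0\<rho> x)"
        by (rule Bochner_Integration.integral_cong[OF refl])
          (simp add: D0_def \<rho>_def power2_eq_square minus_divide_left algebra_simps)
      finally show ?thesis by simp
    qed
    finally have quot: "(diss (s n) - diss t) / h n
        = (LINT x|M. a n x) - 2 * \<sigma> * X n" by simp
    have X0: "0 \<le> X n"
    proof -
      have "AE x in M. 0 \<le> ?\<mu> (c (s n) x) * (norm (E n x))\<^sup>2"
        using c_pos[OF s0[of n]] by eventually_elim (simp add: mu_pos less_imp_le)
      then show ?thesis unfolding X_def by (intro divide_nonneg_nonneg integral_nonneg_AE) auto
    qed
    have XY: "X n \<le> (LINT x|M. y n x)"
    proof -
      have "X n \<le> (LINT x|M. (?\<mu> (c t x) - ?\<mu> (c (s n) x))\<^sup>2 * ?q x * inverse (?\<mu> (c (s n) x))) / (h n)\<^sup>2"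
        unfolding X_def using energy_bound[OF ct cs] by (intro divide_right_mono) auto
      also have "\<dots> = (LINT x|M. (?\<mu> (c t x) - ?\<mu> (c (s n) x))\<^sup>2 * ?q x * inverse (?\<mu> (c (s n) x)) / (h n)\<^sup>2)"
        by (rule integral_divide_zero[symmetric])
      also have "\<dots> = (LINT x|M. y n x)"
      proof (rule Bochner_Integration.integral_cong[OF refl])
        fix x
        have "(A - B)\<^sup>2 * Q * I / k\<^sup>2 = (B - A) / k * ((B - A) / k) * Q * I" for A B Q I k :: real
          by (simp only: power2_commute[of A B]) (simp add: power2_eq_square)
        then show "(?\<mu> (c t x) - ?\<mu> (c (s n) x))\<^sup>2 * ?q x * inverse (?\<mu> (c (s n) x)) / (h n)\<^sup>2 = y n x"
          unfolding y_def D0_def .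
      qed
      finally show ?thesis .
    qed
    have "- (2 * \<sigma> * X n) \<le> (1 - \<sigma>) * (LINT x|M. y n x)"
      using \<sigma> X0 XY by auto
    then show ?thesis using quot unfolding h_def by linarith
  qed
  show ?thesis using lim le by blast
qed

end

end

lemma dissipation_continuous: "continuous_on {0..} (diss)"
  unfolding continuous_on_sequentially
proof (intro allI ballI impI)
  fix s :: "nat \<Rightarrow> real" and t :: real assume t: "t \<in> {0..}" and s: "(\<forall>n. s n \<in> {0..}) \<and> s \<longlonglongrightarrow> t"
  then have t0: "0 \<le> t" by simp
  show "(diss \<circ> s) \<longlonglongrightarrow> diss t"
  proof (rule flow_locally_Lipschitz[OF t0])
    fix \<eta> m K :: real
    assume \<eta>: "0 < \<eta>" and m: "0 < m" and K: "0 \<le> K" and loc: "\<And>s. 0 \<le> s \<Longrightarrow> \<bar>s - t\<bar> < \<eta> \<Longrightarrow>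
      near t m K s"
    from s \<eta> obtain N where N: "\<And>n. N \<le> n \<Longrightarrow> \<bar>s n - t\<bar> < \<eta>"
      unfolding LIMSEQ_def dist_real_def by blast
    have "(\<lambda>n. diss (s (n + N))) \<longlonglongrightarrow> diss t"
    proof (rule dissipation_convergent[OF t0 _ _ _ m K])
      show "0 \<le> s (n + N)" for n using s by simp
      show "(\<lambda>n. s (n + N)) \<longlonglongrightarrow> t" using s by (intro LIMSEQ_ignore_initial_segment) blast
      show "\<bar>s (n + N) - t\<bar> < \<eta>" for n by (rule N) simp
      show "near t m K (s (n + N))" for n
        by (rule loc) (use s N[of "n + N"] in auto)
    qed
    then show ?thesis unfolding comp_def by (rule LIMSEQ_offset)
  qed
qed

end

section \<open>Exponential decay and the error estimate\<close>

lemma convex_second_derivative_nonneg: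
  fixes f f' :: "real \<Rightarrow> real"
  assumes convex: "convex_on {0<..} f"
    and f: "\<And>x. 0 < x \<Longrightarrow> (f has_real_derivative f' x) (at x)"
    and f': "(f' has_real_derivative f'') (at r)" and r: "0 < r"
  shows "0 \<le> f''"
proof (rule ccontr)
  have tangent: "f' x * (y - x) \<le> f y - f x" if x: "0 < x" and y: "0 < y" for x y
  proof (rule convex_on_imp_above_tangent[OF convex])
    show "connected {0::real<..}" by simp
    show "x \<in> interior {0<..}" using x by (simp add: interior_open)
    show "y \<in> {0<..}" using y by simp
    show "(f has_field_derivative f' x) (at x within {0<..})"
      by (rule has_field_derivative_at_within[OF f[OF x]])
  qed
  assume "\<not> 0 \<le> f''"
  then have "f'' < 0" by simp
  from DERIV_neg_dec_right[OF f' this] obtain d where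
    d: "d > 0" "\<forall>h>0. h < d \<longrightarrow> f' (r + h) < f' r" by blast
  define y where "y = r + d / 2"
  have y: "r < y" "f' y < f' r" using d by (simp_all add: y_def)
  have "f' r * (y - r) + f' y * (r - y) \<le> 0"
    using tangent[of r y] tangent[of y r] y(1) r by simp
  then have "(f' r - f' y) * (y - r) \<le> 0" by (simp add: algebra_simps)
  moreover have "0 < (f' r - f' y) * (y - r)" using y by simp
  ultimately show False by simp
qed

context power_like_potential
begin

lemma decay_rate_le:
  assumes "decay_rate \<phi> > - \<infinity>" "0 < r"
  shows "real_of_ereal (decay_rate \<phi>)
    \<le> 1 + r * deriv (deriv (mu \<phi>)) r / (2 * deriv (mu \<phi>) r)"
proof -
  have "decay_rate \<phi> \<le> ereal (1 + r * deriv (deriv (mu \<phi>)) r / (2 * deriv (mu \<phi>) r))"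
    unfolding decay_rate_def using assms(2) by (intro INF_lower) simp
  with assms(1) show ?thesis by (cases "decay_rate \<phi>") auto
qed

text \<open>
  As \<open>q \<ge> 0\<close>, one of the three factors \<open>y - q\<close> in the cubic term may be replaced by \<open>y\<close>, which produces
  exactly the quotient in the definition of the rate.
\<close>
lemma decay_density_convex:
  assumes rate: "decay_rate \<phi> > - \<infinity>" and y: "0 < y" and q: "0 \<le> q"
    and pos: "deriv (mu \<phi>) y > 0" and curv: "deriv (deriv (mu \<phi>)) y \<le> 0"
  shows "decay_density 1 y q \<le> - real_of_ereal (decay_rate \<phi>) * (\<bar>deriv (mu \<phi>) y\<bar> * (y - q)\<^sup>2)"
proof -
  define A B r where "A = deriv (mu \<phi>) y" and "B = deriv (deriv (mu \<phi>)) y" and "r = y - q"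
  define l where "l = real_of_ereal (decay_rate \<phi>)"
  have A: "A > 0" and B: "B \<le> 0" using pos curv by (simp_all add: A_def B_def)
  have "l \<le> 1 + y * B / (2 * A)" unfolding l_def A_def B_def by (rule decay_rate_le[OF rate y])
  then have "l * A \<le> (1 + y * B / (2 * A)) * A" using A by (intro mult_right_mono) auto
  also have "\<dots> = A + y * B / 2" using A by (simp add: field_simps)
  finally have lA: "l * A \<le> A + y * B / 2" .
  have "- B / 2 * r \<le> - B / 2 * y" using B q by (intro mult_left_mono) (auto simp: r_def)
  with lA have "- B / 2 * r - A \<le> - (l * A)" by (simp add: algebra_simps)
  then have "(- B / 2 * r - A) * r\<^sup>2 \<le> - (l * A) * r\<^sup>2" by (rule mult_right_mono) simp
  moreover have "decay_density 1 y q = (- B / 2 * r - A) * r\<^sup>2"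
    unfolding decay_density_def A_def[symmetric] B_def[symmetric] r_def[symmetric]
    by (simp add: power2_eq_square power3_eq_cube algebra_simps)
  ultimately show ?thesis using A unfolding A_def[symmetric] l_def[symmetric] r_def[symmetric]
    by (simp add: mult.assoc)
qed

text \<open>
  The condition on the second derivative lets the last summand be absorbed by \<open>\<mu>''(y) q (y - q)\<^sup>2 / 2\<close>; together
  with the cubic term this again replaces one factor \<open>y - q\<close> by \<open>y\<close>.
\<close>
lemma decay_density_concave:
  assumes rate: "decay_rate \<phi> > - \<infinity>" and y: "0 < y" and q: "0 \<le> q"
    and neg: "deriv (mu \<phi>) y < 0"
    and curv: "4 * (deriv (mu \<phi>) y)\<^sup>2 / mu \<phi> y \<le> deriv (deriv (mu \<phi>)) y"
  shows "decay_density (-1) y q \<le> - real_of_ereal (decay_rate \<phi>) * (\<bar>deriv (mu \<phi>) y\<bar> * (y - q)\<^sup>2)"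
proof -
  define A B r where "A = deriv (mu \<phi>) y" and "B = deriv (deriv (mu \<phi>)) y" and "r = y - q"
  define l J where "l = real_of_ereal (decay_rate \<phi>)" and "J = A\<^sup>2 * inverse (mu \<phi> y)"
  have A: "A < 0" and J: "4 * J \<le> B" using neg curv by (simp_all add: A_def B_def J_def divide_inverse mult.assoc)
  have "l \<le> 1 + y * B / (2 * A)" unfolding l_def A_def B_def by (rule decay_rate_le[OF rate y])
  then have "(1 + y * B / (2 * A)) * A \<le> l * A" using A by (intro mult_right_mono_neg) auto
  moreover have "(1 + y * B / (2 * A)) * A = A + y * B / 2" using A by (simp add: field_simps)
  ultimately have lA: "A + y * B / 2 \<le> l * A" by simp
  have "2 * J * q \<le> B / 2 * q" using J q by (intro mult_right_mono) auto
  moreover have "B / 2 * r + B / 2 * q = y * B / 2" by (simp add: r_def field_simps)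
  ultimately have "B / 2 * r + A + 2 * J * q \<le> l * A" using lA by linarith
  then have "(B / 2 * r + A + 2 * J * q) * r\<^sup>2 \<le> l * A * r\<^sup>2" by (rule mult_right_mono) simp
  moreover have "decay_density (-1) y q = (B / 2 * r + A + 2 * J * q) * r\<^sup>2"
    unfolding decay_density_def J_def A_def[symmetric] B_def[symmetric] r_def[symmetric]
    by (simp add: power2_eq_square power3_eq_cube algebra_simps)
  ultimately show ?thesis using A unfolding A_def[symmetric] l_def[symmetric] r_def[symmetric]
    by (simp add: mult.assoc)
qed

lemma DERIV_Phi: assumes "0 < x" shows "(Phi \<phi> has_real_derivative mu \<phi> x / 2) (at x)"
proof -
  have x: "sqrt x > 0" using assms by simp
  have "(Phi \<phi> has_real_derivative \<psi> (sqrt x) * (inverse (sqrt x) / 2)) (at x)"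
    unfolding Phi_def[abs_def] by (rule DERIV_chain2[OF DERIV_phi[OF x] DERIV_real_sqrt[OF assms]])
  moreover have "\<psi> (sqrt x) * (inverse (sqrt x) / 2) = mu \<phi> x / 2"
    unfolding mu_eq[OF C3 assms] divide_inverse by (rule mult.assoc[symmetric])
  ultimately show ?thesis by (simp only:)
qed

lemma deriv_mu_nonneg_of_convex:
  assumes "convex_on {0<..} (Phi \<phi>)" "0 < r"
  shows "0 \<le> deriv (mu \<phi>) r"
proof -
  have "0 \<le> deriv (mu \<phi>) r / 2"
    by (rule convex_second_derivative_nonneg[OF assms(1) DERIV_Phi DERIV_cdivide[OF DERIV_mu_deriv[OF assms(2)]] assms(2)])
  then show ?thesis by simp
qed

lemma deriv_mu_nonpos_of_concave:
  assumes "concave_on {0<..} (Phi \<phi>)" "0 < r"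
  shows "deriv (mu \<phi>) r \<le> 0"
proof -
  have "0 \<le> - (deriv (mu \<phi>) r / 2)"
  proof (rule convex_second_derivative_nonneg[where f = "\<lambda>x. - Phi \<phi> x" and f' = "\<lambda>x. - (mu \<phi> x / 2)"])
    show "convex_on {0<..} (\<lambda>x. - Phi \<phi> x)" using assms(1) by (simp only: concave_on_def)
    show "((\<lambda>x. - Phi \<phi> x) has_real_derivative - (mu \<phi> x / 2)) (at x)" if "0 < x" for x
      by (rule DERIV_minus[OF DERIV_Phi[OF that]])
    show "((\<lambda>x. - (mu \<phi> x / 2)) has_real_derivative - (deriv (mu \<phi>) r / 2)) (at r)"
      by (rule DERIV_minus[OF DERIV_cdivide[OF DERIV_mu_deriv[OF assms(2)]]])
  qed (rule assms(2))
  then show ?thesis by simp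
qed

end

locale decaying_flow = coefficient_flow +
  assumes a: "Phi_strictly_convex \<phi> \<or> Phi_strictly_concave \<phi>"
    and c_rate: "decay_rate \<phi> > - \<infinity>"
    and c_cases:
      "(convex_on {0<..} (Phi \<phi>) \<and> (\<forall>r>0. deriv (deriv (mu \<phi>)) r \<le> 0)) \<or>
       (concave_on {0<..} (Phi \<phi>) \<and>
          (\<forall>r>0. deriv (deriv (mu \<phi>)) r \<ge> 4 * (deriv (mu \<phi>) r)\<^sup>2 / mu \<phi> r))"
begin

abbreviation rate :: real where "rate \<equiv> real_of_ereal (decay_rate \<phi>)"

lemma deriv_mu_nonzero: "0 < r \<Longrightarrow> deriv (mu \<phi>) r \<noteq> 0"
  using a unfolding Phi_strictly_convex_def Phi_strictly_concave_def by (metis less_irrefl)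

text \<open>
  Strict monotonicity of \<open>\<mu>\<close> excludes a vanishing derivative, so convexity or concavity of \<open>\<Phi>\<close> fixes the sign.
\<close>
lemma decay_density_bound:
  "\<exists>\<sigma>. (\<sigma> = 1 \<or> \<sigma> = -1) \<and> (\<forall>r>0. \<bar>deriv (mu \<phi>) r\<bar> = \<sigma> * deriv (mu \<phi>) r) \<and>
    (\<forall>y q. 0 < y \<longrightarrow> 0 \<le> q \<longrightarrow> decay_density \<sigma> y q \<le> - rate * (\<bar>deriv (mu \<phi>) y\<bar> * (y - q)\<^sup>2))"
  using c_cases
proof
  assume h: "convex_on {0<..} (Phi \<phi>) \<and> (\<forall>r>0. deriv (deriv (mu \<phi>)) r \<le> 0)"
  have pos: "deriv (mu \<phi>) r > 0" if "r > 0" for r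
    using deriv_mu_nonneg_of_convex[OF conjunct1[OF h] that] deriv_mu_nonzero[OF that] by simp
  show ?thesis
    by (intro exI[of _ 1] conjI allI impI decay_density_convex c_rate)
      (use pos h in \<open>auto simp: abs_of_pos\<close>)
next
  assume h: "concave_on {0<..} (Phi \<phi>) \<and>
      (\<forall>r>0. deriv (deriv (mu \<phi>)) r \<ge> 4 * (deriv (mu \<phi>) r)\<^sup>2 / mu \<phi> r)"
  have neg: "deriv (mu \<phi>) r < 0" if "r > 0" for r
    using deriv_mu_nonpos_of_concave[OF conjunct1[OF h] that] deriv_mu_nonzero[OF that] by simp
  show ?thesis
    by (intro exI[of _ "-1"] conjI allI impI decay_density_concave c_rate)
      (use neg h in \<open>auto simp: abs_of_neg\<close>)
qed

lemma dissipation_decay: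
  assumes T: "0 \<le> T"
  shows "diss T \<le> exp (- (2 * rate) * T) * diss 0"
proof (rule Gronwall_upper_Dini[OF dissipation_continuous T])
  fix t e :: real assume t: "0 \<le> t" and e: "0 < e"
  let ?q = "\<lambda>x. (norm (Du t x))\<^sup>2"
  obtain \<sigma> where \<sigma>: "\<sigma> = 1 \<or> \<sigma> = -1" "\<And>r. r > 0 \<Longrightarrow> \<bar>deriv (mu \<phi>) r\<bar> = \<sigma> * deriv (mu \<phi>) r"
    and dens: "\<And>y q. 0 < y \<Longrightarrow> 0 \<le> q \<Longrightarrow> decay_density \<sigma> y q \<le> - rate * (\<bar>deriv (mu \<phi>) y\<bar> * (y - q)\<^sup>2)"
    using decay_density_bound by blast
  have ct: "c t \<in> positive_cone \<Omega> Ch" by (rule c_cone[OF t])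
  have \<mu>: "ess_bounded M (\<lambda>x. mu \<phi> (c t x))" "ess_bounded M (\<lambda>x. deriv (mu \<phi>) (c t x))"
    "ess_bounded M (\<lambda>x. deriv (deriv (mu \<phi>)) (c t x))" "ess_bounded M (\<lambda>x. inverse (mu \<phi> (c t x)))"
    "ess_bounded M (\<lambda>x. \<bar>deriv (mu \<phi>) (c t x)\<bar>)"
    using cone_comp_ess_bounded[OF ct continuous_mu(1)] cone_comp_ess_bounded[OF ct continuous_mu(2)]
      cone_comp_ess_bounded[OF ct continuous_mu''] cone_comp_ess_bounded[OF ct continuous_inverse_mu]
      cone_comp_ess_bounded[OF ct continuous_on_rabs[OF continuous_mu(2)]] by simp_all
  have q: "ess_bounded M ?q" by (intro D_square_ess_bounded u_mem ct)
  have r: "ess_bounded M (\<lambda>x. c t x - ?q x)" by (intro ess_bounded_diff c_ess_bounded t q)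
  have dens_int: "integrable M (\<lambda>x. decay_density \<sigma> (c t x) (?q x))"
    unfolding decay_density_def power2_eq_square[of "deriv _ _"] power2_eq_square[of "_ - _"] power3_eq_cube
    by (intro fm.ess_bounded_integrable ess_bounded_diff fm.ess_bounded_add fm.ess_bounded_mult
        fm.ess_bounded_const \<mu> q r)
  have lim_le: "(LINT x|M. decay_density \<sigma> (c t x) (?q x)) \<le> - (2 * rate) * diss t"
  proof -
    have "(LINT x|M. decay_density \<sigma> (c t x) (?q x))
        \<le> (LINT x|M. - rate * (\<bar>deriv (mu \<phi>) (c t x)\<bar> * (c t x - ?q x)\<^sup>2))"
    proof (rule integral_mono_AE[OF dens_int])
      show "integrable M (\<lambda>x. - rate * (\<bar>deriv (mu \<phi>) (c t x)\<bar> * (c t x - ?q x)\<^sup>2))"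
        unfolding power2_eq_square[of "_ - _"]
        by (intro integrable_mult_right fm.ess_bounded_integrable fm.ess_bounded_mult \<mu> r)
      show "AE x in M. decay_density \<sigma> (c t x) (?q x) \<le> - rate * (\<bar>deriv (mu \<phi>) (c t x)\<bar> * (c t x - ?q x)\<^sup>2)"
        using c_pos[OF t] by eventually_elim (rule dens, auto)
    qed
    also have "\<dots> = - (2 * rate) * diss t"
      unfolding dissipation_def by simp
    finally show ?thesis .
  qed
  show "eventually (\<lambda>s. diss s \<le> diss t + (s - t) * (- (2 * rate) * diss t + e)) (at_right t)"
  proof (rule flow_locally_Lipschitz[OF t])
    fix \<eta> m K :: real
    assume \<eta>: "0 < \<eta>" and m: "0 < m" and K: "0 \<le> K" and loc: "\<And>s. 0 \<le> s \<Longrightarrow> \<bar>s - t\<bar> < \<eta> \<Longrightarrow>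
      near t m K s"
    show ?thesis
    proof (rule sequentially_imp_eventually_at_right[of t "t + \<eta>"])
      show "t < t + \<eta>" using \<eta> by simp
      fix s :: "nat \<Rightarrow> real"
      assume s: "\<And>n. t < s n" "\<And>n. s n < t + \<eta>" "s \<longlonglongrightarrow> t"
      have s0: "0 \<le> s n" for n using s(1)[of n] t by linarith
      have s\<eta>: "\<bar>s n - t\<bar> < \<eta>" for n using s(1,2)[of n] by linarith
      obtain Z where Z: "Z \<longlonglongrightarrow> (LINT x|M. decay_density \<sigma> (c t x) (?q x))"
        "\<And>n. (diss (s n) - diss t) / (s n - t) \<le> Z n"
        using dissipation_quotient_le[OF t s0 s(3) s\<eta> m K loc[OF s0 s\<eta>] s(1) \<sigma>] by blast
      have "eventually (\<lambda>n. Z n < - (2 * rate) * diss t + e) sequentially"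
        by (rule order_tendstoD(2)[OF Z(1)]) (use lim_le e in linarith)
      then show "eventually (\<lambda>n. diss (s n) \<le> diss t + (s n - t) * (- (2 * rate) * diss t + e)) sequentially"
      proof eventually_elim
        case (elim n)
        then have "(diss (s n) - diss t) / (s n - t) \<le> - (2 * rate) * diss t + e" using Z(2)[of n] by linarith
        then show ?case using s(1)[of n] by (simp add: pos_divide_le_eq mult.commute)
      qed
    qed
  qed
qed

end

context coefficient_flow
begin

lemma phi_norm_ess_bounded:
  assumes v: "v \<in> Wh" shows "ess_bounded M (\<lambda>x. \<phi> (norm (D v x)))"
proof -
  obtain K where K: "AE x in M. norm (D v x) \<le> K" using D_bounded[OF v] .
  have "compact (\<phi> ` {0..K})"
    by (intro compact_continuous_image continuous_on_subset[OF phi_continuous]) auto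
  then have "bounded (\<phi> ` {0..K})" by (rule compact_imp_bounded)
  then obtain L where "\<forall>y\<in>\<phi> ` {0..K}. norm y \<le> L" unfolding bounded_iff by blast
  then have L: "\<bar>\<phi> y\<bar> \<le> L" if "y \<in> {0..K}" for y using that by auto
  have "AE x in M. \<bar>\<phi> (norm (D v x))\<bar> \<le> L" using K by eventually_elim (rule L, simp)
  moreover have "(\<lambda>x. \<phi> (norm (D v x))) \<in> borel_measurable M"
  proof -
    have n: "(\<lambda>x. norm (D v x)) \<in> borel_measurable M" using D_measurable[OF v] by measurable
    have "(\<lambda>r. if r \<in> {0..} then \<phi> r else 0) \<in> borel_measurable borel"
      by (rule borel_measurable_continuous_on_if) (use phi_continuous in auto)
    from measurable_compose[OF n this] show ?thesis by simp
  qed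
  ultimately show ?thesis unfolding ess_bounded_def by blast
qed

lemma mu_norm_measurable:
  assumes v: "v \<in> Wh" and f: "continuous_on {0<..} f"
  shows "(\<lambda>x. f ((norm (D v x))\<^sup>2) *\<^sub>R D v x) \<in> borel_measurable M"
proof -
  have n: "(\<lambda>x. (norm (D v x))\<^sup>2) \<in> borel_measurable M" using D_measurable[OF v] by measurable
  have "(\<lambda>r. if r \<in> {0<..} then f r else 0) \<in> borel_measurable borel"
    by (rule borel_measurable_continuous_on_if) (use f in auto)
  from measurable_compose[OF n this]
  have "(\<lambda>x. (if (norm (D v x))\<^sup>2 \<in> {0<..} then f ((norm (D v x))\<^sup>2) else 0) *\<^sub>R D v x) \<in> borel_measurable M"
    by (rule borel_measurable_scaleR) (rule D_measurable[OF v])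
  moreover have "(if (norm (D v x))\<^sup>2 \<in> {0<..} then f ((norm (D v x))\<^sup>2) else 0) *\<^sub>R D v x
      = f ((norm (D v x))\<^sup>2) *\<^sub>R D v x" for x by auto
  ultimately show ?thesis by (simp only:)
qed

lemma psi_bounded_below: "0 < y \<Longrightarrow> y \<le> K \<Longrightarrow> \<psi> y \<le> \<bar>\<psi> K\<bar>"
  using psi_mono[of y K] by linarith

lemma A_inner_ess_bounded:
  assumes v: "v \<in> Wh" and w: "w \<in> Wh"
  shows "ess_bounded M (\<lambda>x. A_map \<phi> (D v x) \<bullet> D w x)"
proof -
  obtain K where K: "AE x in M. norm (D v x) \<le> K" using D_bounded[OF v] .
  obtain L where L: "AE x in M. norm (D w x) \<le> L" using D_bounded[OF w] .
  have "AE x in M. \<bar>A_map \<phi> (D v x) \<bullet> D w x\<bar> \<le> \<bar>\<psi> K\<bar> * L"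
    using K L
  proof eventually_elim
    case (elim x)
    have "norm (A_map \<phi> (D v x)) \<le> \<bar>\<psi> K\<bar>"
    proof (cases "D v x = 0")
      case False
      then have y: "norm (D v x) > 0" by simp
      have "norm (A_map \<phi> (D v x)) = \<psi> (norm (D v x))"
        using y psi_pos[OF y] by (simp add: A_map_def mu_square)
      then show ?thesis using psi_bounded_below[OF y elim(1)] by simp
    qed (simp add: A_map_def)
    with elim(2) have "norm (A_map \<phi> (D v x)) * norm (D w x) \<le> \<bar>\<psi> K\<bar> * L" by (intro mult_mono) auto
    with Cauchy_Schwarz_ineq2[of "A_map \<phi> (D v x)" "D w x"] show ?case by linarith
  qed
  moreover have "(\<lambda>x. A_map \<phi> (D v x) \<bullet> D w x) \<in> borel_measurable M"
    unfolding A_map_def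
    by (intro borel_measurable_inner mu_norm_measurable[OF v continuous_mu(1)] D_measurable w)
  ultimately show ?thesis unfolding ess_bounded_def by blast
qed

lemma V_error_L2:
  assumes v: "v \<in> Wh" and w: "w \<in> Wh"
  shows "L2_on \<Omega> (V_error \<phi> D v w)"
proof -
  have sq: "continuous_on {0<..} (\<lambda>r. sqrt (mu \<phi> r))" by (intro continuous_on_real_sqrt continuous_mu)
  have L2: "L2_on \<Omega> (\<lambda>x. V_map \<phi> (D v x))" if v: "v \<in> Wh" for v
    unfolding L2_on_def
  proof
    show m: "(\<lambda>x. V_map \<phi> (D v x)) \<in> borel_measurable M"
      unfolding V_map_def by (rule mu_norm_measurable[OF v sq])
    have "(norm (V_map \<phi> P))\<^sup>2 = A_map \<phi> P \<bullet> P" for P :: 'm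
    proof (cases "P = 0")
      case False
      then have n: "norm P > 0" by simp
      have "A_map \<phi> P \<bullet> P = \<psi> (norm P) / norm P * (norm P)\<^sup>2"
        by (simp only: A_map_def mu_square[OF n] inner_scaleR_left power2_norm_eq_inner[symmetric])
      with n show ?thesis unfolding norm_V_map by (simp add: power2_eq_square)
    qed (simp add: V_map_def)
    then have "ess_bounded M (\<lambda>x. (norm (V_map \<phi> (D v x)))\<^sup>2)"
      using A_inner_ess_bounded[OF v v] by (simp only:)
    then show "integrable M (\<lambda>x. (norm (V_map \<phi> (D v x)))\<^sup>2)" by (rule fm.ess_bounded_integrable)
  qed
  show ?thesis unfolding V_error_def[abs_def] by (rule L2_diff[OF L2[OF v] L2[OF w]])
qed

text \<open>
  Since \<open>\<mu>(c) D u\<close> and \<open>A(D u\<^sub>*)\<close> have the same pairing with \<open>D (u - u\<^sub>*)\<close>, one may be exchanged for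
  the other in the integrated Bregman distance between its lower and its upper pointwise bound.
\<close>
lemma V_error_dissipation:
  assumes ubar: "nonlinear_solution \<Omega> \<phi> Wh D F ubar"
  obtains C where "C > 0" "\<And>t. 0 \<le> t \<Longrightarrow>
     (LINT x|M. (norm (V_error \<phi> D (u (c t)) ubar x))\<^sup>2) \<le> C * diss t"
proof (rule energy_gap[where 'm = 'm])
  fix K assume K: "K > 0" and gap: "\<And>(P :: 'm) R c. c > 0 \<Longrightarrow>
       \<phi> (norm P) - \<phi> (norm R) - mu \<phi> c * (P \<bullet> (P - R)) \<le> K * (\<bar>deriv (mu \<phi>) c\<bar> * (c - (norm P)\<^sup>2)\<^sup>2)"
  have ub: "ubar \<in> Wh" and ub_eq: "\<And>v. v \<in> Wh \<Longrightarrow> (LINT x|M. A_map \<phi> (D ubar x) \<bullet> D v x) = F v"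
    using ubar unfolding nonlinear_solution_def by blast+
  show ?thesis
  proof (rule that[of "1536 * K"])
    show "1536 * K > 0" using K by simp
    fix t :: real assume t: "0 \<le> t"
    let ?P = "Du t" and ?R = "D ubar"
    have ct: "c t \<in> positive_cone \<Omega> Ch" by (rule c_cone[OF t])
    have ut: "u (c t) \<in> Wh" by (rule u_mem[OF ct])
    define w where "w = (\<lambda>x. u (c t) x - ubar x)"
    have w: "w \<in> Wh" unfolding w_def by (rule Wh_diff[OF ut ub])
    have Dw: "AE x in M. D w x = ?P x - ?R x" unfolding w_def by (rule D_diff[OF ut ub])
    have phi_int: "integrable M (\<lambda>x. \<phi> (norm (?P x)))" "integrable M (\<lambda>x. \<phi> (norm (?R x)))"
      by (intro fm.ess_bounded_integrable phi_norm_ess_bounded ut ub)+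
    have A_int: "integrable M (\<lambda>x. A_map \<phi> (?R x) \<bullet> D w x)"
      by (intro fm.ess_bounded_integrable A_inner_ess_bounded ub w)
    have \<tau>_int: "integrable M (\<lambda>x. mu \<phi> (c t x) * (?P x \<bullet> D w x))"
      by (intro fm.ess_bounded_integrable fm.ess_bounded_mult cone_comp_ess_bounded[OF ct continuous_mu(1)]
          D_inner_ess_bounded ut w)
    have d_int: "integrable M (\<lambda>x. \<bar>deriv (mu \<phi>) (c t x)\<bar> * (c t x - (norm (?P x))\<^sup>2)\<^sup>2)"
      unfolding power2_eq_square[of "_ - _"]
      by (intro fm.ess_bounded_integrable fm.ess_bounded_mult ess_bounded_diff c_ess_bounded t
          D_square_ess_bounded ut cone_comp_ess_bounded[OF ct continuous_on_rabs[OF continuous_mu(2)]])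
    have V_int: "integrable M (\<lambda>x. (norm (V_error \<phi> D (u (c t)) ubar x))\<^sup>2)"
      using V_error_L2[OF ut ub] unfolding L2_on_def by blast
    have "(LINT x|M. (norm (V_error \<phi> D (u (c t)) ubar x))\<^sup>2 / 768)
        \<le> (LINT x|M. \<phi> (norm (?P x)) - \<phi> (norm (?R x)) - A_map \<phi> (?R x) \<bullet> D w x)"
    proof (rule integral_mono_AE)
      show "AE x in M. (norm (V_error \<phi> D (u (c t)) ubar x))\<^sup>2 / 768
          \<le> \<phi> (norm (?P x)) - \<phi> (norm (?R x)) - A_map \<phi> (?R x) \<bullet> D w x"
        using Dw by eventually_elim (simp only: V_error_def bregman_controls_V)
    qed (intro integrable_divide Bochner_Integration.integrable_diff V_int phi_int A_int)+
    also have "\<dots> = (LINT x|M. \<phi> (norm (?P x)) - \<phi> (norm (?R x)) - mu \<phi> (c t x) * (?P x \<bullet> D w x))"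
      using phi_int A_int \<tau>_int ub_eq[OF w] u_eq[OF ct w] by simp
    also have "\<dots> \<le> (LINT x|M. K * (\<bar>deriv (mu \<phi>) (c t x)\<bar> * (c t x - (norm (?P x))\<^sup>2)\<^sup>2))"
    proof (rule integral_mono_AE)
      show "AE x in M. \<phi> (norm (?P x)) - \<phi> (norm (?R x)) - mu \<phi> (c t x) * (?P x \<bullet> D w x)
          \<le> K * (\<bar>deriv (mu \<phi>) (c t x)\<bar> * (c t x - (norm (?P x))\<^sup>2)\<^sup>2)"
        using Dw c_pos[OF t] by eventually_elim (simp only: gap)
    qed (intro integrable_mult_right Bochner_Integration.integrable_diff d_int phi_int \<tau>_int)+
    also have "\<dots> = 2 * K * diss t" by (simp add: dissipation_def)
    finally show "(LINT x|M. (norm (V_error \<phi> D (u (c t)) ubar x))\<^sup>2)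
        \<le> 1536 * K * diss t" by simp
  qed
qed

end

context decaying_flow
begin

theorem V_error_decay:
  assumes ubar: "nonlinear_solution \<Omega> \<phi> Wh D F ubar"
  shows "(\<exists>C>0. \<forall>t\<ge>0. L2_on \<Omega> (V_error \<phi> D (u (c t)) ubar) \<and>
           L2_norm \<Omega> (V_error \<phi> D (u (c t)) ubar)
             \<le> C * exp (- rate * t) * sqrt (diss 0)) \<and>
        (decay_rate \<phi> > 0 \<longrightarrow>
           ((\<lambda>t. L2_norm \<Omega> (V_error \<phi> D (u (c t)) ubar)) \<longlongrightarrow> 0) at_top)"
proof -
  let ?N = "\<lambda>t. L2_norm \<Omega> (V_error \<phi> D (u (c t)) ubar)"
  have ub: "ubar \<in> Wh" using ubar unfolding nonlinear_solution_def by blast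
  obtain C where C: "C > 0" "\<And>t. 0 \<le> t \<Longrightarrow>
     (LINT x|M. (norm (V_error \<phi> D (u (c t)) ubar x))\<^sup>2) \<le> C * diss t"
    by (rule V_error_dissipation[OF ubar]) (rule that)
  have bound: "?N t \<le> sqrt C * exp (- rate * t) * sqrt (diss 0)" if t: "0 \<le> t" for t
  proof -
    have "(LINT x|M. (norm (V_error \<phi> D (u (c t)) ubar x))\<^sup>2) \<le> C * (exp (- (2 * rate) * t) * diss 0)"
      using C(2)[OF t] dissipation_decay[OF t] C(1) by (meson less_imp_le mult_left_mono order_trans)
    then have "?N t \<le> sqrt (C * (exp (- (2 * rate) * t) * diss 0))"
      unfolding L2_norm_def by (rule real_sqrt_le_mono)
    also have "exp (- (2 * rate) * t) = (exp (- rate * t))\<^sup>2"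
      by (simp add: power2_eq_square exp_add[symmetric])
    also have "sqrt (C * ((exp (- rate * t))\<^sup>2 * diss 0)) = sqrt C * exp (- rate * t) * sqrt (diss 0)"
      by (simp add: real_sqrt_mult)
    finally show ?thesis .
  qed
  have "((\<lambda>t. ?N t) \<longlongrightarrow> 0) at_top" if pos: "decay_rate \<phi> > 0"
  proof -
    have "rate > 0"
    proof -
      have "decay_rate \<phi> \<le> ereal (1 + 1 * deriv (deriv (mu \<phi>)) 1 / (2 * deriv (mu \<phi>) 1))"
        unfolding decay_rate_def by (rule INF_lower) simp
      then have "decay_rate \<phi> \<noteq> \<infinity>" by auto
      with pos show ?thesis by (cases "decay_rate \<phi>") auto
    qed
    then have "filterlim (\<lambda>t. - rate * t) at_bot at_top"
      by (intro filterlim_tendsto_neg_mult_at_bot[OF tendsto_const _ filterlim_ident]) simp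
    then have "((\<lambda>t. exp (- rate * t)) \<longlongrightarrow> 0) at_top" by (rule filterlim_compose[OF exp_at_bot])
    then have "((\<lambda>t. sqrt C * exp (- rate * t) * sqrt (diss 0)) \<longlongrightarrow> sqrt C * 0 * sqrt (diss 0)) at_top"
      by (intro tendsto_mult tendsto_const)
    then have lim: "((\<lambda>t. sqrt C * exp (- rate * t) * sqrt (diss 0)) \<longlongrightarrow> 0) at_top" by simp
    show ?thesis
    proof (rule tendsto_sandwich[OF _ _ tendsto_const lim])
      show "eventually (\<lambda>t. 0 \<le> ?N t) at_top"
        unfolding L2_norm_def by (intro always_eventually allI real_sqrt_ge_zero integral_nonneg_AE) auto
      show "eventually (\<lambda>t. ?N t \<le> sqrt C * exp (- rate * t) * sqrt (diss 0)) at_top"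
        using eventually_ge_at_top[of 0] by eventually_elim (rule bound)
    qed
  qed
  moreover have "L2_on \<Omega> (V_error \<phi> D (u (c t)) ubar)" if "0 \<le> t" for t
    by (rule V_error_L2[OF u_mem[OF c_cone[OF that]] ub])
  ultimately show ?thesis using bound C(1) by (intro conjI exI[of _ "sqrt C"]) auto
qed

end

lemma functional_diff:
  assumes S: "fin_dim_fun_space S" "S \<subseteq> X" and F: "bounded_functional_on X N F"
    and fg: "f \<in> S" "g \<in> S"
  shows "F (\<lambda>x. f x - g x) = F f - F g"
proof -
  have g': "(\<lambda>x. (-1) *\<^sub>R g x) \<in> S" using S(1) fg(2) unfolding fin_dim_fun_space_def by blast
  have add: "\<And>u v. u \<in> X \<Longrightarrow> v \<in> X \<Longrightarrow> F (\<lambda>x. u x + v x) = F u + F v"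
    and scale: "\<And>a u. u \<in> X \<Longrightarrow> F (\<lambda>x. a *\<^sub>R u x) = a * F u"
    using F unfolding bounded_functional_on_def by blast+
  have "F (\<lambda>x. f x + (-1) *\<^sub>R g x) = F f + F (\<lambda>x. (-1) *\<^sub>R g x)"
    by (rule add) (use S(2) fg(1) g' in blast)+
  also have "F (\<lambda>x. (-1) *\<^sub>R g x) = (-1) * F g" by (rule scale) (use S(2) fg(2) in blast)
  finally show ?thesis by simp
qed

theorem theorem4p8:
  fixes \<Omega> :: "(real ^ 'd) set" and \<phi> :: "real \<Rightarrow> real" and Ch :: "(real ^ 'd \<Rightarrow> real) set"
  assumes dimension: "CARD('d) = 2 \<or> CARD('d) = 3"
    and domain: "open \<Omega>" "connected \<Omega>" "\<Omega> \<noteq> {}" "bounded \<Omega>"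
    and standing: "standing_assumptions \<phi>"
    and a: "Phi_strictly_convex \<phi> \<or> Phi_strictly_concave \<phi>"
    and b: "(ereal (1/3) \<le> S_minus \<phi> \<and> S_minus \<phi> \<le> S_plus \<phi> \<and> S_plus \<phi> < 1) \<or>
            (1 < S_minus \<phi> \<and> S_minus \<phi> \<le> S_plus \<phi> \<and> S_plus \<phi> \<le> 3)"
    and c_rate: "decay_rate \<phi> > - \<infinity>"
    and c_cases:
      "(convex_on {0<..} (Phi \<phi>) \<and> (\<forall>r>0. deriv (deriv (mu \<phi>)) r \<le> 0)) \<or>
       (concave_on {0<..} (Phi \<phi>) \<and>
          (\<forall>r>0. deriv (deriv (mu \<phi>)) r \<ge> 4 * (deriv (mu \<phi>) r)\<^sup>2 / mu \<phi> r))"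
  shows
    "(\<forall>(Uh :: (real ^ 'd \<Rightarrow> real) set) F u c0 c ubar.
        scalar_spaces \<Omega> Ch Uh \<and>
        bounded_functional_on (H10 \<Omega>) (H1_norm \<Omega>) F \<and>
        (\<forall>b\<in>positive_cone \<Omega> Ch. weighted_solution \<Omega> \<phi> Uh (weak_grad \<Omega>) F b (u b)) \<and>
        c0 \<in> positive_cone \<Omega> Ch \<and> flow_solution \<Omega> Ch (weak_grad \<Omega>) u c0 c \<and>
        nonlinear_solution \<Omega> \<phi> Uh (weak_grad \<Omega>) F ubar \<longrightarrow>
        (\<exists>C>0. \<forall>t\<ge>0. L2_on \<Omega> (V_error \<phi> (weak_grad \<Omega>) (u (c t)) ubar) \<and>
           L2_norm \<Omega> (V_error \<phi> (weak_grad \<Omega>) (u (c t)) ubar)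
             \<le> C * exp (- real_of_ereal (decay_rate \<phi>) * t)
                 * sqrt (dissipation \<Omega> \<phi> (weak_grad \<Omega>) u c 0)) \<and>
        (decay_rate \<phi> > 0 \<longrightarrow>
           ((\<lambda>t. L2_norm \<Omega> (V_error \<phi> (weak_grad \<Omega>) (u (c t)) ubar)) \<longlongrightarrow> 0) at_top))
     \<and>
     (\<forall>(Uh :: (real ^ 'd \<Rightarrow> real ^ 'd) set) Qh Wh F u c0 c ubar.
        vector_spaces \<Omega> Ch Uh Qh \<and> Wh = discretely_div_free \<Omega> Uh Qh \<and>
        bounded_functional_on (H10_vec \<Omega>) (H1_norm_vec \<Omega>) F \<and>
        (\<forall>b\<in>positive_cone \<Omega> Ch. weighted_solution \<Omega> \<phi> Wh (sym_grad \<Omega>) F b (u b)) \<and>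
        c0 \<in> positive_cone \<Omega> Ch \<and> flow_solution \<Omega> Ch (sym_grad \<Omega>) u c0 c \<and>
        nonlinear_solution \<Omega> \<phi> Wh (sym_grad \<Omega>) F ubar \<longrightarrow>
        (\<exists>C>0. \<forall>t\<ge>0. L2_on \<Omega> (V_error \<phi> (sym_grad \<Omega>) (u (c t)) ubar) \<and>
           L2_norm \<Omega> (V_error \<phi> (sym_grad \<Omega>) (u (c t)) ubar)
             \<le> C * exp (- real_of_ereal (decay_rate \<phi>) * t)
                 * sqrt (dissipation \<Omega> \<phi> (sym_grad \<Omega>) u c 0)) \<and>
        (decay_rate \<phi> > 0 \<longrightarrow>
           ((\<lambda>t. L2_norm \<Omega> (V_error \<phi> (sym_grad \<Omega>) (u (c t)) ubar)) \<longlongrightarrow> 0) at_top))"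
proof -
  have \<Omega>: "\<Omega> \<in> lmeasurable" by (rule lmeasurable_open[OF domain(4,1)])
  have scalar: "(\<exists>C>0. \<forall>t\<ge>0. L2_on \<Omega> (V_error \<phi> (weak_grad \<Omega>) (u (c t)) ubar) \<and>
           L2_norm \<Omega> (V_error \<phi> (weak_grad \<Omega>) (u (c t)) ubar)
             \<le> C * exp (- real_of_ereal (decay_rate \<phi>) * t)
                 * sqrt (dissipation \<Omega> \<phi> (weak_grad \<Omega>) u c 0)) \<and>
        (decay_rate \<phi> > 0 \<longrightarrow>
           ((\<lambda>t. L2_norm \<Omega> (V_error \<phi> (weak_grad \<Omega>) (u (c t)) ubar)) \<longlongrightarrow> 0) at_top)"
    if spaces: "scalar_spaces \<Omega> Ch Uh" and F: "bounded_functional_on (H10 \<Omega>) (H1_norm \<Omega>) F"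
      and sol: "\<forall>b\<in>positive_cone \<Omega> Ch. weighted_solution \<Omega> \<phi> Uh (weak_grad \<Omega>) F b (u b)"
      and flow: "flow_solution \<Omega> Ch (weak_grad \<Omega>) u c0 c"
      and ubar: "nonlinear_solution \<Omega> \<phi> Uh (weak_grad \<Omega>) F ubar"
    for Uh :: "(real ^ 'd \<Rightarrow> real) set" and F u c0 c ubar
  proof -
    have Ch: "coefficient_space \<Omega> Ch" and Uh: "fin_dim_fun_space Uh" "Uh \<subseteq> H10 \<Omega>"
      and sq: "squares_in \<Omega> (weak_grad \<Omega>) Uh Ch"
      using spaces unfolding scalar_spaces_def by blast+
    have H1: "v \<in> H1 \<Omega>" if "v \<in> Uh" for v using Uh(2) that unfolding H10_def by blast
    interpret decaying_flow \<phi> \<Omega> Ch Uh "weak_grad \<Omega>" F u c0 c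
    proof unfold_locales
      fix v w assume vw: "v \<in> Uh" "w \<in> Uh"
      show "(\<lambda>x. v x - w x) \<in> Uh" by (rule fun_space_diff[OF Uh(1) vw])
      show "F (\<lambda>x. v x - w x) = F v - F w" by (rule functional_diff[OF Uh F vw])
      show "AE x in lebesgue_on \<Omega>. weak_grad \<Omega> (\<lambda>x. v x - w x) x = weak_grad \<Omega> v x - weak_grad \<Omega> w x"
        by (rule weak_grad_diff[OF domain(1) \<Omega> H1[OF vw(1)] H1[OF vw(2)]])
    next
      fix v assume "v \<in> Uh"
      show "weak_grad \<Omega> v \<in> borel_measurable (lebesgue_on \<Omega>)"
        by (rule L2_measurable[OF weak_grad_L2[OF H1[OF \<open>v \<in> Uh\<close>]]])
    next
      fix b assume "b \<in> positive_cone \<Omega> Ch"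
      then show "weighted_solution \<Omega> \<phi> Uh (weak_grad \<Omega>) F b (u b)" using sol by blast
    qed (rule standing b \<Omega> Ch sq flow a c_rate c_cases)+
    show ?thesis by (rule V_error_decay[OF ubar])
  qed
  have vector: "(\<exists>C>0. \<forall>t\<ge>0. L2_on \<Omega> (V_error \<phi> (sym_grad \<Omega>) (u (c t)) ubar) \<and>
           L2_norm \<Omega> (V_error \<phi> (sym_grad \<Omega>) (u (c t)) ubar)
             \<le> C * exp (- real_of_ereal (decay_rate \<phi>) * t)
                 * sqrt (dissipation \<Omega> \<phi> (sym_grad \<Omega>) u c 0)) \<and>
        (decay_rate \<phi> > 0 \<longrightarrow>
           ((\<lambda>t. L2_norm \<Omega> (V_error \<phi> (sym_grad \<Omega>) (u (c t)) ubar)) \<longlongrightarrow> 0) at_top)"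
    if spaces: "vector_spaces \<Omega> Ch Uh Qh" and Wh: "Wh = discretely_div_free \<Omega> Uh Qh"
      and F: "bounded_functional_on (H10_vec \<Omega>) (H1_norm_vec \<Omega>) F"
      and sol: "\<forall>b\<in>positive_cone \<Omega> Ch. weighted_solution \<Omega> \<phi> Wh (sym_grad \<Omega>) F b (u b)"
      and flow: "flow_solution \<Omega> Ch (sym_grad \<Omega>) u c0 c"
      and ubar: "nonlinear_solution \<Omega> \<phi> Wh (sym_grad \<Omega>) F ubar"
    for Uh Wh :: "(real ^ 'd \<Rightarrow> real ^ 'd) set" and Qh F u c0 c ubar
  proof -
    have Ch: "coefficient_space \<Omega> Ch" and Uh: "fin_dim_fun_space Uh" "Uh \<subseteq> H10_vec \<Omega>"
      and sqU: "squares_in \<Omega> (sym_grad \<Omega>) Uh Ch"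
      using spaces unfolding vector_spaces_def by blast+
    have WU: "Wh \<subseteq> Uh" unfolding Wh discretely_div_free_def by blast
    have sq: "squares_in \<Omega> (sym_grad \<Omega>) Wh Ch" using sqU WU unfolding squares_in_def by blast
    have H: "v \<in> H10_vec \<Omega>" if "v \<in> Wh" for v using Uh(2) WU that by blast
    interpret decaying_flow \<phi> \<Omega> Ch Wh "sym_grad \<Omega>" F u c0 c
    proof unfold_locales
      fix v w assume vw: "v \<in> Wh" "w \<in> Wh"
      show "(\<lambda>x. v x - w x) \<in> Wh"
        using vw unfolding Wh by (rule discretely_div_free_diff[OF domain(1) \<Omega> spaces])
      show "F (\<lambda>x. v x - w x) = F v - F w"
        by (rule functional_diff[OF Uh F]) (use vw WU in blast)+
      show "AE x in lebesgue_on \<Omega>. sym_grad \<Omega> (\<lambda>x. v x - w x) x = sym_grad \<Omega> v x - sym_grad \<Omega> w x"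
        by (rule sym_grad_diff[OF domain(1) \<Omega> H[OF vw(1)] H[OF vw(2)]])
    next
      fix v assume "v \<in> Wh"
      show "sym_grad \<Omega> v \<in> borel_measurable (lebesgue_on \<Omega>)"
        by (rule sym_grad_measurable[OF H[OF \<open>v \<in> Wh\<close>]])
    next
      fix b assume "b \<in> positive_cone \<Omega> Ch"
      then show "weighted_solution \<Omega> \<phi> Wh (sym_grad \<Omega>) F b (u b)" using sol by blast
    qed (rule standing b \<Omega> Ch sq flow a c_rate c_cases)+
    show ?thesis by (rule V_error_decay[OF ubar])
  qed
  show ?thesis
    by (intro conjI[of "\<forall>Uh. _ Uh" "\<forall>Uh. _ Uh"] allI impI; elim conjE) (rule scalar vector; assumption)+
qed

end
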